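(* Let $\Omega,U,H,L,r,c(\lambda),c(0),\mathcal{M}_0$ be as in the context, and assume (H1), (H2), (H3), (H4) and (A1) listed there. Then $$\lim_{\substack{\lambda\to0^+\\ r(\lambda)>0}}\left(\frac{c(\lambda)-c(0)}{r(\lambda)}\right)=\max_{\mu\in\mathcal{M}_0}\big\langle\mu,(-x)\cdot D_xL(x,v)\big\rangle,$$ $$\lim_{\substack{\lambda\to0^+\\ r(\lambda)<0}}\left(\frac{c(\lambda)-c(0)}{r(\lambda)}\right)=\min_{\mu\in\mathcal{M}_0}\big\langle\mu,(-x)\cdot D_xL(x,v)\big\rangle.$$ Thus $(c(\lambda)-c(0))/r(\lambda)$ converges as $\lambda\to0^+$ if and only if the following invariant holds: $$\big\langle\mu,(-x)\cdot D_xL(x,v)\big\rangle=c^{(1)}\qquad\text{for all }\mu\in\mathcal{M}_0,$$ where $c^{(1)}$ is a positive constant.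
   Context: $\Omega\subset\mathbb{R}^n$ is open, bounded, connected, with $0\in\Omega$. $U=B(0,R_0)$ is an open ball with $2\Omega\subseteq U$, and $H:\overline U\times\mathbb{R}^n\to\mathbb{R}$ is continuous. The Lagrangian is $L(x,v)=\sup_{p\in\mathbb{R}^n}(p\cdot v-H(x,p))$, $(x,v)\in\overline U\times\mathbb{R}^n$. Assumptions: (H1) for each $R>0$ there is $C_R$ with $|H(x,p)-H(y,p)|\le C_R|x-y|$ and $|H(x,p)-H(x,q)|\le C_R|p-q|$ for $x,y\in\overline U$, $|p|,|q|\le R$; (H2) $\lim_{|p|\to\infty}\min_{x\in\overline U}H(x,p)=+\infty$; (H3) $p\mapsto H(x,p)$ is convex for each $x\in\overline U$; (H4) for $v\in\mathbb{R}^n$, $x\mapsto L(x,v)$ is continuously differentiable on $\overline U$; (A1) $\Omega$ is star-shaped with respect to the origin and there is $\kappa>0$ such that $\mathrm{dist}(x,\overline\Omega)\ge\kappa s$ for all $s>0$ and $x\in(1+s)\partial\Omega$. $r:(0,\infty)\to\mathbb{R}$ is continuous with $r(\lambda)\to0$ as $\lambda\to0^+$, and is not identically zero near $0$; limits of $(c(\lambda)-c(0))/r(\lambda)$ are taken along $\lambda$ with $r(\lambda)\ne0$. Only small $\lambda>0$ matter. The additive eigenvalue of $H$ in an open set $D\subset U$ is $\inf\{c\in\mathbb{R}:H(x,Dv)\le c\text{ has a viscosity subsolution in }D\}$. $c(0)$ is the additive eigenvalue of $H$ in $\Omega$ and $c(\lambda)$, $\lambda>0$, that of $H$ in $(1+r(\lambda))\Omega$.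 Normalization (made without loss of generality; not an additional restriction on $H$): the solutions considered satisfy an a priori gradient bound $|Du|\le C_H$ with $C_H$ depending only on $H$, so the values of $H(x,p)$ for large $|p|$ are irrelevant; after modifying $H$ for large $|p|$ one may assume that there is $h>0$ such that $H(x,p)=\sup_{|v|\le h}(p\cdot v-L(x,v))$ for $(x,p)\in\overline\Omega\times\mathbb{R}^n$ and $L(x,v)=\sup_{p}(p\cdot v-H(x,p))$ for $(x,v)\in\overline\Omega\times\overline B_h$, with $L\in C(\overline\Omega\times\overline B_h)$, where $\overline B_h$ is the closed ball of radius $h$ at $0$ in $\mathbb{R}^n$. The measures below are defined with this normalization. Viscosity Mather measures: for $f\in C(\overline\Omega\times\overline B_h)$ put $H_f(x,p)=\max_{|v|\le h}(p\cdot v-f(x,v))$. Let $\mathcal{G}_{0,\Omega}$ be the set of $f\in C(\overline\Omega\times\overline B_h)$ for which there is $u\in C(\overline\Omega)$ that is a viscosity subsolution of $H_f(x,Du)\le0$ in $\Omega$. For a Radon measure $\mu$ on $\overline\Omega\times\overline B_h$ write $\langle\mu,f\rangle=\int f\,d\mu$, and let $\mathcal{G}'_{0,\Omega}$ be the set of Radon measures with $\langle\mu,f\rangle\ge0$ for all $f\in\mathcal{G}_{0,\Omega}$. One has $-c(0)=\min\langle\mu,L\rangle$ over probability measures $\mu\in\mathcal{G}'_{0,\Omega}$; $\mathcal{M}_0$ is the set of probability measures $\mu\in\mathcal{G}'_{0,\Omega}$ with $\langle\mu,L\rangle=-c(0)$.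
   Formalization: Mended: in (H4) D_xL is jointly continuous in (x,v); c^(1) is nonnegative, not positive (H=|p|^2 gives 0); "converges ⇒ invariant" is claimed only when r takes both signs near 0 (if r>0 the quotient always converges). As literally stated, each of these claims is false. *)

theory Defs
  imports "HOL-Probability.Probability"
begin

text \<open>Throughout, \<open>'a\<close> is \<open>\<real>\<^sup>n\<close>, \<open>U\<close> is \<open>ball 0 R0\<close>, and the Hamiltonian \<open>H x p\<close> is only ever evaluated at
  \<open>x \<in> cball 0 R0\<close>.\<close>

definition dilate :: "real \<Rightarrow> 'a::real_vector set \<Rightarrow> 'a set" where
  "dilate t S = (\<lambda>x. t *\<^sub>R x) ` S"

definition gradient :: "('a::euclidean_space \<Rightarrow> real) \<Rightarrow> 'a \<Rightarrow> 'a" where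
  "gradient f x = (THE g. GDERIV f x :> g)"

definition viscosity_subsolution ::
  "('a::euclidean_space \<Rightarrow> 'a \<Rightarrow> real) \<Rightarrow> 'a set \<Rightarrow> ('a \<Rightarrow> real) \<Rightarrow> bool" where
  "viscosity_subsolution F D u \<longleftrightarrow>
     continuous_on D u \<and>
     (\<forall>\<phi> \<phi>' x. (\<forall>y\<in>D. GDERIV \<phi> y :> \<phi>' y) \<longrightarrow> continuous_on D \<phi>' \<longrightarrow> x \<in> D \<longrightarrow>
        (\<exists>e>0. \<forall>y \<in> D \<inter> ball x e. u y - \<phi> y \<le> u x - \<phi> x) \<longrightarrow>
        F x (\<phi>' x) \<le> 0)"

definition additive_eigenvalue ::
  "('a::euclidean_space \<Rightarrow> 'a \<Rightarrow> real) \<Rightarrow> 'a set \<Rightarrow> real" where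
  "additive_eigenvalue H D = Inf {c. \<exists>v. viscosity_subsolution (\<lambda>x p. H x p - c) D v}"

definition eigenvalue_quotient ::
  "('a::euclidean_space \<Rightarrow> 'a \<Rightarrow> real) \<Rightarrow> 'a set \<Rightarrow> real \<Rightarrow> real" where
  "eigenvalue_quotient H \<Omega> s =
     (additive_eigenvalue H (dilate (1 + s) \<Omega>) - additive_eigenvalue H \<Omega>) / s"

text \<open>The supremum is meaningful where it is finite; this is part of \<open>H4\<close> below.\<close>

definition lagrangian :: "('a::euclidean_space \<Rightarrow> 'a \<Rightarrow> real) \<Rightarrow> 'a \<Rightarrow> 'a \<Rightarrow> real" where
  "lagrangian H x v = (SUP p. p \<bullet> v - H x p)"

definition H1 :: "real \<Rightarrow> ('a::euclidean_space \<Rightarrow> 'a \<Rightarrow> real) \<Rightarrow> bool" where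
  "H1 R0 H \<longleftrightarrow>
     (\<forall>R>0. \<exists>C. \<forall>x\<in>cball 0 R0. \<forall>y\<in>cball 0 R0. \<forall>p\<in>cball 0 R. \<forall>q\<in>cball 0 R.
        \<bar>H x p - H y p\<bar> \<le> C * norm (x - y) \<and> \<bar>H x p - H x q\<bar> \<le> C * norm (p - q))"

definition H2 :: "real \<Rightarrow> ('a::euclidean_space \<Rightarrow> 'a \<Rightarrow> real) \<Rightarrow> bool" where
  "H2 R0 H \<longleftrightarrow> filterlim (\<lambda>p. INF x\<in>cball 0 R0. H x p) at_top at_infinity"

definition H3 :: "real \<Rightarrow> ('a::euclidean_space \<Rightarrow> 'a \<Rightarrow> real) \<Rightarrow> bool" where
  "H3 R0 H \<longleftrightarrow> (\<forall>x\<in>cball 0 R0. convex_on UNIV (H x))"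

text \<open>The derivative \<open>D\<^sub>xL\<close> is required to be continuous in \<open>(x, v)\<close>. Continuity in \<open>x\<close> for each
  fixed \<open>v\<close> is not enough for the formula for the derivative of the eigenvalue: in \<open>\<real>\<^sup>3\<close>, with
  \<open>x = (1 + t, y)\<close> and \<open>v = (v\<^sub>1, w)\<close>, take the Lagrangian
  \<open>|v|\<^sup>2/2 + |y|\<^sup>2/2 - B t + q(t, y, w)\<close>, where \<open>q = - b (Jy \<bullet> w) \<chi>((y, w)/sqrt t)\<close> for \<open>t > 0\<close> and
  \<open>q = 0\<close> otherwise, with \<open>J\<close> a quarter turn, \<open>b > 1\<close> and \<open>\<chi>\<close> a slowly varying cutoff. On the cube
  \<open>(-1,1)\<^sup>3\<close> the only Mather measure is the point mass at \<open>((1, 0), 0)\<close>, which gives the value \<open>B\<close>, while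
  circles of radius and speed \<open>sqrt s\<close> in the dilated cube force the quotient to be at least
  \<open>B + b - 1\<close> as \<open>s\<close> decreases to 0.\<close>

definition H4 :: "real \<Rightarrow> ('a::euclidean_space \<Rightarrow> 'a \<Rightarrow> real) \<Rightarrow> bool" where
  "H4 R0 H \<longleftrightarrow>
     (\<forall>x\<in>cball 0 R0. \<forall>v. bdd_above (range (\<lambda>p. p \<bullet> v - H x p))) \<and>
     (\<exists>G. (\<forall>v. \<forall>x\<in>cball 0 R0.
             ((\<lambda>y. lagrangian H y v) has_derivative (\<lambda>w. w \<bullet> G x v)) (at x within cball 0 R0)) \<and>
          continuous_on (cball 0 R0 \<times> UNIV) (\<lambda>(x, v). G x v))"

definition A1 :: "'a::euclidean_space set \<Rightarrow> bool" where
  "A1 \<Omega> \<longleftrightarrow>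
     (\<forall>x\<in>\<Omega>. closed_segment 0 x \<subseteq> \<Omega>) \<and>
     (\<exists>\<kappa>>0. \<forall>s>0. \<forall>x\<in>dilate (1 + s) (frontier \<Omega>). \<kappa> * s \<le> infdist x (closure \<Omega>))"

definition ham :: "real \<Rightarrow> ('a::euclidean_space \<Rightarrow> 'a \<Rightarrow> real) \<Rightarrow> 'a \<Rightarrow> 'a \<Rightarrow> real" where
  "ham h f x p = (SUP v\<in>cball 0 h. p \<bullet> v - f x v)"

text \<open>A constant function is a subsolution at level \<open>max H(x, 0)\<close>, so no additive eigenvalue exceeds
  this level, and the bound below is an a priori gradient bound for all subsolutions up to it. The
  normalized Hamiltonian is \<open>ham h (lagrangian H)\<close>; it has linear growth, whereas \<open>H\<close> is superlinear
  in \<open>p\<close> because its Lagrangian is finite. Hence the two can agree only for bounded \<open>p\<close>, and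
  normalization consists in agreement in the range of the gradient bound.\<close>

definition gradient_bound :: "real \<Rightarrow> ('a::euclidean_space \<Rightarrow> 'a \<Rightarrow> real) \<Rightarrow> real \<Rightarrow> bool" where
  "gradient_bound R0 H C \<longleftrightarrow>
     (\<forall>x\<in>cball 0 R0. \<forall>p. H x p \<le> (SUP y\<in>cball 0 R0. H y 0) \<longrightarrow> norm p \<le> C)"

definition normalizing_radius :: "real \<Rightarrow> ('a::euclidean_space \<Rightarrow> 'a \<Rightarrow> real) \<Rightarrow> real \<Rightarrow> bool" where
  "normalizing_radius R0 H h \<longleftrightarrow>
     0 < h \<and>
     (\<exists>C. gradient_bound R0 H C \<and>
          (\<forall>x\<in>cball 0 R0. \<forall>p\<in>cball 0 C. H x p = ham h (lagrangian H) x p))"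

definition pairing :: "('a \<times> 'a) measure \<Rightarrow> ('a \<Rightarrow> 'a \<Rightarrow> real) \<Rightarrow> real" where
  "pairing \<mu> f = (\<integral>(x, v). f x v \<partial>\<mu>)"

definition G0 :: "'a::euclidean_space set \<Rightarrow> real \<Rightarrow> ('a \<Rightarrow> 'a \<Rightarrow> real) set" where
  "G0 \<Omega> h = {f. continuous_on (closure \<Omega> \<times> cball 0 h) (\<lambda>(x, v). f x v) \<and>
                (\<exists>u. continuous_on (closure \<Omega>) u \<and> viscosity_subsolution (ham h f) \<Omega> u)}"

text \<open>Finite Borel measures on a compact subset of \<open>\<real>\<^sup>n \<times> \<real>\<^sup>n\<close> are exactly the nonnegative Radon
  measures on it; only probability measures enter the definition of \<open>mather_measures\<close>.\<close>

definition G0_dual :: "'a::euclidean_space set \<Rightarrow> real \<Rightarrow> ('a \<times> 'a) measure set" where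
  "G0_dual \<Omega> h = {\<mu>. sets \<mu> = sets (restrict_space borel (closure \<Omega> \<times> cball 0 h)) \<and>
                     finite_measure \<mu> \<and> (\<forall>f\<in>G0 \<Omega> h. 0 \<le> pairing \<mu> f)}"

definition mather_measures ::
  "('a::euclidean_space \<Rightarrow> 'a \<Rightarrow> real) \<Rightarrow> 'a set \<Rightarrow> real \<Rightarrow> ('a \<times> 'a) measure set" where
  "mather_measures H \<Omega> h = {\<mu> \<in> G0_dual \<Omega> h. prob_space \<mu> \<and>
                              pairing \<mu> (lagrangian H) = - additive_eigenvalue H \<Omega>}"

definition DL_pairing :: "('a::euclidean_space \<Rightarrow> 'a \<Rightarrow> real) \<Rightarrow> ('a \<times> 'a) measure \<Rightarrow> real" where
  "DL_pairing H \<mu> = pairing \<mu> (\<lambda>x v. (- x) \<bullet> gradient (\<lambda>y. lagrangian H y v) x)"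

end

theory Submission
  imports Defs
begin

text \<open>
  The dilation \<open>x \<mapsto> (1 + s) x\<close> turns \<open>c(s)\<close> into the eigenvalue of the Lagrangian
  \<open>L\<^sub>s(x, v) = L((1 + s) x, v)\<close> on the fixed domain. Let \<open>P\<close> be the set of probability measures in the
  dual cone of \<open>G0\<close>, which does not depend on \<open>s\<close>. The subsolution property is preserved under sums, so
  \<open>G0\<close> is a convex cone, and separation from it gives the duality \<open>c(s) = max \<langle>\<mu>, - L\<^sub>s\<rangle>\<close> over
  \<open>\<mu> \<in> P\<close>. Since \<open>P\<close> is weakly compact and \<open>L\<^sub>s\<close> is differentiable in \<open>s\<close> uniformly on compact sets,
  the one-sided derivatives of this maximum at \<open>s = 0\<close> are the extreme values of
  \<open>\<langle>\<mu>, - x \<bullet> D\<^sub>xL\<rangle>\<close> over the maximizers at \<open>s = 0\<close>, which are the Mather measures. The derivative is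
  nonnegative because the eigenvalue increases with the domain.
\<close>

section \<open>Linear functionals dominated by sublinear ones\<close>

text \<open>Two obstacles shape the argument. The first is the representation of a separating
  functional by a measure. Separation is purely algebraic here and is done on all functions bounded
  on the compact set, discontinuous ones included. The functional can then be evaluated on
  indicators, and the measure arises as a weak limit of discrete measures. The second is that the
  cone \<open>G0\<close> is built from the normalized Hamiltonian \<open>ham h L\<close>, which
  agrees with \<open>H\<close> only for bounded momenta, while eigenvalues are defined by
  \<open>H\<close>. One direction is free, as \<open>ham h L\<close> lies below \<open>H\<close>.
  For the other, a connectedness argument along a segment of momenta turns
  \<open>ham h L x p <= c\<close> into \<open>H x p <= c\<close> whenever \<open>c\<close> is below
  the level \<open>M\<close> of the constant subsolutions.\<close>

definition sublinear_on :: "('b \<Rightarrow> real) set \<Rightarrow> (('b \<Rightarrow> real) \<Rightarrow> real) \<Rightarrow> bool" where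
  "sublinear_on V p \<longleftrightarrow>
     (\<forall>f\<in>V. \<forall>g\<in>V. p (\<lambda>x. f x + g x) \<le> p f + p g) \<and>
     (\<forall>f\<in>V. \<forall>c>0. p (\<lambda>x. c * f x) \<le> c * p f)"

lemma sublinear_onD:
  assumes "sublinear_on V p" and "f \<in> V"
  shows "g \<in> V \<Longrightarrow> p (\<lambda>x. f x + g x) \<le> p f + p g"
    and "0 < c \<Longrightarrow> p (\<lambda>x. c * f x) \<le> c * p f"
  using assms unfolding sublinear_on_def by auto

lemma sublinear_on_zero:
  assumes "sublinear_on V p" and "(\<lambda>x. 0) \<in> V"
  shows "p (\<lambda>x. 0) = 0"
proof -
  have *: "p (\<lambda>x. 0) \<le> c * p (\<lambda>x. 0)" if "c > 0" for c
    using assms that unfolding sublinear_on_def by fastforce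
  show ?thesis using *[of 2] *[of "1/2"] by simp
qed

lemma sublinear_on_uminus:
  assumes "sublinear_on V p" and V: "\<And>c f. f \<in> V \<Longrightarrow> (\<lambda>x. c * f x) \<in> V" and f: "f \<in> V"
  shows "- p (\<lambda>x. - f x) \<le> p f"
proof -
  have "(\<lambda>x. - f x) \<in> V" using V[OF f, of "-1"] by simp
  then have "p (\<lambda>x. f x + - f x) \<le> p f + p (\<lambda>x. - f x)"
    using sublinear_onD(1)[OF assms(1) f] by blast
  moreover have "p (\<lambda>x. 0) = 0"
    using sublinear_on_zero[OF assms(1)] V[OF f, of 0] by simp
  ultimately show ?thesis by simp
qed

text \<open>A minimal sublinear functional is additive: for \<open>g\<close> fixed, the functional
  \<open>f \<mapsto> inf\<^sub>t\<^sub>\<ge>\<^sub>0 (m (f + t g) - t m g)\<close> is sublinear and below \<open>m\<close>.\<close>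

lemma Hahn_Banach_functions:
  fixes V :: "('b \<Rightarrow> real) set"
  assumes p0: "sublinear_on V p0"
    and Va: "\<And>f g. f \<in> V \<Longrightarrow> g \<in> V \<Longrightarrow> (\<lambda>x. f x + g x) \<in> V"
    and Vs: "\<And>c f. f \<in> V \<Longrightarrow> (\<lambda>x. c * f x) \<in> V"
  obtains \<Lambda> where "\<And>f. f \<in> V \<Longrightarrow> \<Lambda> f \<le> p0 f"
    and "\<And>f g. f \<in> V \<Longrightarrow> g \<in> V \<Longrightarrow> \<Lambda> (\<lambda>x. f x + g x) = \<Lambda> f + \<Lambda> g"
    and "\<And>c f. f \<in> V \<Longrightarrow> \<Lambda> (\<lambda>x. c * f x) = c * \<Lambda> f"
proof -
  \<comment> \<open>Values off \<open>V\<close> are pinned to 0, so that the order \<open>P\<close>,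
    which compares all functions, only sees values on \<open>V\<close>.\<close>
  define A where "A = {p. sublinear_on V p \<and> (\<forall>f\<in>V. p f \<le> p0 f) \<and> (\<forall>f. f \<notin> V \<longrightarrow> p f = 0)}"
  \<comment> \<open>The order is reversed: a maximal element in the sense of Zorn's lemma is
    pointwise minimal.\<close>
  define P where "P = (\<lambda>p q :: ('b \<Rightarrow> real) \<Rightarrow> real. \<forall>f. q f \<le> p f)"
  have Vm: "(\<lambda>x. - f x) \<in> V" if "f \<in> V" for f using Vs[OF that, of "-1"] by simp
  \<comment> \<open>The bound is the same for all of \<open>A\<close>, so infima over chains are
    finite.\<close>
  have lower: "- p0 (\<lambda>x. - f x) \<le> p f" if "p \<in> A" "f \<in> V" for p f
  proof -
    have "- p (\<lambda>x. - f x) \<le> p f" using that Vs by (intro sublinear_on_uminus[of V]) (auto simp: A_def)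
    then show ?thesis using that Vm[of f] unfolding A_def by fastforce
  qed
  have "\<exists>m\<in>A. \<forall>a\<in>A. P m a \<longrightarrow> a = m"
  proof (rule predicate_Zorn)
    show "partial_order_on A (relation_of P A)"
      by (rule partial_order_on_relation_ofI) (auto simp: P_def fun_eq_iff intro: order_trans order_antisym)
  next
    fix C assume "C \<in> Chains (relation_of P A)"
    then have CA: "C \<subseteq> A" and tot: "\<And>p q. p \<in> C \<Longrightarrow> q \<in> C \<Longrightarrow> P p q \<or> P q p"
      unfolding Chains_def relation_of_def by auto
    show "\<exists>u\<in>A. \<forall>a\<in>C. P a u"
    proof (cases "C = {}")
      case True
      have "(\<lambda>f. if f \<in> V then p0 f else 0) \<in> A"
        using p0 Va Vs unfolding A_def sublinear_on_def by auto
      then show ?thesis using True by auto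
    next
      case False
      then obtain q where q: "q \<in> C" by auto
      define u where "u f = (if f \<in> V then INF p\<in>C. p f else 0)" for f
      have bdd: "bdd_below ((\<lambda>p. p f) ` C)" if "f \<in> V" for f
        using lower that CA by (intro bdd_belowI2) auto
      have u_le: "u f \<le> p f" if "p \<in> C" "f \<in> V" for p f
        using that unfolding u_def by (auto intro!: cINF_lower bdd)
      have u_ge: "c \<le> u f" if "f \<in> V" "\<And>p. p \<in> C \<Longrightarrow> c \<le> p f" for c f
        using that False unfolding u_def by (auto intro!: cINF_greatest)
      have sl: "sublinear_on V p" if "p \<in> C" for p using that CA by (auto simp: A_def)
      have add: "u (\<lambda>x. f x + g x) \<le> u f + u g" if f: "f \<in> V" and g: "g \<in> V" for f g
      proof -
        \<comment> \<open>In a chain the smaller of \<open>p\<close> and \<open>q\<close> is a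
          common minorant \<open>s\<close>, whose subadditivity serves both.\<close>
        have "u (\<lambda>x. f x + g x) \<le> p f + q g" if pq: "p \<in> C" "q \<in> C" for p q
        proof -
          obtain s where s: "s \<in> C" "s f \<le> p f" "s g \<le> q g"
            using tot[OF pq] pq unfolding P_def by blast
          have "u (\<lambda>x. f x + g x) \<le> s (\<lambda>x. f x + g x)" using u_le s Va f g by blast
          also have "\<dots> \<le> s f + s g" using sublinear_onD(1)[OF sl[OF s(1)] f g] .
          finally show ?thesis using s by linarith
        qed
        then have "u (\<lambda>x. f x + g x) - q g \<le> u f" if "q \<in> C" for q
          using that f by (intro u_ge) (auto simp: algebra_simps)
        then have "u (\<lambda>x. f x + g x) - u f \<le> u g"
          using g by (intro u_ge) (auto simp: algebra_simps)
        then show ?thesis by linarith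
      qed
      have "u (\<lambda>x. c * f x) \<le> c * u f" if f: "f \<in> V" and c: "c > 0" for f c
      proof -
        have "u (\<lambda>x. c * f x) / c \<le> p f" if "p \<in> C" for p
        proof -
          have "u (\<lambda>x. c * f x) \<le> c * p f"
            using u_le[OF that Vs[OF f]] sublinear_onD(2)[OF sl[OF that] f c] by (rule order_trans)
          then show ?thesis using c by (simp add: field_simps)
        qed
        then have "u (\<lambda>x. c * f x) / c \<le> u f" using f by (intro u_ge)
        then show ?thesis using c by (simp add: field_simps)
      qed
      then have "sublinear_on V u" using add unfolding sublinear_on_def by blast
      moreover have "u f \<le> p0 f" if "f \<in> V" for f
        using u_le[OF q that] q CA that unfolding A_def by fastforce
      moreover have "u f = 0" if "f \<notin> V" for f using that by (simp add: u_def)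
      ultimately have "u \<in> A" unfolding A_def by blast
      moreover have "P a u" if "a \<in> C" for a
        unfolding P_def
      proof
        fix f show "u f \<le> a f"
          using u_le[OF that] that CA by (cases "f \<in> V") (auto simp: A_def u_def)
      qed
      ultimately show ?thesis by blast
    qed
  qed
  then obtain m where m: "m \<in> A" and min: "\<And>a. a \<in> A \<Longrightarrow> P m a \<Longrightarrow> a = m" by blast
  have ms: "sublinear_on V m" using m by (simp add: A_def)
  have madd: "m (\<lambda>x. f x + g x) \<le> m f + m g" if "f \<in> V" "g \<in> V" for f g
    using sublinear_onD(1)[OF ms that] .
  have mscale: "m (\<lambda>x. c * f x) = c * m f" if "f \<in> V" "c \<ge> 0" for f c
  proof (cases "c = 0")
    case True
    then show ?thesis using sublinear_on_zero[OF ms] Vs[OF that(1), of 0] by simp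
  next
    case False
    then have c: "c > 0" using that by simp
    have "m (\<lambda>x. (1/c) * (c * f x)) \<le> (1/c) * m (\<lambda>x. c * f x)"
      using sublinear_onD(2)[OF ms Vs[OF that(1), of c], of "1/c"] c by simp
    then have "c * m f \<le> m (\<lambda>x. c * f x)" using c by (simp add: field_simps)
    moreover have "m (\<lambda>x. c * f x) \<le> c * m f" using sublinear_onD(2)[OF ms that(1) c] .
    ultimately show ?thesis by simp
  qed
  have super: "m f + m g \<le> m (\<lambda>x. f x + g x)" if f: "f \<in> V" and g: "g \<in> V" for f g
  proof -
    define k where "k f t = m (\<lambda>x. f x + t * g x) - t * m g" for f t
    define q where "q f = (if f \<in> V then INF t\<in>{0..}. k f t else 0)" for f
    have Vt: "(\<lambda>x. f x + t * g x) \<in> V" if "f \<in> V" for f t using Va Vs g that by blast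
    \<comment> \<open>Subadditivity for \<open>t * g = (f + t * g) + (- f)\<close> keeps the infimum
      finite.\<close>
    have klow: "- m (\<lambda>x. - f x) \<le> k f t" if "f \<in> V" "t \<ge> 0" for f t
    proof -
      have "m (\<lambda>x. t * g x) \<le> m (\<lambda>x. f x + t * g x) + m (\<lambda>x. - f x)"
        using madd[OF Vt[OF that(1), of t] Vm[OF that(1)]] by (simp add: algebra_simps)
      then show ?thesis using mscale[OF g that(2)] by (simp add: k_def)
    qed
    have q_le: "q f \<le> k f t" if "f \<in> V" "t \<ge> 0" for f t
      using that klow[OF that(1)] unfolding q_def
      by (auto intro!: cINF_lower bdd_belowI2[where m="- m (\<lambda>x. - f x)"])
    have q_ge: "c \<le> q f" if "f \<in> V" "\<And>t. t \<ge> 0 \<Longrightarrow> c \<le> k f t" for c f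
      using that unfolding q_def by (auto intro!: cINF_greatest)
    \<comment> \<open>The parameters add up, so they can be chosen separately for each
      summand.\<close>
    have kadd: "k (\<lambda>x. f1 x + f2 x) (s + t) \<le> k f1 s + k f2 t"
      if "f1 \<in> V" "f2 \<in> V" for f1 f2 s t
    proof -
      have "(\<lambda>x. (f1 x + s * g x) + (f2 x + t * g x)) = (\<lambda>x. f1 x + f2 x + (s + t) * g x)"
        by (simp add: algebra_simps)
      then show ?thesis using madd[OF Vt[OF that(1), of s] Vt[OF that(2), of t]]
        by (simp add: k_def algebra_simps)
    qed
    have add: "q (\<lambda>x. f1 x + f2 x) \<le> q f1 + q f2" if f: "f1 \<in> V" "f2 \<in> V" for f1 f2
    proof -
      have *: "q (\<lambda>x. f1 x + f2 x) \<le> k f1 s + k f2 t" if "s \<ge> 0" "t \<ge> 0" for s t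
        using q_le[OF Va[OF f], of "s + t"] kadd[OF f, of s t] that by linarith
      then have "q (\<lambda>x. f1 x + f2 x) - k f2 t \<le> q f1" if "t \<ge> 0" for t
        using that f by (intro q_ge) (auto simp: algebra_simps)
      then have "q (\<lambda>x. f1 x + f2 x) - q f1 \<le> q f2"
        using f by (intro q_ge) (auto simp: algebra_simps)
      then show ?thesis by linarith
    qed
    have "q (\<lambda>x. c * f x) \<le> c * q f" if f: "f \<in> V" and c: "c > 0" for f c
    proof -
      have "q (\<lambda>x. c * f x) / c \<le> k f t" if "t \<ge> 0" for t
      proof -
        have "k (\<lambda>x. c * f x) (c * t) = c * k f t"
          using mscale[OF Vt[OF f, of t], of c] c by (simp add: k_def algebra_simps)
        then have "q (\<lambda>x. c * f x) \<le> c * k f t"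
          using q_le[OF Vs[OF f], of "c * t" c] c that by simp
        then show ?thesis using c by (simp add: field_simps)
      qed
      then have "q (\<lambda>x. c * f x) / c \<le> q f" using f by (intro q_ge)
      then show ?thesis using c by (simp add: field_simps)
    qed
    then have qs: "sublinear_on V q" using add unfolding sublinear_on_def by blast
    have qm: "q f \<le> m f" if "f \<in> V" for f using q_le[OF that, of 0] by (simp add: k_def)
    have "q \<in> A" using qs qm m unfolding A_def by (auto simp: q_def intro: order_trans)
    moreover have "P m q" unfolding P_def
    proof
      fix f show "q f \<le> m f" using qm m by (cases "f \<in> V") (auto simp: A_def q_def)
    qed
    ultimately have "q = m" using min by blast
    \<comment> \<open>Minimality has turned \<open>q\<close> into \<open>m\<close>; the value
      \<open>t = 1\<close> now reads \<open>m f <= m (f + g) - m g\<close>.\<close>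
    then show ?thesis using q_le[OF f, of 1] by (simp add: k_def)
  qed
  have Ladd: "m (\<lambda>x. f x + g x) = m f + m g" if "f \<in> V" "g \<in> V" for f g
    using madd[OF that] super[OF that] by simp
  have Lscale: "m (\<lambda>x. c * f x) = c * m f" if "f \<in> V" for c f
  proof (cases "c \<ge> 0")
    case True then show ?thesis using mscale that by blast
  next
    case False
    have "m (\<lambda>x. c * f x + (- c) * f x) = m (\<lambda>x. c * f x) + m (\<lambda>x. (- c) * f x)"
      using Ladd Vs that by blast
    moreover have "m (\<lambda>x. 0) = 0" using sublinear_on_zero[OF ms] Vs[OF that, of 0] by simp
    moreover have "m (\<lambda>x. (- c) * f x) = - c * m f" using mscale[OF that, of "- c"] False by simp
    ultimately show ?thesis by simp
  qed
  show thesis using that[of m] m Ladd Lscale by (auto simp: A_def)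
qed

section \<open>Weak compactness of probability measures on compact sets\<close>

text \<open>Reads the memberships in \<open>B m\<close>, \<open>B (m + 1)\<close>, ... as digits 0
  and 1 of a base 3 expansion. Base 3 leaves a gap: the digits after the first contribute at most
  1/2, so they cannot imitate a first digit 1, as they could in base 2. The offset \<open>m\<close>
  allows inductions to drop a digit.\<close>

definition ternary_code :: "(nat \<Rightarrow> 'b set) \<Rightarrow> nat \<Rightarrow> 'b \<Rightarrow> real" where
  "ternary_code B m x = (\<Sum>k. indicator (B (k + m)) x / 3 ^ k)"

lemma summable_ternary_code: "summable (\<lambda>k. indicator (B (k + m)) x / 3 ^ k :: real)"
proof (rule summable_comparison_test'[where N=0])
  show "summable (\<lambda>k. (1/3) ^ k :: real)" by (rule summable_geometric) simp
  show "norm (indicator (B (n + m)) x / 3 ^ n :: real) \<le> (1/3) ^ n" for n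
    by (simp add: indicator_def power_one_over)
qed

lemma ternary_code_Suc:
  "ternary_code B m x = indicator (B m) x + ternary_code B (Suc m) x / 3"
proof -
  have "ternary_code B m x = indicator (B m) x + (\<Sum>k. indicator (B (Suc k + m)) x / 3 ^ Suc k)"
    unfolding ternary_code_def using suminf_split_head[OF summable_ternary_code[of B m x]] by simp
  also have "(\<Sum>k. indicator (B (Suc k + m)) x / 3 ^ Suc k :: real) =
      (\<Sum>k. indicator (B (k + Suc m)) x / 3 ^ k / 3)" by (simp add: mult.commute)
  also have "\<dots> = ternary_code B (Suc m) x / 3"
    unfolding ternary_code_def by (rule suminf_divide[OF summable_ternary_code])
  finally show ?thesis .
qed

lemma ternary_code_bounds: "0 \<le> ternary_code B m x" "ternary_code B m x \<le> 3/2"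
proof -
  show "0 \<le> ternary_code B m x" unfolding ternary_code_def
    by (rule suminf_nonneg[OF summable_ternary_code]) simp
  have "ternary_code B m x \<le> (\<Sum>k. (1/3) ^ k)" unfolding ternary_code_def
    by (rule suminf_le[OF _ summable_ternary_code summable_geometric])
      (simp_all add: indicator_def power_one_over)
  also have "\<dots> = 3/2" by (subst suminf_geometric) simp_all
  finally show "ternary_code B m x \<le> 3/2" .
qed

text \<open>A digit 1 puts the value at or above 1, a digit 0 at or below 1/2.\<close>

lemma ternary_code_first_digit:
  assumes lt: "\<bar>ternary_code B m x - ternary_code B m y\<bar> < 1/2"
  shows "x \<in> B m \<longleftrightarrow> y \<in> B m"
proof (rule ccontr)
  note bounds = ternary_code_bounds[of B "Suc m" x] ternary_code_bounds[of B "Suc m" y]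
  assume "\<not> (x \<in> B m \<longleftrightarrow> y \<in> B m)"
  then consider "x \<in> B m" "y \<notin> B m" | "x \<notin> B m" "y \<in> B m" by blast
  then show False
  proof cases
    case 1
    then have "ternary_code B m x = 1 + ternary_code B (Suc m) x / 3"
      "ternary_code B m y = ternary_code B (Suc m) y / 3"
      by (simp_all add: ternary_code_Suc[of B m])
    then show False using bounds lt by linarith
  next
    case 2
    then have "ternary_code B m y = 1 + ternary_code B (Suc m) y / 3"
      "ternary_code B m x = ternary_code B (Suc m) x / 3"
      by (simp_all add: ternary_code_Suc[of B m])
    then show False using bounds lt by linarith
  qed
qed

lemma ternary_code_digits:
  assumes "\<bar>ternary_code B m x - ternary_code B m y\<bar> < (1/2) / 3 ^ n" and "k \<le> n"
  shows "x \<in> B (k + m) \<longleftrightarrow> y \<in> B (k + m)"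
  using assms
proof (induction n arbitrary: m k)
  case (0 m k)
  then show ?case using ternary_code_first_digit[of B m x y] by simp
next
  case (Suc n m k)
  have "(1/2) / 3 ^ Suc n \<le> (1/2::real)" by (simp add: field_simps) (simp add: mult_ge1_I)
  then have "\<bar>ternary_code B m x - ternary_code B m y\<bar> < 1/2" using Suc.prems by linarith
  then have eq: "x \<in> B m \<longleftrightarrow> y \<in> B m"
    by (rule ternary_code_first_digit)
  then have "indicator (B m) x = (indicator (B m) y :: real)" by (simp add: indicator_def)
  \<comment> \<open>Dropping a common first digit triples the difference; the power of 3 in the
    bound pays for this.\<close>
  then have "ternary_code B (Suc m) x - ternary_code B (Suc m) y =
      3 * (ternary_code B m x - ternary_code B m y)"
    using ternary_code_Suc[of B m x] ternary_code_Suc[of B m y] by simp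
  then have "\<bar>ternary_code B (Suc m) x - ternary_code B (Suc m) y\<bar> =
      3 * \<bar>ternary_code B m x - ternary_code B m y\<bar>"
    by (simp only: abs_mult abs_numeral)
  then have "\<bar>ternary_code B (Suc m) x - ternary_code B (Suc m) y\<bar> < (1/2) / 3 ^ n"
    using Suc.prems(1) by (simp add: field_simps)
  then show ?case
    using Suc.IH[of "Suc m" "k - 1"] Suc.prems(2) eq by (cases k) auto
qed

text \<open>The code is not continuous, but it is Borel and its inverse is uniformly continuous; this
  transports weak compactness from the real line to \<open>K\<close>.\<close>

lemma compact_real_code:
  fixes K :: "'b::euclidean_space set"
  assumes K: "compact K"
  obtains \<sigma> :: "'b \<Rightarrow> real" and g :: "real \<Rightarrow> 'b"
  where "\<sigma> \<in> borel_measurable borel" "\<And>x. \<sigma> x \<in> {0..3/2}" "continuous_on UNIV g"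
    "\<And>x. x \<in> K \<Longrightarrow> g (\<sigma> x) = x"
proof -
  obtain D :: "'b set" where D: "countable D" "\<And>X. open X \<Longrightarrow> X \<noteq> {} \<Longrightarrow> \<exists>d\<in>D. d \<in> X"
    using countable_dense_setE by blast
  have "D \<noteq> {}" using D(2)[of UNIV] by auto
  define a where "a = from_nat_into D"
  have a: "\<exists>i. a i \<in> X" if "open X" "X \<noteq> {}" for X
    using D that from_nat_into_surj[OF D(1)] unfolding a_def by metis
  \<comment> \<open>A countable base: balls with centres in a dense sequence and radii
    \<open>1 / (j + 1)\<close>, the two indices being packed into one.\<close>
  define B where "B k = ball (a (fst (prod_decode k))) (1 / real (Suc (snd (prod_decode k))))" for k
  have Bcov: "\<exists>k. x \<in> B k \<and> (\<forall>y z. y \<in> B k \<longrightarrow> z \<in> B k \<longrightarrow> dist y z < e)" if "e > 0" for x e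
  proof -
    obtain j where j: "1 / real (Suc j) < e / 2" using nat_approx_posE[of "e/2"] \<open>e > 0\<close> by auto
    obtain i where i: "a i \<in> ball x (1 / real (Suc j))" using a[of "ball x (1 / real (Suc j))"] by auto
    have Bk: "B (prod_encode (i, j)) = ball (a i) (1 / real (Suc j))" by (simp add: B_def)
    show ?thesis
    proof (rule exI[of _ "prod_encode (i, j)"], intro conjI allI impI)
      show "x \<in> B (prod_encode (i, j))" using i by (simp add: Bk dist_commute)
      fix y z assume "y \<in> B (prod_encode (i, j))" "z \<in> B (prod_encode (i, j))"
      then have "dist (a i) y < 1 / real (Suc j)" "dist (a i) z < 1 / real (Suc j)" by (simp_all add: Bk)
      then show "dist y z < e" using j dist_triangle3[of y z "a i"] by linarith
    qed
  qed
  define \<sigma> where "\<sigma> = ternary_code B 0"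
  \<comment> \<open>Finitely many small balls cover \<open>K\<close>. Close codes agree in all
    digits up to the largest index of these balls, so the two points share one of them.\<close>
  have sep: "\<exists>d>0. \<forall>x\<in>K. \<forall>y\<in>K. \<bar>\<sigma> x - \<sigma> y\<bar> < d \<longrightarrow> dist x y < e" if e: "e > 0" for e
  proof -
    define F where "F = {k. \<forall>y z. y \<in> B k \<longrightarrow> z \<in> B k \<longrightarrow> dist y z < e}"
    have "K \<subseteq> (\<Union>k\<in>F. B k)" using Bcov[OF e] unfolding F_def by blast
    moreover have "open (B k)" for k by (simp add: B_def)
    ultimately obtain F' where F': "F' \<subseteq> F" "finite F'" "K \<subseteq> (\<Union>k\<in>F'. B k)"
      using compactE_image[OF K, of F B] by metis
    obtain n where n: "\<forall>k\<in>F'. k \<le> n" using F'(2) finite_nat_set_iff_bounded_le by blast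
    show ?thesis
    proof (intro exI[of _ "(1/2) / 3 ^ n"] conjI ballI impI)
      fix x y assume "x \<in> K" "y \<in> K" and lt: "\<bar>\<sigma> x - \<sigma> y\<bar> < (1/2) / 3 ^ n"
      then obtain k where "k \<in> F'" "x \<in> B k" using F' by blast
      moreover have "y \<in> B k"
        using ternary_code_digits[of B 0 x y n k] lt n calculation by (auto simp: \<sigma>_def)
      ultimately show "dist x y < e" using F' unfolding F_def by blast
    qed simp
  qed
  have inj: "inj_on \<sigma> K"
  proof (rule inj_onI, rule ccontr)
    fix x y assume "x \<in> K" "y \<in> K" "\<sigma> x = \<sigma> y" "x \<noteq> y"
    then show False using sep[of "dist x y"] by force
  qed
  have uc: "uniformly_continuous_on (\<sigma> ` K) (inv_into K \<sigma>)"
    unfolding uniformly_continuous_on_def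
  proof (intro allI impI)
    fix e :: real assume "e > 0"
    then obtain d where d: "d > 0" "\<forall>x\<in>K. \<forall>y\<in>K. \<bar>\<sigma> x - \<sigma> y\<bar> < d \<longrightarrow> dist x y < e" using sep by blast
    then show "\<exists>d>0. \<forall>x\<in>\<sigma> ` K. \<forall>x'\<in>\<sigma> ` K. dist x' x < d \<longrightarrow> dist (inv_into K \<sigma> x') (inv_into K \<sigma> x) < e"
      using inj by (intro exI[of _ d]) (auto simp: inv_into_f_f dist_real_def)
  qed
  \<comment> \<open>The image of \<open>K\<close> need not be closed, hence the extension first to
    its closure and then to the whole line.\<close>
  obtain g0 where g0: "uniformly_continuous_on (closure (\<sigma> ` K)) g0"
    "\<And>x. x \<in> \<sigma> ` K \<Longrightarrow> inv_into K \<sigma> x = g0 x"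
    using uniformly_continuous_on_extension_on_closure[OF uc] by metis
  obtain g where g: "continuous_on UNIV g" "\<And>x. x \<in> closure (\<sigma> ` K) \<Longrightarrow> g x = g0 x"
    using Dugundji[of UNIV UNIV "closure (\<sigma> ` K)" g0]
      uniformly_continuous_imp_continuous[OF g0(1)] by auto
  show thesis
  proof (rule that)
    have "B k \<in> sets borel" for k by (simp add: B_def)
    then show "\<sigma> \<in> borel_measurable borel"
      unfolding \<sigma>_def ternary_code_def
      by (intro borel_measurable_suminf borel_measurable_divide borel_measurable_indicator borel_measurable_const)
    show "\<sigma> x \<in> {0..3/2}" for x using ternary_code_bounds[of B 0 x] by (simp add: \<sigma>_def)
    show "g (\<sigma> x) = x" if "x \<in> K" for x
      using g(2)[of "\<sigma> x"] g0(2)[of "\<sigma> x"] that closure_subset[of "\<sigma> ` K"] inv_into_f_f[OF inj that]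
      by auto
  qed (rule g(1))
qed

section \<open>Integrals and weak limits on a compact set\<close>

abbreviation prob_on :: "'b::topological_space set \<Rightarrow> 'b measure \<Rightarrow> bool" where
  "prob_on K \<mu> \<equiv> sets \<mu> = sets (restrict_space borel K) \<and> prob_space \<mu>"

lemma prob_on_space: "sets \<mu> = sets (restrict_space borel K) \<Longrightarrow> space \<mu> = K"
  by (drule sets_eq_imp_space_eq) (simp add: space_restrict_space)

lemma prob_on_measurable:
  fixes f :: "'b::euclidean_space \<Rightarrow> real"
  assumes "sets \<mu> = sets (restrict_space borel K)" "continuous_on K f"
  shows "f \<in> borel_measurable \<mu>"
  using borel_measurable_continuous_on_restrict[OF assms(2)] measurable_cong_sets[OF assms(1) refl] by blast

lemma prob_on_integrable:
  fixes f :: "'b::euclidean_space \<Rightarrow> real"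
  assumes "compact K" "sets \<mu> = sets (restrict_space borel K)" "finite_measure \<mu>" "continuous_on K f"
  shows "integrable \<mu> f"
proof -
  obtain B where "\<And>x. x \<in> K \<Longrightarrow> norm (f x) \<le> B"
    using compact_imp_bounded[OF compact_continuous_image[OF assms(4,1)]] by (auto simp: bounded_iff)
  then show ?thesis
    using prob_on_measurable[OF assms(2,4)] assms(3) prob_on_space[OF assms(2)]
    by (intro finite_measure.integrable_const_bound[where B=B]) auto
qed

text \<open>The code pushes the measures forward to a bounded interval, where tightness is automatic
  and Helly's selection theorem gives a weak limit. The decoder \<open>g\<close> is continuous and
  inverts the code on \<open>K\<close>, so integrals of \<open>f\<close> become integrals of the
  continuous function \<open>f (g t)\<close>; this is why the code itself may jump.\<close>

lemma weak_sequential_compactness: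
  fixes K :: "'b::euclidean_space set"
  assumes K: "compact K" and \<mu>: "\<And>n::nat. prob_on K (\<mu> n)"
  shows "\<exists>r \<nu>. strict_mono r \<and> prob_on K \<nu> \<and>
    (\<forall>f::'b \<Rightarrow> real. continuous_on K f \<longrightarrow> (\<lambda>n. integral\<^sup>L (\<mu> (r n)) f) \<longlonglongrightarrow> integral\<^sup>L \<nu> f)"
proof -
  obtain \<sigma> :: "'b \<Rightarrow> real" and g where
    \<sigma>: "\<sigma> \<in> borel_measurable borel" "\<And>x. \<sigma> x \<in> {0..3/2}" and g: "continuous_on UNIV g" and
    g\<sigma>: "\<And>x. x \<in> K \<Longrightarrow> g (\<sigma> x) = x"
    using compact_real_code[OF K] by metis
  have gm[measurable]: "g \<in> borel_measurable borel" using borel_measurable_continuous_onI[OF g] .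
  have sp: "space (\<mu> n) = K" for n using \<mu> prob_on_space by blast
  have \<sigma>m[measurable]: "\<sigma> \<in> borel_measurable (\<mu> n)" for n
    using measurable_restrict_space1[OF \<sigma>(1), of K] \<mu>[of n] measurable_cong_sets by blast
  define m where "m n = distr (\<mu> n) borel \<sigma>" for n :: nat
  have rd: "real_distribution (m n)" for n
    unfolding m_def real_distribution_def real_distribution_axioms_def
    using \<mu>[of n] \<sigma>m[of n] by (simp add: prob_space.prob_space_distr)
  have "tight m"
    unfolding tight_def
  proof (intro conjI allI impI rd)
    fix e :: real assume "e > 0"
    have "measure (m n) {-1<..2} = 1" for n
    proof -
      have "\<sigma> -` {-1<..2} \<inter> space (\<mu> n) = space (\<mu> n)"
      proof -
        have "-1 < \<sigma> x \<and> \<sigma> x \<le> 2" for x using \<sigma>(2)[of x] by auto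
        then show ?thesis by auto
      qed
      then show ?thesis using \<mu>[of n] by (simp add: m_def measure_distr prob_space.prob_space)
    qed
    then show "\<exists>a b. a < b \<and> (\<forall>n. 1 - e < measure (m n) {a<..b})"
      using \<open>e > 0\<close> by (intro exI[of _ "-1"] exI[of _ 2]) simp
  qed
  then obtain r M where r: "strict_mono (r :: nat \<Rightarrow> nat)" and M: "real_distribution M"
    and wc: "weak_conv_m (m \<circ> id \<circ> r) M"
    using tight_imp_convergent_subsubsequence[of m id] strict_mono_id by (auto simp: id_def)
  interpret M: real_distribution M by fact
  have conv: "(\<lambda>n. integral\<^sup>L (\<mu> (r n)) f) \<longlonglongrightarrow> integral\<^sup>L M (\<lambda>t. f (g t))"
    if f: "continuous_on UNIV f" "\<And>x. norm (f x) \<le> B" for f :: "'b \<Rightarrow> real" and B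
  proof -
    have fg: "continuous_on UNIV (\<lambda>t. f (g t))"
      using continuous_on_compose2[OF f(1) g] by simp
    have "(\<lambda>n. integral\<^sup>L (m (r n)) (\<lambda>t. f (g t))) \<longlonglongrightarrow> integral\<^sup>L M (\<lambda>t. f (g t))"
      using weak_conv_imp_integral_bdd_continuous_conv[of "\<lambda>n. m (r n)" M "\<lambda>t. f (g t)" B] rd M wc fg f(2)
      by (simp add: continuous_on_eq_continuous_at comp_def)
    moreover have "integral\<^sup>L (m (r n)) (\<lambda>t. f (g t)) = integral\<^sup>L (\<mu> (r n)) f" for n
    proof -
      have "integral\<^sup>L (m (r n)) (\<lambda>t. f (g t)) = integral\<^sup>L (\<mu> (r n)) (\<lambda>x. f (g (\<sigma> x)))"
        unfolding m_def using borel_measurable_continuous_onI[OF fg] by (intro integral_distr) auto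
      also have "\<dots> = integral\<^sup>L (\<mu> (r n)) f"
        by (rule Bochner_Integration.integral_cong) (auto simp: sp g\<sigma>)
      finally show ?thesis .
    qed
    ultimately show ?thesis by simp
  qed
  define N where "N = distr M borel g"
  have Np: "prob_space N" unfolding N_def by (rule M.prob_space_distr) simp
  interpret N: prob_space N by fact
  have Nint: "integral\<^sup>L N f = integral\<^sup>L M (\<lambda>t. f (g t))" if "continuous_on UNIV f" for f :: "'b \<Rightarrow> real"
    unfolding N_def using borel_measurable_continuous_onI[OF that] by (intro integral_distr) auto
  have Kne: "K \<noteq> {}" using prob_space.not_empty[of "\<mu> 0"] \<mu>[of 0] sp[of 0] by auto
  have Kc: "closed K" using K compact_imp_closed by blast
  have Kb: "K \<in> sets borel" using Kc by auto
  have AEK: "AE x in N. x \<in> K"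
  proof -
    \<comment> \<open>A bounded continuous function that vanishes exactly on \<open>K\<close>. Its
      integrals are 0 along the sequence, hence in the limit, so \<open>N\<close> is concentrated on
      \<open>K\<close>.\<close>
    define d where "d x = min 1 (infdist x K)" for x
    have dc: "continuous_on UNIV d" unfolding d_def by (intro continuous_intros)
    have db: "norm (d x) \<le> 1" for x unfolding d_def by (auto simp: infdist_nonneg)
    have "integral\<^sup>L (\<mu> (r n)) d = 0" for n
    proof -
      have "integral\<^sup>L (\<mu> (r n)) d = integral\<^sup>L (\<mu> (r n)) (\<lambda>x. 0)"
        by (rule Bochner_Integration.integral_cong) (auto simp: sp d_def)
      then show ?thesis by simp
    qed
    then have "integral\<^sup>L N d = 0"
      using conv[OF dc db] Nint[OF dc] LIMSEQ_unique[OF _ tendsto_const] by fastforce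
    moreover have "integrable N d"
      using borel_measurable_continuous_onI[OF dc] db
      by (intro N.integrable_const_bound[where B=1]) (auto simp: N_def)
    moreover have "0 \<le> d x" for x by (simp add: d_def infdist_nonneg)
    ultimately have "AE x in N. d x = 0" using integral_nonneg_eq_0_iff_AE by blast
    then show ?thesis
    proof eventually_elim
      case (elim x)
      then have "infdist x K = 0" by (simp add: d_def min_def split: if_splits)
      then show ?case using in_closed_iff_infdist_zero[OF Kc Kne] by blast
    qed
  qed
  define \<nu> where "\<nu> = restrict_space N K"
  have setsN: "sets N = sets borel" by (simp add: N_def)
  have \<nu>s: "sets \<nu> = sets (restrict_space borel K)"
    unfolding \<nu>_def by (rule sets_restrict_space_cong[OF setsN])
  have KN: "K \<in> sets N" using Kb setsN by simp
  have "emeasure N K = 1" using AEK KN N.emeasure_eq_1_AE by blast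
  then have "prob_space \<nu>" unfolding \<nu>_def using KN by (intro prob_space_restrict_space)
  moreover have "(\<lambda>n. integral\<^sup>L (\<mu> (r n)) f) \<longlonglongrightarrow> integral\<^sup>L \<nu> f" if f: "continuous_on K f" for f :: "'b \<Rightarrow> real"
  proof -
    obtain B where B: "B \<ge> 0" "\<And>x. x \<in> K \<Longrightarrow> norm (f x) \<le> B"
    proof -
      obtain B where "\<And>x. x \<in> K \<Longrightarrow> norm (f x) \<le> B"
        using compact_imp_bounded[OF compact_continuous_image[OF f K]] by (auto simp: bounded_iff)
      then show thesis using that[of "max B 0"] by fastforce
    qed
    \<comment> \<open>Convergence is known for bounded continuous functions on the whole space; an
      extension with the same bound reduces \<open>f\<close> to that case.\<close>
    obtain F where F: "continuous_on UNIV F" "\<And>x. x \<in> K \<Longrightarrow> F x = f x" "\<And>x. norm (F x) \<le> B"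
      using Tietze[OF f _ B(1), of UNIV] B(2) Kc by auto
    have "integral\<^sup>L (\<mu> (r n)) F = integral\<^sup>L (\<mu> (r n)) f" for n
      by (rule Bochner_Integration.integral_cong) (auto simp: sp F)
    then have "(\<lambda>n. integral\<^sup>L (\<mu> (r n)) f) \<longlonglongrightarrow> integral\<^sup>L N F" using conv[OF F(1,3)] Nint[OF F(1)] by simp
    moreover have "integral\<^sup>L N F = integral\<^sup>L \<nu> f"
    proof -
      have Fm: "F \<in> borel_measurable N" using borel_measurable_continuous_onI[OF F(1)] by (simp add: N_def)
      have "integral\<^sup>L \<nu> f = integral\<^sup>L \<nu> F"
        by (rule Bochner_Integration.integral_cong) (auto simp: prob_on_space[OF \<nu>s] F)
      also have "\<dots> = integral\<^sup>L N (\<lambda>x. indicator K x *\<^sub>R F x)"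
        unfolding \<nu>_def using Kb setsN by (subst integral_restrict_space) auto
      also have "\<dots> = integral\<^sup>L N F"
        using AEK Fm Kb setsN by (intro integral_cong_AE) (auto simp: indicator_def)
      finally show ?thesis by simp
    qed
    ultimately show ?thesis by simp
  qed
  ultimately show ?thesis using r \<nu>s by blast
qed

text \<open>A form of the Riesz representation theorem. The values of the functional on indicators
  of small cells are the weights of a discrete measure, whose integral of \<open>f\<close> misses
  \<open>\<Lambda> f\<close> by at most the oscillation of \<open>f\<close> at the scale of the
  cells. A weak limit of such measures represents the functional on continuous functions.\<close>

lemma positive_functional_measure:
  fixes K :: "'b::euclidean_space set" and \<Lambda> :: "('b \<Rightarrow> real) \<Rightarrow> real"
  assumes K: "compact K"
    and upper: "\<And>f c. bounded (f ` K) \<Longrightarrow> (\<And>x. x \<in> K \<Longrightarrow> f x \<le> c) \<Longrightarrow> \<Lambda> f \<le> c"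
    and add: "\<And>f g. bounded (f ` K) \<Longrightarrow> bounded (g ` K) \<Longrightarrow> \<Lambda> (\<lambda>x. f x + g x) = \<Lambda> f + \<Lambda> g"
    and scale: "\<And>c f. bounded (f ` K) \<Longrightarrow> \<Lambda> (\<lambda>x. c * f x) = c * \<Lambda> f"
  obtains \<mu> where "prob_on K \<mu>" "\<And>f. continuous_on K f \<Longrightarrow> integral\<^sup>L \<mu> f = \<Lambda> f"
proof -
  have bs: "bounded ((\<lambda>x. c * f x) ` K)" if "bounded (f ` K)" for f :: "'b \<Rightarrow> real" and c
    using bounded_scaling[OF that, of c] by (simp add: image_image)
  have ba: "bounded ((\<lambda>x. f x + g x) ` K)" if "bounded (f ` K)" "bounded (g ` K)" for f g :: "'b \<Rightarrow> real"
    using bounded_plus_comp[OF that] .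
  have close: "\<bar>\<Lambda> f - \<Lambda> g\<bar> \<le> e" if "bounded (f ` K)" "bounded (g ` K)" "\<And>x. x \<in> K \<Longrightarrow> \<bar>f x - g x\<bar> \<le> e" for f g e
  proof -
    have *: "\<Lambda> f - \<Lambda> g \<le> e" if b: "bounded (f ` K)" "bounded (g ` K)" "\<And>x. x \<in> K \<Longrightarrow> \<bar>f x - g x\<bar> \<le> e" for f g
    proof -
      have "\<Lambda> (\<lambda>x. f x + (-1) * g x) \<le> e"
        using b(3) by (intro upper ba bs b) (auto simp: abs_le_iff)
      then show ?thesis using add[OF b(1) bs[OF b(2), of "-1"]] scale[OF b(2), of "-1"] by simp
    qed
    show ?thesis using *[of f g] *[of g f] that by (simp add: abs_minus_commute abs_le_iff)
  qed
  have bind: "bounded (indicator A ` K :: real set)" for A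
    by (rule boundedI[of _ 1]) (auto simp: indicator_def)
  have discrete: "\<exists>\<mu>. prob_on K \<mu> \<and> (\<forall>f e. continuous_on K f \<longrightarrow>
      (\<forall>x\<in>K. \<forall>y\<in>K. dist x y < d \<longrightarrow> \<bar>f x - f y\<bar> \<le> e) \<longrightarrow> \<bar>integral\<^sup>L \<mu> f - \<Lambda> f\<bar> \<le> e)" if d: "d > 0" for d
  proof -
    obtain F where F: "F \<subseteq> K" "finite F" "K \<subseteq> (\<Union>a\<in>F. ball a d)"
      using compactE_image[OF K, of K "\<lambda>a. ball a d"] d by force
    \<comment> \<open>The level sets of \<open>q\<close> cut \<open>K\<close> into cells, each
      within distance \<open>d\<close> of one point of \<open>F\<close>.\<close>
    define q where "q x = (SOME a. a \<in> F \<and> dist x a < d)" for x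
    have q: "q x \<in> F" "dist x (q x) < d" if "x \<in> K" for x
    proof -
      have "\<exists>a. a \<in> F \<and> dist x a < d" using F(3) that by (force simp: dist_commute)
      then have "q x \<in> F \<and> dist x (q x) < d" unfolding q_def by (rule someI_ex)
      then show "q x \<in> F" "dist x (q x) < d" by auto
    qed
    define I where "I a = (indicator {x. q x = a} :: 'b \<Rightarrow> real)" for a
    have bI: "bounded (I a ` K)" for a unfolding I_def by (rule bind)
    define w where "w a = \<Lambda> (I a)" for a
    have w0: "w a \<ge> 0" for a
      using upper[OF bs[OF bI[of a], of "-1"], of 0] scale[OF bI[of a], of "-1"]
      by (auto simp: w_def I_def)
    have sum: "\<Lambda> (\<lambda>x. \<Sum>a\<in>S. f a * I a x) = (\<Sum>a\<in>S. f a * w a) \<and>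
        bounded ((\<lambda>x. \<Sum>a\<in>S. f a * I a x) ` K)" if "finite S" for S f
      using that
    proof (induction S)
      case empty
      then show ?case using scale[OF bind[of "{}"], of 0] bs[OF bind[of "{}"], of 0] by auto
    next
      case (insert b S)
      then show ?case
        using add[OF bs[OF bI[of b], of "f b"], of "\<lambda>x. \<Sum>a\<in>S. f a * I a x"]
          scale[OF bI[of b], of "f b"] ba[OF bs[OF bI[of b], of "f b"]]
        by (simp add: w_def)
    qed
    have fq: "(\<Sum>a\<in>F. f a * I a x) = f (q x)" if "x \<in> K" for f :: "'b \<Rightarrow> real" and x
      using q(1)[OF that] F(2) by (simp add: I_def indicator_def)
    have near: "\<bar>(\<Sum>a\<in>F. f a * w a) - \<Lambda> f\<bar> \<le> e"
      if "bounded (f ` K)" "\<forall>x\<in>K. \<forall>y\<in>K. dist x y < d \<longrightarrow> \<bar>f x - f y\<bar> \<le> e" for f e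
    proof -
      \<comment> \<open>On \<open>K\<close> the sum is the step function \<open>f (q x)\<close>,
        which is within \<open>e\<close> of \<open>f\<close>.\<close>
      have "\<bar>\<Lambda> (\<lambda>x. \<Sum>a\<in>F. f a * I a x) - \<Lambda> f\<bar> \<le> e"
      proof (rule close)
        fix x assume "x \<in> K"
        then show "\<bar>(\<Sum>a\<in>F. f a * I a x) - f x\<bar> \<le> e"
          using that(2) q[OF \<open>x \<in> K\<close>] F(1) fq[of x f] by (force simp: abs_minus_commute)
      qed (use sum[OF F(2), of f] that in auto)
      then show ?thesis using sum[OF F(2), of f] by simp
    qed
    have one: "\<Lambda> (\<lambda>x. 1) = 1"
    proof -
      have b: "bounded ((\<lambda>x. 1::real) ` K)" by (rule boundedI[of _ 1]) auto
      show ?thesis using upper[OF b, of 1] upper[OF bs[OF b, of "-1"], of "-1"] scale[OF b, of "-1"] by auto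
    qed
    have "\<bar>(\<Sum>a\<in>F. 1 * w a) - \<Lambda> (\<lambda>x. 1)\<bar> \<le> 0"
      by (rule near[of "\<lambda>x. 1"]) (auto intro: boundedI[of _ 1])
    then have w1: "(\<Sum>a\<in>F. w a) = 1" using one by simp
    define P where "P = point_measure F (\<lambda>a. ennreal (w a))"
    have "emeasure P F = (\<Sum>a\<in>F. ennreal (w a))"
      unfolding P_def using F(2) by (subst emeasure_point_measure_finite) auto
    also have "\<dots> = 1" using w0 w1 by (simp add: sum_ennreal)
    finally have Pp: "prob_space P" by (intro prob_spaceI) (simp add: P_def space_point_measure)
    define \<mu> where "\<mu> = distr P (restrict_space borel K) id"
    have idm: "id \<in> measurable P (restrict_space borel K)"
      unfolding P_def using F(1) by (auto simp: measurable_def space_point_measure sets_point_measure space_restrict_space)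
    have "prob_on K \<mu>" unfolding \<mu>_def using prob_space.prob_space_distr[OF Pp idm] by simp
    moreover have "integral\<^sup>L \<mu> f = (\<Sum>a\<in>F. f a * w a)" if "continuous_on K f" for f :: "'b \<Rightarrow> real"
    proof -
      have "integral\<^sup>L \<mu> f = integral\<^sup>L P f"
        unfolding \<mu>_def using integral_distr[OF idm borel_measurable_continuous_on_restrict[OF that]] by simp
      also have "\<dots> = (\<Sum>a\<in>F. w a * f a)"
        unfolding P_def using w0 F(2) by (simp add: lebesgue_integral_point_measure_finite)
      finally show ?thesis by (simp add: mult.commute)
    qed
    ultimately show ?thesis
      using near compact_imp_bounded[OF compact_continuous_image[OF _ K]] by (intro exI[of _ \<mu>]) auto
  qed
  define good where "good n \<mu> \<longleftrightarrow> prob_on K \<mu> \<and> (\<forall>f e. continuous_on K f \<longrightarrow>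
      (\<forall>x\<in>K. \<forall>y\<in>K. dist x y < 1 / real (Suc n) \<longrightarrow> \<bar>f x - f y\<bar> \<le> e) \<longrightarrow> \<bar>integral\<^sup>L \<mu> f - \<Lambda> f\<bar> \<le> e)"
    for n \<mu>
  have "\<exists>\<mu>. good n \<mu>" for n unfolding good_def by (rule discrete) simp
  then obtain \<mu> where "\<And>n. good n (\<mu> n)" by metis
  then have \<mu>: "\<And>n. prob_on K (\<mu> n)" and near: "\<And>n f e. continuous_on K f \<Longrightarrow>
      (\<forall>x\<in>K. \<forall>y\<in>K. dist x y < 1 / real (Suc n) \<longrightarrow> \<bar>f x - f y\<bar> \<le> e) \<Longrightarrow> \<bar>integral\<^sup>L (\<mu> n) f - \<Lambda> f\<bar> \<le> e"
    unfolding good_def by blast+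
  obtain r \<nu> where r: "strict_mono r" and \<nu>: "prob_on K \<nu>" and
    lim: "\<And>f::'b \<Rightarrow> real. continuous_on K f \<Longrightarrow> (\<lambda>n. integral\<^sup>L (\<mu> (r n)) f) \<longlonglongrightarrow> integral\<^sup>L \<nu> f"
    using weak_sequential_compactness[where \<mu>=\<mu>, OF K \<mu>] by blast
  have "integral\<^sup>L \<nu> f = \<Lambda> f" if f: "continuous_on K f" for f
  proof -
    have "(\<lambda>n. integral\<^sup>L (\<mu> n) f) \<longlonglongrightarrow> \<Lambda> f"
    proof (rule metric_LIMSEQ_I)
      fix e :: real assume e: "e > 0"
      obtain d where d: "d > 0" "\<And>x y. x \<in> K \<Longrightarrow> y \<in> K \<Longrightarrow> dist y x < d \<Longrightarrow> dist (f y) (f x) < e/2"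
        using compact_uniformly_continuous[OF f K] e unfolding uniformly_continuous_on_def
        by (metis half_gt_zero)
      obtain N where N: "1 / real (Suc N) < d" using nat_approx_posE[OF d(1)] by auto
      show "\<exists>N. \<forall>n\<ge>N. dist (integral\<^sup>L (\<mu> n) f) (\<Lambda> f) < e"
      proof (intro exI[of _ N] allI impI)
        fix n assume "N \<le> n"
        then have "1 / real (Suc n) \<le> 1 / real (Suc N)" by (simp add: frac_le)
        then have "\<bar>integral\<^sup>L (\<mu> n) f - \<Lambda> f\<bar> \<le> e/2"
          using d(2) N by (intro near[OF f]) (force simp: dist_real_def intro: less_imp_le)
        then show "dist (integral\<^sup>L (\<mu> n) f) (\<Lambda> f) < e" using e by (simp add: dist_real_def)
      qed
    qed
    then have "(\<lambda>n. integral\<^sup>L (\<mu> (r n)) f) \<longlonglongrightarrow> \<Lambda> f"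
      using LIMSEQ_subseq_LIMSEQ[OF _ r] by (simp add: comp_def)
    then show ?thesis using lim[OF f] LIMSEQ_unique by blast
  qed
  then show thesis using that \<nu> by blast
qed

section \<open>Dual cones of measures and the envelope theorem\<close>

lemma prob_on_integral_diff_le:
  fixes f g :: "'b::euclidean_space \<Rightarrow> real"
  assumes K: "compact K" and \<mu>: "prob_on K \<mu>" and f: "continuous_on K f" and g: "continuous_on K g"
    and le: "\<And>x. x \<in> K \<Longrightarrow> \<bar>f x - g x\<bar> \<le> e"
  shows "\<bar>integral\<^sup>L \<mu> f - integral\<^sup>L \<mu> g\<bar> \<le> e"
proof -
  interpret prob_space \<mu> using \<mu> by blast
  have i: "integrable \<mu> f" "integrable \<mu> g"
    using prob_on_integrable[OF K] \<mu> f g finite_measure_axioms by blast+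
  have sp: "space \<mu> = K" using \<mu> prob_on_space by blast
  have "f x \<le> g x + e" "g x \<le> f x + e" if "x \<in> space \<mu>" for x using le[of x] that by (auto simp: sp)
  then have "integral\<^sup>L \<mu> f \<le> integral\<^sup>L \<mu> (\<lambda>x. g x + e)" "integral\<^sup>L \<mu> g \<le> integral\<^sup>L \<mu> (\<lambda>x. f x + e)"
    using i by (intro integral_mono; simp)+
  then show ?thesis using i by (simp add: prob_space)
qed

text \<open>Minimizing the supremum of \<open>f + \<gamma>\<close> over the cone gives a sublinear
  functional. A linear functional below it is at most the supremum of \<open>f\<close> (take
  \<open>\<gamma> = 0\<close>) and is nonnegative on the cone (evaluate at
  \<open>- \<gamma>\<close>). The hypothesis \<open>nonneg\<close> keeps the infimum above minus
  infinity.\<close>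

lemma cone_dual_measure:
  fixes K :: "'b::euclidean_space set" and \<Gamma> :: "('b \<Rightarrow> real) set"
  assumes K: "compact K"
    and bounded: "\<And>\<gamma>. \<gamma> \<in> \<Gamma> \<Longrightarrow> bounded (\<gamma> ` K)"
    and zero: "(\<lambda>x. 0) \<in> \<Gamma>"
    and add: "\<And>\<gamma> \<gamma>'. \<gamma> \<in> \<Gamma> \<Longrightarrow> \<gamma>' \<in> \<Gamma> \<Longrightarrow> (\<lambda>x. \<gamma> x + \<gamma>' x) \<in> \<Gamma>"
    and scale: "\<And>\<gamma> c. \<gamma> \<in> \<Gamma> \<Longrightarrow> c > 0 \<Longrightarrow> (\<lambda>x. c * \<gamma> x) \<in> \<Gamma>"
    and nonneg: "\<And>\<gamma> e. \<gamma> \<in> \<Gamma> \<Longrightarrow> e > 0 \<Longrightarrow> \<exists>x\<in>K. - e < \<gamma> x"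
  obtains \<mu> where "prob_on K \<mu>" "\<And>\<gamma>. \<gamma> \<in> \<Gamma> \<Longrightarrow> continuous_on K \<gamma> \<Longrightarrow> 0 \<le> integral\<^sup>L \<mu> \<gamma>"
proof -
  have Kne: "K \<noteq> {}" using nonneg[OF zero zero_less_one] by auto
  define V where "V = {f :: 'b \<Rightarrow> real. bounded (f ` K)}"
  have Va: "(\<lambda>x. f x + g x) \<in> V" if "f \<in> V" "g \<in> V" for f g
    using that bounded_plus_comp[of f K g] by (auto simp: V_def)
  have Vs: "(\<lambda>x. c * f x) \<in> V" if "f \<in> V" for c f
    using that bounded_scaling[of "f ` K" c] by (auto simp: V_def image_image)
  have \<Gamma>V: "\<gamma> \<in> V" if "\<gamma> \<in> \<Gamma>" for \<gamma> using bounded[OF that] by (simp add: V_def)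
  define S where "S f \<gamma> = (SUP x\<in>K. f x + \<gamma> x)" for f \<gamma> :: "'b \<Rightarrow> real"
  have S_ge: "f x + \<gamma> x \<le> S f \<gamma>" if "f \<in> V" "\<gamma> \<in> \<Gamma>" "x \<in> K" for f \<gamma> x
  proof -
    have "bounded ((\<lambda>x. f x + \<gamma> x) ` K)" using Va[OF that(1) \<Gamma>V[OF that(2)]] by (simp add: V_def)
    then show ?thesis unfolding S_def using that(3) by (intro cSUP_upper bounded_imp_bdd_above)
  qed
  have S_le: "S f \<gamma> \<le> c" if "\<And>x. x \<in> K \<Longrightarrow> f x + \<gamma> x \<le> c" for f \<gamma> c
    unfolding S_def using Kne that by (intro cSUP_least)
  define p where "p f = (INF \<gamma>\<in>\<Gamma>. S f \<gamma>)" for f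
  have p_le: "p f \<le> S f \<gamma>" if "f \<in> V" "\<gamma> \<in> \<Gamma>" for f \<gamma>
  proof -
    have "\<exists>B. \<forall>x\<in>K. \<bar>f x\<bar> \<le> B" using \<open>f \<in> V\<close> by (auto simp: V_def bounded_iff)
    then obtain B where B: "\<And>x. x \<in> K \<Longrightarrow> \<bar>f x\<bar> \<le> B" by blast
    have "- B - 1 \<le> S f \<gamma>" if \<gamma>: "\<gamma> \<in> \<Gamma>" for \<gamma>
    proof -
      obtain x where x: "x \<in> K" "- 1 < \<gamma> x" using nonneg[OF \<gamma> zero_less_one] by auto
      show ?thesis using S_ge[OF \<open>f \<in> V\<close> \<gamma> x(1)] x(2) B[OF x(1)] by linarith
    qed
    then show ?thesis unfolding p_def using that(2) by (intro cINF_lower bdd_belowI2)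
  qed
  have p_ge: "c \<le> p f" if "\<And>\<gamma>. \<gamma> \<in> \<Gamma> \<Longrightarrow> c \<le> S f \<gamma>" for c f
    unfolding p_def using zero that by (intro cINF_greatest) auto
  have "sublinear_on V p"
    unfolding sublinear_on_def
  proof (intro conjI ballI allI impI)
    fix f g assume f: "f \<in> V" and g: "g \<in> V"
    have *: "p (\<lambda>x. f x + g x) \<le> S f \<gamma> + S g \<gamma>'" if "\<gamma> \<in> \<Gamma>" "\<gamma>' \<in> \<Gamma>" for \<gamma> \<gamma>'
    proof -
      have "p (\<lambda>x. f x + g x) \<le> S (\<lambda>x. f x + g x) (\<lambda>x. \<gamma> x + \<gamma>' x)" by (intro p_le Va f g add that)
      also have "\<dots> \<le> S f \<gamma> + S g \<gamma>'"
      proof (rule S_le)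
        fix x assume "x \<in> K"
        then show "f x + g x + (\<gamma> x + \<gamma>' x) \<le> S f \<gamma> + S g \<gamma>'"
          using S_ge[OF f that(1), of x] S_ge[OF g that(2), of x] by linarith
      qed
      finally show ?thesis .
    qed
    have "p (\<lambda>x. f x + g x) - S g \<gamma>' \<le> p f" if \<gamma>': "\<gamma>' \<in> \<Gamma>" for \<gamma>'
    proof (rule p_ge)
      fix \<gamma> assume "\<gamma> \<in> \<Gamma>"
      then show "p (\<lambda>x. f x + g x) - S g \<gamma>' \<le> S f \<gamma>" using *[OF _ \<gamma>', of \<gamma>] by linarith
    qed
    then have "p (\<lambda>x. f x + g x) - p f \<le> p g" by (intro p_ge) (simp add: algebra_simps)
    then show "p (\<lambda>x. f x + g x) \<le> p f + p g" by linarith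
  next
    fix f :: "'b \<Rightarrow> real" and c :: real assume f: "f \<in> V" and c: "0 < c"
    have "p (\<lambda>x. c * f x) / c \<le> S f \<gamma>" if "\<gamma> \<in> \<Gamma>" for \<gamma>
    proof -
      have "p (\<lambda>x. c * f x) \<le> S (\<lambda>x. c * f x) (\<lambda>x. c * \<gamma> x)" by (intro p_le Vs f scale that c)
      also have "\<dots> \<le> c * S f \<gamma>"
      proof (rule S_le)
        fix x assume "x \<in> K"
        then have "c * (f x + \<gamma> x) \<le> c * S f \<gamma>" using S_ge[OF f that] c by (intro mult_left_mono) auto
        then show "c * f x + c * \<gamma> x \<le> c * S f \<gamma>" by (simp add: distrib_left)
      qed
      finally show ?thesis using c by (simp add: pos_divide_le_eq mult.commute)
    qed
    then have "p (\<lambda>x. c * f x) / c \<le> p f" by (rule p_ge)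
    then show "p (\<lambda>x. c * f x) \<le> c * p f" using c by (simp add: pos_divide_le_eq mult.commute)
  qed
  then obtain \<Lambda> where \<Lambda>: "\<And>f. f \<in> V \<Longrightarrow> \<Lambda> f \<le> p f"
    "\<And>f g. f \<in> V \<Longrightarrow> g \<in> V \<Longrightarrow> \<Lambda> (\<lambda>x. f x + g x) = \<Lambda> f + \<Lambda> g"
    "\<And>c f. f \<in> V \<Longrightarrow> \<Lambda> (\<lambda>x. c * f x) = c * \<Lambda> f"
    by (rule Hahn_Banach_functions) (use Va Vs in auto)
  have upper: "\<Lambda> f \<le> c" if "bounded (f ` K)" "\<And>x. x \<in> K \<Longrightarrow> f x \<le> c" for f c
  proof -
    have "f \<in> V" using that by (simp add: V_def)
    then have "\<Lambda> f \<le> S f (\<lambda>x. 0)" using \<Lambda>(1) p_le[OF _ zero] order_trans by blast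
    also have "\<dots> \<le> c" using that by (intro S_le) auto
    finally show ?thesis .
  qed
  obtain \<mu> where \<mu>: "prob_on K \<mu>" "\<And>f. continuous_on K f \<Longrightarrow> integral\<^sup>L \<mu> f = \<Lambda> f"
    using positive_functional_measure[OF K, of \<Lambda>] upper \<Lambda>(2,3) unfolding V_def mem_Collect_eq by blast
  have "0 \<le> integral\<^sup>L \<mu> \<gamma>" if \<gamma>: "\<gamma> \<in> \<Gamma>" "continuous_on K \<gamma>" for \<gamma>
  proof -
    have V: "(\<lambda>x. (-1) * \<gamma> x) \<in> V" by (rule Vs[OF \<Gamma>V[OF \<gamma>(1)]])
    have "\<Lambda> (\<lambda>x. (-1) * \<gamma> x) \<le> S (\<lambda>x. (-1) * \<gamma> x) \<gamma>" using \<Lambda>(1)[OF V] p_le[OF V \<gamma>(1)] by linarith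
    also have "\<dots> \<le> 0" by (rule S_le) simp
    finally show ?thesis using \<mu>(2)[OF \<gamma>(2)] \<Lambda>(3)[OF \<Gamma>V[OF \<gamma>(1)], of "-1"] by simp
  qed
  then show thesis using that \<mu>(1) by blast
qed

text \<open>Danskin's argument. Testing \<open>c s\<close> with a minimizer for \<open>s = 0\<close>
  bounds the quotient from below; testing \<open>c 0\<close> with a minimizer \<open>m s\<close> for
  \<open>s\<close> bounds it from above. By weak compactness the \<open>m s\<close> accumulate only
  at minimizers for \<open>s = 0\<close>, where the two bounds meet. Since \<open>c s\<close> is
  minus a minimum, \<open>D\<close> is the derivative of \<open>- ell\<close>.\<close>

lemma envelope_right_derivative:
  fixes K :: "'b::euclidean_space set" and ell :: "real \<Rightarrow> 'b \<Rightarrow> real" and c :: "real \<Rightarrow> real"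
  assumes K: "compact K" and \<delta>0: "0 < \<delta>0"
    and prob: "\<And>\<mu>. \<mu> \<in> P \<Longrightarrow> prob_on K \<mu>"
    and closed: "\<And>\<mu> \<nu>. (\<And>n::nat. \<mu> n \<in> P) \<Longrightarrow> prob_on K \<nu> \<Longrightarrow>
      (\<And>f::'b \<Rightarrow> real. continuous_on K f \<Longrightarrow> (\<lambda>n. integral\<^sup>L (\<mu> n) f) \<longlonglongrightarrow> integral\<^sup>L \<nu> f) \<Longrightarrow> \<nu> \<in> P"
    and cont: "\<And>s. 0 \<le> s \<Longrightarrow> s < \<delta>0 \<Longrightarrow> continuous_on K (ell s)" and D: "continuous_on K D"
    and lower: "\<And>s \<mu>. 0 \<le> s \<Longrightarrow> s < \<delta>0 \<Longrightarrow> \<mu> \<in> P \<Longrightarrow> - c s \<le> integral\<^sup>L \<mu> (ell s)"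
    and attained: "\<And>s. 0 \<le> s \<Longrightarrow> s < \<delta>0 \<Longrightarrow> \<exists>\<mu>\<in>P. integral\<^sup>L \<mu> (ell s) = - c s"
    and unif: "\<And>\<epsilon>. \<epsilon> > 0 \<Longrightarrow> \<exists>\<delta>>0. \<forall>s. 0 < s \<and> s < \<delta> \<longrightarrow> (\<forall>z\<in>K. \<bar>ell s z - ell 0 z + s * D z\<bar> \<le> \<epsilon> * s)"
  shows "\<exists>\<mu>\<in>P. integral\<^sup>L \<mu> (ell 0) = - c 0 \<and>
    (\<forall>\<nu>\<in>P. integral\<^sup>L \<nu> (ell 0) = - c 0 \<longrightarrow> integral\<^sup>L \<nu> D \<le> integral\<^sup>L \<mu> D) \<and>
    ((\<lambda>s. (c s - c 0) / s) \<longlongrightarrow> integral\<^sup>L \<mu> D) (at_right 0)"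
proof -
  define q where "q s = (c s - c 0) / s" for s
  obtain m where m: "\<And>s. 0 \<le> s \<Longrightarrow> s < \<delta>0 \<Longrightarrow> m s \<in> P \<and> integral\<^sup>L (m s) (ell s) = - c s"
    using attained by metis
  have c0: "continuous_on K (ell 0)" using cont \<delta>0 by simp
  have int: "integrable \<mu> f" if "\<mu> \<in> P" "continuous_on K f" for \<mu> and f :: "'b \<Rightarrow> real"
    using prob_on_integrable[OF K _ _ that(2)] prob[OF that(1)]
    by (auto simp: prob_space_def)
  have expand: "\<bar>integral\<^sup>L \<mu> (ell s) - integral\<^sup>L \<mu> (ell 0) + s * integral\<^sup>L \<mu> D\<bar> \<le> \<epsilon> * s"
    if \<mu>: "\<mu> \<in> P" and s: "0 < s" "s < \<delta>0" and le: "\<forall>z\<in>K. \<bar>ell s z - ell 0 z + s * D z\<bar> \<le> \<epsilon> * s" for \<mu> s \<epsilon>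
  proof -
    have cs: "continuous_on K (ell s)" using cont s by simp
    have cr: "continuous_on K (\<lambda>z. ell 0 z - s * D z)" by (intro continuous_intros c0 D)
    have "\<bar>integral\<^sup>L \<mu> (ell s) - integral\<^sup>L \<mu> (\<lambda>z. ell 0 z - s * D z)\<bar> \<le> \<epsilon> * s"
    proof (rule prob_on_integral_diff_le[OF K prob[OF \<mu>] cs cr])
      fix z assume "z \<in> K"
      then show "\<bar>ell s z - (ell 0 z - s * D z)\<bar> \<le> \<epsilon> * s" using le by (simp add: algebra_simps)
    qed
    moreover have "integral\<^sup>L \<mu> (\<lambda>z. ell 0 z - s * D z) = integral\<^sup>L \<mu> (ell 0) - s * integral\<^sup>L \<mu> D"
      using int[OF \<mu> c0] int[OF \<mu> D] by simp
    ultimately show ?thesis by (simp add: algebra_simps)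
  qed
  have near: "\<exists>\<delta>>0. \<forall>s. 0 < s \<and> s < \<delta> \<longrightarrow> s < \<delta>0 \<and>
      (\<forall>\<mu>\<in>P. \<bar>integral\<^sup>L \<mu> (ell s) - integral\<^sup>L \<mu> (ell 0) + s * integral\<^sup>L \<mu> D\<bar> \<le> \<epsilon> * s)" if \<epsilon>: "\<epsilon> > 0" for \<epsilon>
  proof -
    obtain \<delta> where \<delta>: "\<delta> > 0" "\<forall>s. 0 < s \<and> s < \<delta> \<longrightarrow> (\<forall>z\<in>K. \<bar>ell s z - ell 0 z + s * D z\<bar> \<le> \<epsilon> * s)"
      using unif[OF \<epsilon>] by blast
    show ?thesis using \<delta> \<delta>0 expand by (intro exI[of _ "min \<delta> \<delta>0"]) auto
  qed
  have q_lower: "\<forall>\<^sub>F s in at_right 0. integral\<^sup>L \<nu> D - \<epsilon> \<le> q s"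
    if \<nu>: "\<nu> \<in> P" "integral\<^sup>L \<nu> (ell 0) = - c 0" and \<epsilon>: "\<epsilon> > 0" for \<nu> \<epsilon>
  proof -
    obtain \<delta> where \<delta>: "\<delta> > 0" "\<forall>s. 0 < s \<and> s < \<delta> \<longrightarrow> s < \<delta>0 \<and>
      (\<forall>\<mu>\<in>P. \<bar>integral\<^sup>L \<mu> (ell s) - integral\<^sup>L \<mu> (ell 0) + s * integral\<^sup>L \<mu> D\<bar> \<le> \<epsilon> * s)"
      using near[OF \<epsilon>] by blast
    have "integral\<^sup>L \<nu> D - \<epsilon> \<le> q s" if s: "0 < s" "s < \<delta>" for s
    proof -
      have s0: "s < \<delta>0" using \<delta>(2) s by blast
      have "integral\<^sup>L \<nu> (ell s) - integral\<^sup>L \<nu> (ell 0) + s * integral\<^sup>L \<nu> D \<le> \<epsilon> * s"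
        using \<delta>(2) s \<nu>(1) by (meson abs_le_D1)
      moreover have "- c s \<le> integral\<^sup>L \<nu> (ell s)" using lower[of s \<nu>] s s0 \<nu>(1) by simp
      ultimately have "(integral\<^sup>L \<nu> D - \<epsilon>) * s \<le> c s - c 0" using \<nu>(2) by (simp add: algebra_simps)
      then show ?thesis using s by (simp add: q_def pos_le_divide_eq)
    qed
    then show ?thesis using \<delta>(1) unfolding eventually_at_right_field by (intro exI[of _ \<delta>]) auto
  qed
  have q_upper: "\<forall>\<^sub>F s in at_right 0. q s \<le> integral\<^sup>L (m s) D + \<epsilon>" if \<epsilon>: "\<epsilon> > 0" for \<epsilon>
  proof -
    obtain \<delta> where \<delta>: "\<delta> > 0" "\<forall>s. 0 < s \<and> s < \<delta> \<longrightarrow> s < \<delta>0 \<and>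
      (\<forall>\<mu>\<in>P. \<bar>integral\<^sup>L \<mu> (ell s) - integral\<^sup>L \<mu> (ell 0) + s * integral\<^sup>L \<mu> D\<bar> \<le> \<epsilon> * s)"
      using near[OF \<epsilon>] by blast
    have "q s \<le> integral\<^sup>L (m s) D + \<epsilon>" if s: "0 < s" "s < \<delta>" for s
    proof -
      have s0: "s < \<delta>0" using \<delta>(2) s by blast
      have ms: "m s \<in> P" "integral\<^sup>L (m s) (ell s) = - c s" using m[of s] s s0 by auto
      have "- (integral\<^sup>L (m s) (ell s) - integral\<^sup>L (m s) (ell 0) + s * integral\<^sup>L (m s) D) \<le> \<epsilon> * s"
        using \<delta>(2) s ms(1) by (meson abs_le_D2)
      moreover have "- c 0 \<le> integral\<^sup>L (m s) (ell 0)" using lower[of 0 "m s"] \<delta>0 ms(1) by simp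
      ultimately have "c s - c 0 \<le> (integral\<^sup>L (m s) D + \<epsilon>) * s" using ms(2) by (simp add: algebra_simps)
      then show ?thesis using s by (simp add: q_def pos_divide_le_eq)
    qed
    then show ?thesis using \<delta>(1) unfolding eventually_at_right_field by (intro exI[of _ \<delta>]) auto
  qed
  have limit: "\<exists>r \<nu>. strict_mono (r :: nat \<Rightarrow> nat) \<and> \<nu> \<in> P \<and> integral\<^sup>L \<nu> (ell 0) = - c 0 \<and>
      (\<lambda>n. integral\<^sup>L (m (s (r n))) D) \<longlonglongrightarrow> integral\<^sup>L \<nu> D"
    if s: "\<And>n::nat. 0 < s n \<and> s n < \<delta>0" "s \<longlonglongrightarrow> 0" for s
  proof -
    have ms: "m (s n) \<in> P" "integral\<^sup>L (m (s n)) (ell (s n)) = - c (s n)" for n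
      using m[of "s n"] s(1)[of n] by auto
    obtain r \<nu> where r: "strict_mono (r :: nat \<Rightarrow> nat)" and \<nu>: "prob_on K \<nu>" and
      lim: "\<And>f::'b \<Rightarrow> real. continuous_on K f \<Longrightarrow> (\<lambda>n. integral\<^sup>L (m (s (r n))) f) \<longlonglongrightarrow> integral\<^sup>L \<nu> f"
      using weak_sequential_compactness[where \<mu>="\<lambda>n. m (s n)", OF K prob[OF ms(1)]] by blast
    have \<nu>P: "\<nu> \<in> P" by (rule closed[of "\<lambda>n. m (s (r n))"]) (use ms \<nu> lim in auto)
    obtain B where B: "\<And>\<mu>. \<mu> \<in> P \<Longrightarrow> \<bar>integral\<^sup>L \<mu> D\<bar> \<le> B"
    proof -
      have "bounded (D ` K)" by (rule compact_imp_bounded[OF compact_continuous_image[OF D K]])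
      then obtain B where "\<And>x. x \<in> K \<Longrightarrow> \<bar>D x - 0\<bar> \<le> B" by (auto simp: bounded_iff)
      then have "\<bar>integral\<^sup>L \<mu> D - integral\<^sup>L \<mu> (\<lambda>x. 0)\<bar> \<le> B" if "\<mu> \<in> P" for \<mu>
        using prob_on_integral_diff_le[OF K prob[OF that] D, of "\<lambda>x. 0" B] by simp
      then have "\<And>\<mu>. \<mu> \<in> P \<Longrightarrow> \<bar>integral\<^sup>L \<mu> D\<bar> \<le> B" by simp
      then show thesis by (rule that)
    qed
    obtain \<delta> where \<delta>: "\<delta> > 0" "\<forall>s. 0 < s \<and> s < \<delta> \<longrightarrow> s < \<delta>0 \<and>
      (\<forall>\<mu>\<in>P. \<bar>integral\<^sup>L \<mu> (ell s) - integral\<^sup>L \<mu> (ell 0) + s * integral\<^sup>L \<mu> D\<bar> \<le> 1 * s)"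
      using near[OF zero_less_one] by blast
    \<comment> \<open>Passing from \<open>ell 0\<close> to \<open>ell t\<close> changes every
      integral by at most \<open>t * (B + 1)\<close>; the comparison of \<open>m t\<close> with
      \<open>m 0\<close> pays this twice.\<close>
    have upp: "integral\<^sup>L (m t) (ell 0) \<le> - c 0 + 2 * (t * (B + 1))" if t: "0 < t" "t < \<delta>" for t
    proof -
      have t0: "t < \<delta>0" using \<delta>(2) t by blast
      have dif: "\<bar>integral\<^sup>L \<mu> (ell t) - integral\<^sup>L \<mu> (ell 0)\<bar> \<le> t * (B + 1)" if "\<mu> \<in> P" for \<mu>
      proof -
        have "\<bar>integral\<^sup>L \<mu> (ell t) - integral\<^sup>L \<mu> (ell 0) + t * integral\<^sup>L \<mu> D\<bar> \<le> 1 * t"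
          using \<delta>(2) t that by blast
        moreover have "\<bar>t * integral\<^sup>L \<mu> D\<bar> \<le> t * B" using B[OF that] t by (simp add: abs_mult)
        ultimately show ?thesis by (simp add: algebra_simps)
      qed
      have mt: "m t \<in> P" "integral\<^sup>L (m t) (ell t) = - c t" using m[of t] t t0 by auto
      have m0: "m 0 \<in> P" "integral\<^sup>L (m 0) (ell 0) = - c 0" using m[of 0] \<delta>0 by auto
      have "- c t \<le> integral\<^sup>L (m 0) (ell t)" using lower[of t "m 0"] m0 t t0 by simp
      then show ?thesis using dif[OF mt(1)] dif[OF m0(1)] mt(2) m0(2) by linarith
    qed
    have sr: "(\<lambda>n. s (r n)) \<longlonglongrightarrow> 0" using LIMSEQ_subseq_LIMSEQ[OF s(2) r] by (simp add: comp_def)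
    have "\<forall>\<^sub>F n in sequentially. s (r n) < \<delta>" using order_tendstoD(2)[OF sr \<delta>(1)] .
    then have "\<forall>\<^sub>F n in sequentially. integral\<^sup>L (m (s (r n))) (ell 0) \<le> - c 0 + 2 * (s (r n) * (B + 1))"
      by eventually_elim (use upp s in auto)
    moreover have "(\<lambda>n. - c 0 + 2 * (s (r n) * (B + 1))) \<longlonglongrightarrow> - c 0 + 2 * (0 * (B + 1))"
      by (intro tendsto_intros sr)
    ultimately have "integral\<^sup>L \<nu> (ell 0) \<le> - c 0 + 2 * (0 * (B + 1))"
      using tendsto_le[OF trivial_limit_sequentially _ lim[OF c0]] by blast
    then have "integral\<^sup>L \<nu> (ell 0) = - c 0" using lower[of 0 \<nu>] \<delta>0 \<nu>P by simp
    then show ?thesis using r \<nu>P lim[OF D] by blast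
  qed
  have seq: "(\<lambda>n. s (r n)) \<longlonglongrightarrow> 0 \<and> filterlim (\<lambda>n. s (r n)) (at_right 0) sequentially"
    if "\<And>n::nat. 0 < s n \<and> s n < \<delta>0" "s \<longlonglongrightarrow> 0" "strict_mono (r :: nat \<Rightarrow> nat)" for s :: "nat \<Rightarrow> real" and r
  proof -
    have "(\<lambda>n. s (r n)) \<longlonglongrightarrow> 0" using LIMSEQ_subseq_LIMSEQ[OF that(2,3)] by (simp add: comp_def)
    moreover have "s (r n) \<in> {0<..} \<and> s (r n) \<noteq> 0" for n using that(1)[of "r n"] by simp
    ultimately show ?thesis by (auto simp: filterlim_at)
  qed
  \<comment> \<open>Some sequence tending to 0; the shift \<open>n + 2\<close> keeps already its
    first term strictly below \<open>\<delta>0\<close>.\<close>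
  define s1 where "s1 n = \<delta>0 / real (n + 2)" for n :: nat
  have s1: "\<And>n. 0 < s1 n \<and> s1 n < \<delta>0" using \<delta>0 by (auto simp: s1_def field_simps intro!: add_pos_nonneg)
  have "(\<lambda>n. \<delta>0 / real n) \<longlonglongrightarrow> 0" by (rule lim_const_over_n)
  then have s1l: "s1 \<longlonglongrightarrow> 0" unfolding s1_def[abs_def] by (rule LIMSEQ_ignore_initial_segment)
  obtain r1 \<mu> where r1: "strict_mono (r1 :: nat \<Rightarrow> nat)" and \<mu>: "\<mu> \<in> P" "integral\<^sup>L \<mu> (ell 0) = - c 0"
    and \<mu>l: "(\<lambda>n. integral\<^sup>L (m (s1 (r1 n))) D) \<longlonglongrightarrow> integral\<^sup>L \<mu> D"
    using limit[OF s1 s1l] by blast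
  have max: "integral\<^sup>L \<nu> D \<le> integral\<^sup>L \<mu> D" if \<nu>: "\<nu> \<in> P" "integral\<^sup>L \<nu> (ell 0) = - c 0" for \<nu>
  proof (rule field_le_epsilon)
    fix e :: real assume e: "e > 0"
    \<comment> \<open>The quotient drops out of its two bounds and leaves an inequality between
      integrals that survives the weak limit.\<close>
    have "\<forall>\<^sub>F s in at_right 0. integral\<^sup>L \<nu> D \<le> integral\<^sup>L (m s) D + e"
      using q_lower[OF \<nu>, of "e/2"] q_upper[of "e/2"] e by (auto elim: eventually_elim2)
    then have "\<forall>\<^sub>F n in sequentially. integral\<^sup>L \<nu> D \<le> integral\<^sup>L (m (s1 (r1 n))) D + e"
      using seq[OF s1 s1l r1] by (auto dest: eventually_compose_filterlim)
    moreover have "(\<lambda>n. integral\<^sup>L (m (s1 (r1 n))) D + e) \<longlonglongrightarrow> integral\<^sup>L \<mu> D + e" by (intro tendsto_intros \<mu>l)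
    ultimately show "integral\<^sup>L \<nu> D \<le> integral\<^sup>L \<mu> D + e"
      using tendsto_lowerbound trivial_limit_sequentially by blast
  qed
  have upper: "\<forall>\<^sub>F s in at_right 0. q s \<le> integral\<^sup>L \<mu> D + e" if e: "e > 0" for e
  \<comment> \<open>Otherwise parameters with too large quotients would tend to 0, and their
    minimizers would accumulate at a minimizer for \<open>s = 0\<close> whose integral of
    \<open>D\<close> exceeds the maximum.\<close>
  proof (rule ccontr)
    assume "\<not> ?thesis"
    then have fr: "\<exists>\<^sub>F s in at_right 0. integral\<^sup>L \<mu> D + e < q s" by (simp add: not_eventually not_le)
    have "\<exists>s. 0 < s \<and> s < \<delta>0 / real (Suc n) \<and> integral\<^sup>L \<mu> D + e < q s" for n
    proof -
      have "\<forall>\<^sub>F s in at_right 0. 0 < s \<and> s < \<delta>0 / real (Suc n)"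
        using \<delta>0 unfolding eventually_at_right_field by (intro exI[of _ "\<delta>0 / real (Suc n)"]) auto
      then have "\<exists>\<^sub>F s in at_right 0. (integral\<^sup>L \<mu> D + e < q s) \<and> (0 < s \<and> s < \<delta>0 / real (Suc n))"
        by (rule frequently_eventually_frequently[OF fr])
      then show ?thesis using frequently_ex by blast
    qed
    then obtain s where s: "\<And>n. 0 < s n \<and> s n < \<delta>0 / real (Suc n) \<and> integral\<^sup>L \<mu> D + e < q (s n)" by metis
    have sl: "s \<longlonglongrightarrow> 0"
    proof (rule tendsto_sandwich[OF _ _ tendsto_const])
      show "(\<lambda>n. \<delta>0 / real (Suc n)) \<longlonglongrightarrow> 0" using LIMSEQ_Suc[OF lim_const_over_n[of \<delta>0]] .
    qed (use s in \<open>auto intro!: always_eventually less_imp_le\<close>)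
    have s0: "0 < s n \<and> s n < \<delta>0" for n
    proof -
      have "\<delta>0 / real (Suc n) \<le> \<delta>0" using \<delta>0 by (simp add: field_simps)
      then show ?thesis using s[of n] by linarith
    qed
    obtain r \<nu> where r: "strict_mono (r :: nat \<Rightarrow> nat)" and \<nu>: "\<nu> \<in> P" "integral\<^sup>L \<nu> (ell 0) = - c 0"
      and \<nu>l: "(\<lambda>n. integral\<^sup>L (m (s (r n))) D) \<longlonglongrightarrow> integral\<^sup>L \<nu> D"
      using limit[OF s0 sl] by blast
    have "\<forall>\<^sub>F n in sequentially. q (s (r n)) \<le> integral\<^sup>L (m (s (r n))) D + e / 2"
      using seq[OF s0 sl r] q_upper[of "e/2"] e by (auto dest: eventually_compose_filterlim)
    then have "\<forall>\<^sub>F n in sequentially. integral\<^sup>L \<mu> D + e / 2 \<le> integral\<^sup>L (m (s (r n))) D"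
    proof eventually_elim
      case (elim n)
      then show ?case using s[of "r n"] by linarith
    qed
    then have "integral\<^sup>L \<mu> D + e / 2 \<le> integral\<^sup>L \<nu> D"
      using tendsto_lowerbound[OF \<nu>l] trivial_limit_sequentially by blast
    then show False using max[OF \<nu>] e by linarith
  qed
  have "(q \<longlongrightarrow> integral\<^sup>L \<mu> D) (at_right 0)"
  proof (rule tendstoI)
    fix e :: real assume e: "e > 0"
    have "\<forall>\<^sub>F s in at_right 0. integral\<^sup>L \<mu> D - e / 2 \<le> q s \<and> q s \<le> integral\<^sup>L \<mu> D + e / 2"
      using q_lower[OF \<mu>, of "e/2"] upper[of "e/2"] e by (intro eventually_conj) auto
    then show "\<forall>\<^sub>F s in at_right 0. dist (q s) (integral\<^sup>L \<mu> D) < e"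
    proof eventually_elim
      case (elim s)
      then show ?case using e by (auto simp: dist_real_def abs_less_iff)
    qed
  qed
  then show ?thesis using \<mu> max unfolding q_def[abs_def] by blast
qed

section \<open>Viscosity subsolutions\<close>

lemma DERIV_pos_part_square:
  "((\<lambda>s::real. (max 0 s)\<^sup>2) has_real_derivative 2 * max 0 s) (at s)"
proof -
  consider "s > 0" | "s < 0" | "s = 0" by linarith
  then show ?thesis
  proof cases
    case 1
    have "((\<lambda>s::real. s\<^sup>2) has_real_derivative 2 * max 0 s) (at s)"
      using 1 by (auto intro!: derivative_eq_intros)
    then show ?thesis
      by (rule has_field_derivative_transform_within_open[of _ _ _ "{0<..}"]) (use 1 in auto)
  next
    case 2
    have "((\<lambda>s::real. 0) has_real_derivative 2 * max 0 s) (at s)" using 2 by simp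
    then show ?thesis
      by (rule has_field_derivative_transform_within_open[of _ _ _ "{..<0}"]) (use 2 in auto)
  next
    case 3
    have "((\<lambda>h::real. (max 0 h)\<^sup>2 / h) \<longlongrightarrow> 0) (at 0)"
    proof (rule Lim_null_comparison)
      have "norm ((max 0 h)\<^sup>2 / h) \<le> \<bar>h\<bar>" for h :: real
        by (cases "h > 0") (auto simp: power2_eq_square max_def)
      then show "\<forall>\<^sub>F h in at 0. norm ((max 0 h)\<^sup>2 / h) \<le> \<bar>h::real\<bar>" by simp
      show "(abs \<longlongrightarrow> (0::real)) (at 0)" by (rule tendsto_eq_intros refl | simp)+
    qed
    then show ?thesis using 3 by (simp add: DERIV_def)
  qed
qed

lemma GDERIV_norm_diff_square:
  "GDERIV (\<lambda>y::'a::real_inner. (norm (y - c))\<^sup>2) y :> 2 *\<^sub>R (y - c)"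
proof -
  have "((\<lambda>y. y - c) has_derivative (\<lambda>h. h)) (at y)" by (auto intro!: derivative_eq_intros)
  then have "((\<lambda>y. (y - c) \<bullet> (y - c)) has_derivative (\<lambda>h. (y - c) \<bullet> h + h \<bullet> (y - c))) (at y)"
    using has_derivative_inner by blast
  moreover have "(\<lambda>h. (y - c) \<bullet> h + h \<bullet> (y - c)) = (\<lambda>h. h \<bullet> (2 *\<^sub>R (y - c)))"
  proof
    fix h show "(y - c) \<bullet> h + h \<bullet> (y - c) = h \<bullet> (2 *\<^sub>R (y - c))"
      unfolding inner_commute[of "y - c" h] by simp
  qed
  ultimately show ?thesis unfolding gderiv_def power2_norm_eq_inner by simp
qed

lemma GDERIV_scaled_argument:
  fixes f :: "'a::real_inner \<Rightarrow> real"
  assumes "GDERIV f (b *\<^sub>R y) :> g"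
  shows "GDERIV (\<lambda>y. a * f (b *\<^sub>R y)) y :> (a * b) *\<^sub>R g"
proof -
  have "((\<lambda>y. b *\<^sub>R y) has_derivative (\<lambda>h. b *\<^sub>R h)) (at y)"
    by (rule has_derivative_scaleR_right[OF has_derivative_ident])
  then have "((\<lambda>y. f (b *\<^sub>R y)) has_derivative (\<lambda>h. (b *\<^sub>R h) \<bullet> g)) (at y)"
    using has_derivative_compose assms unfolding gderiv_def by blast
  then have "((\<lambda>y. a * f (b *\<^sub>R y)) has_derivative (\<lambda>h. a * ((b *\<^sub>R h) \<bullet> g))) (at y)"
    by (rule has_derivative_mult_right)
  then show ?thesis unfolding gderiv_def by (simp add: mult.assoc)
qed

text \<open>Test functions need to be defined near the point of contact only: multiply by a cutoff that
  equals \<open>1\<close> up to a second order error at the contact point, and absorb the error into a quadratic.\<close>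

lemma viscosity_subsolution_local_test:
  fixes u :: "'a::euclidean_space \<Rightarrow> real"
  assumes vs: "viscosity_subsolution F D u" and x: "x \<in> D" and e: "e > 0"
    and \<phi>: "\<And>y. y \<in> ball x e \<Longrightarrow> GDERIV \<phi> y :> \<phi>' y" and \<phi>'c: "continuous_on (ball x e) \<phi>'"
    and mx: "\<And>y. y \<in> D \<inter> ball x e \<Longrightarrow> u y - \<phi> y \<le> u x - \<phi> x"
  shows "F x (\<phi>' x) \<le> 0"
proof -
  define \<rho> where "\<rho> = e / 2"
  have \<rho>: "0 < \<rho>" "\<rho> < e" using e by (auto simp: \<rho>_def)
  \<comment> \<open>The cutoff is the squared positive part of \<open>t\<close>. Squaring makes it
    C1 across the sphere of radius \<open>\<rho>\<close> where it starts to vanish, and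
    \<open>\<rho> < e\<close> leaves room to glue with 0 outside the ball on which
    \<open>\<phi>\<close> is given.\<close>
  define t where "t y = 1 + (- 1 / \<rho>\<^sup>2) * (norm (y - x))\<^sup>2" for y
  define k where "k y = (max 0 (t y))\<^sup>2" for y
  define k' where "k' y = (2 * max 0 (t y)) *\<^sub>R ((- 1 / \<rho>\<^sup>2) *\<^sub>R (2 *\<^sub>R (y - x)))" for y
  have t': "GDERIV t y :> (- 1 / \<rho>\<^sup>2) *\<^sub>R (2 *\<^sub>R (y - x))" for y
    unfolding t_def
    using GDERIV_add[OF GDERIV_const GDERIV_mult[OF GDERIV_const GDERIV_norm_diff_square]]
    by (simp only: scaleR_zero_right add_0_left add_0_right)
  have k': "GDERIV k y :> k' y" for y
    unfolding k_def k'_def by (rule GDERIV_DERIV_compose[OF t' DERIV_pos_part_square])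
  have kc: "continuous_on A k" for A unfolding k_def t_def by (intro continuous_intros)
  have k'c: "continuous_on A k'" for A unfolding k'_def t_def by (intro continuous_intros)
  have kz: "k y = 0" "k' y = 0" if "y \<notin> ball x \<rho>" for y
  proof -
    have "\<rho>\<^sup>2 \<le> (norm (y - x))\<^sup>2" using that \<rho> by (intro power_mono) (auto simp: dist_norm norm_minus_commute)
    then have "t y \<le> 0" using \<rho> by (simp add: t_def field_simps)
    then show "k y = 0" "k' y = 0" by (simp_all add: k_def k'_def max_def)
  qed
  define T where "T y = (if y \<in> ball x e then (\<phi> y - \<phi> x) * k y else 0) + (norm (y - x))\<^sup>2" for y
  define G where "G y = (\<phi> y - \<phi> x) *\<^sub>R k' y + k y *\<^sub>R \<phi>' y" for y
  define T' where "T' y = (if y \<in> ball x e then G y else 0) + 2 *\<^sub>R (y - x)" for y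
  have cover: "ball x e \<union> - cball x \<rho> = UNIV" using \<rho> by auto
  have "GDERIV T y :> T' y" for y
  proof -
    have in_y: "y \<in> ball x e \<or> y \<in> - cball x \<rho>" using cover by blast
    have "GDERIV (\<lambda>y. if y \<in> ball x e then (\<phi> y - \<phi> x) * k y else 0) y :> (if y \<in> ball x e then G y else 0)"
      using in_y
    proof
      assume y: "y \<in> ball x e"
      have "GDERIV (\<lambda>y. (\<phi> y - \<phi> x) * k y) y :> G y"
        unfolding G_def using GDERIV_mult[OF GDERIV_diff[OF \<phi>[OF y] GDERIV_const] k'] by simp
      then show ?thesis using y unfolding gderiv_def
        by simp (erule has_derivative_transform_within_open[of _ _ y UNIV "ball x e"], auto)
    next
      assume y: "y \<in> - cball x \<rho>"
      then have "k y = 0" "k' y = 0" using kz[of y] by auto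
      then have z: "(if y \<in> ball x e then G y else 0) = 0" by (simp add: G_def)
      have "GDERIV (\<lambda>y. 0) y :> 0" by (rule GDERIV_const)
      then show ?thesis using y kz unfolding gderiv_def z
        by - (erule has_derivative_transform_within_open[of _ _ y UNIV "- cball x \<rho>"], auto)
    qed
    then show ?thesis unfolding T_def T'_def by (rule GDERIV_add[OF _ GDERIV_norm_diff_square])
  qed
  moreover have "continuous_on D T'"
  proof -
    have \<phi>c: "continuous_on (ball x e) \<phi>"
      using \<phi> unfolding gderiv_def
      by (intro continuous_at_imp_continuous_on ballI) (blast intro: has_derivative_continuous)
    have "continuous_on (ball x e \<union> - cball x \<rho>) (\<lambda>y. if y \<in> ball x e then G y else 0)"
    proof (rule continuous_on_open_Un)
      have "continuous_on (ball x e) G"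
        unfolding G_def by (intro continuous_intros \<phi>c \<phi>'c kc k'c)
      then show "continuous_on (ball x e) (\<lambda>y. if y \<in> ball x e then G y else 0)"
        by (rule continuous_on_eq) auto
      have "continuous_on (- cball x \<rho>) (\<lambda>y. 0 :: 'a)" by simp
      then show "continuous_on (- cball x \<rho>) (\<lambda>y. if y \<in> ball x e then G y else 0)"
        by (rule continuous_on_eq) (use kz in \<open>auto simp: G_def\<close>)
    qed auto
    then have "continuous_on UNIV T'" unfolding T'_def using cover by (intro continuous_intros) auto
    then show ?thesis using continuous_on_subset by blast
  qed
  moreover have "\<exists>d>0. \<forall>y\<in>D \<inter> ball x d. u y - T y \<le> u x - T x"
  proof -
    have "isCont \<phi> x" using \<phi>[of x] e unfolding gderiv_def by (auto intro: has_derivative_continuous)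
    \<comment> \<open>The threshold is fitted to the quadratic: expanding \<open>(1 - s)^2\<close>
      gives \<open>1 - k y <= 2 * s\<close>, so the error of the cutoff is at most
      \<open>(\<rho>^2 / 2) * (2 * s)\<close>, which is the added
      \<open>(norm (y - x))^2\<close>.\<close>
    then obtain d where d: "d > 0" "\<And>y. dist y x < d \<Longrightarrow> dist (\<phi> y) (\<phi> x) < \<rho>\<^sup>2 / 2"
      using continuous_at_eps_delta[of x \<phi>] \<rho>(1) by (meson half_gt_zero zero_less_power)
    have "u y - T y \<le> u x - T x" if y: "y \<in> D" "dist x y < min d e" for y
    proof -
      define \<delta> where "\<delta> = \<phi> y - \<phi> x"
      have 1: "u y - u x \<le> \<delta>" using mx[of y] y by (auto simp: \<delta>_def)
      have 2: "\<bar>\<delta>\<bar> \<le> \<rho>\<^sup>2 / 2" using d(2)[of y] y by (auto simp: \<delta>_def dist_real_def dist_commute)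
      define s where "s = (norm (y - x))\<^sup>2 / \<rho>\<^sup>2"
      have s0: "0 \<le> s" by (simp add: s_def)
      have ty: "t y = 1 - s" by (simp add: t_def s_def)
      have k01: "0 \<le> k y" "k y \<le> 1" "1 - k y \<le> 2 * s"
      proof -
        show "0 \<le> k y" by (simp add: k_def)
        show "k y \<le> 1" using s0 unfolding k_def ty by (intro power_le_one) auto
        show "1 - k y \<le> 2 * s"
        proof (cases "s \<le> 1")
          case True
          then have "k y = (1 - s)\<^sup>2" by (simp add: k_def ty)
          then show ?thesis by (simp add: power2_eq_square algebra_simps)
        next
          case False
          then show ?thesis using \<open>0 \<le> k y\<close> by linarith
        qed
      qed
      have "\<delta> * (1 - k y) \<le> (\<rho>\<^sup>2 / 2) * (2 * s)"
        using 2 k01 s0 by (intro mult_mono) auto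
      also have "\<dots> = (norm (y - x))\<^sup>2" using \<rho> by (simp add: s_def)
      finally have "\<delta> \<le> \<delta> * k y + (norm (y - x))\<^sup>2" by (simp add: algebra_simps)
      moreover have "T y = \<delta> * k y + (norm (y - x))\<^sup>2" using y by (simp add: T_def \<delta>_def)
      moreover have "T x = 0" by (simp add: T_def)
      ultimately show ?thesis using 1 by linarith
    qed
    then show ?thesis using d(1) e by (intro exI[of _ "min d e"]) auto
  qed
  ultimately have "F x (T' x) \<le> 0" using vs x unfolding viscosity_subsolution_def by blast
  moreover have "T' x = \<phi>' x" using e by (simp add: T'_def G_def k'_def k_def t_def)
  ultimately show ?thesis by simp
qed

text \<open>Formally the new function has gradient \<open>a * b\<close> times that of
  \<open>u\<close> at \<open>b *\<^sub>R x\<close>, hence the factor on \<open>p\<close>. A test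
  function on \<open>D'\<close> transports to one known only on the dilate of \<open>D'\<close>,
  possibly smaller than \<open>D\<close>, so the local form of the definition is used.\<close>

lemma viscosity_subsolution_dilate:
  fixes u :: "'a::euclidean_space \<Rightarrow> real"
  assumes vs: "viscosity_subsolution F D u" and ab: "a > 0" "b > 0" and D': "open D'"
    and sub: "\<And>x. x \<in> D' \<Longrightarrow> b *\<^sub>R x \<in> D"
  shows "viscosity_subsolution (\<lambda>x p. F (b *\<^sub>R x) ((1 / (a * b)) *\<^sub>R p)) D' (\<lambda>x. a * u (b *\<^sub>R x))"
  unfolding viscosity_subsolution_def
proof (intro conjI allI impI)
  have "continuous_on D u" using vs by (simp add: viscosity_subsolution_def)
  then show "continuous_on D' (\<lambda>x. a * u (b *\<^sub>R x))"
    using sub by (intro continuous_on_mult_left continuous_on_compose2[of D u D' "\<lambda>x. b *\<^sub>R x"])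
      (auto intro!: continuous_intros)
next
  fix \<phi> \<phi>' x
  assume \<phi>: "\<forall>y\<in>D'. GDERIV \<phi> y :> \<phi>' y" and \<phi>'c: "continuous_on D' \<phi>'" and x: "x \<in> D'"
    and "\<exists>e>0. \<forall>y\<in>D' \<inter> ball x e. a * u (b *\<^sub>R y) - \<phi> y \<le> a * u (b *\<^sub>R x) - \<phi> x"
  then obtain e1 where e1: "e1 > 0" "\<And>y. y \<in> D' \<Longrightarrow> y \<in> ball x e1 \<Longrightarrow> a * u (b *\<^sub>R y) - \<phi> y \<le> a * u (b *\<^sub>R x) - \<phi> x"
    by auto
  obtain e2 where e2: "e2 > 0" "ball x e2 \<subseteq> D'" using D' x open_contains_ball by blast
  define e where "e = min e1 e2"
  have e: "e > 0" "ball x e \<subseteq> D'" using e1 e2 by (auto simp: e_def)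
  have inb: "(1 / b) *\<^sub>R y \<in> ball x e" if "y \<in> ball (b *\<^sub>R x) (b * e)" for y
  proof -
    have "x - (1 / b) *\<^sub>R y = (1 / b) *\<^sub>R (b *\<^sub>R x - y)" using ab by (simp add: algebra_simps)
    then have "dist x ((1 / b) *\<^sub>R y) = dist (b *\<^sub>R x) y / b" using ab by (simp add: dist_norm)
    moreover have "dist (b *\<^sub>R x) y / b < e" using that ab by (simp add: pos_divide_less_eq mult.commute)
    ultimately show ?thesis by simp
  qed
  have "F (b *\<^sub>R x) ((\<lambda>y. (1 / a * (1 / b)) *\<^sub>R \<phi>' ((1 / b) *\<^sub>R y)) (b *\<^sub>R x)) \<le> 0"
  proof (rule viscosity_subsolution_local_test[OF vs])
    show "b *\<^sub>R x \<in> D" using sub x by blast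
    show "0 < b * e" using ab e by simp
    show "GDERIV (\<lambda>y. 1 / a * \<phi> ((1 / b) *\<^sub>R y)) y :> (1 / a * (1 / b)) *\<^sub>R \<phi>' ((1 / b) *\<^sub>R y)"
      if "y \<in> ball (b *\<^sub>R x) (b * e)" for y
      using inb[OF that] e \<phi> by (intro GDERIV_scaled_argument) auto
    show "continuous_on (ball (b *\<^sub>R x) (b * e)) (\<lambda>y. (1 / a * (1 / b)) *\<^sub>R \<phi>' ((1 / b) *\<^sub>R y))"
      using inb e(2)
      by (intro continuous_on_scaleR continuous_on_const
          continuous_on_compose2[OF \<phi>'c, of _ "\<lambda>y. (1 / b) *\<^sub>R y"] continuous_on_id) auto
    fix y assume y: "y \<in> D \<inter> ball (b *\<^sub>R x) (b * e)"
    define z where "z = (1 / b) *\<^sub>R y"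
    have z: "z \<in> ball x e" "y = b *\<^sub>R z" using inb y ab by (auto simp: z_def)
    then have "a * u y - \<phi> z \<le> a * u (b *\<^sub>R x) - \<phi> x" using e1(2)[of z] e by (auto simp: e_def)
    then have "(a * u y - \<phi> z) / a \<le> (a * u (b *\<^sub>R x) - \<phi> x) / a" using ab by (intro divide_right_mono) auto
    then show "u y - 1 / a * \<phi> ((1 / b) *\<^sub>R y) \<le> u (b *\<^sub>R x) - 1 / a * \<phi> ((1 / b) *\<^sub>R b *\<^sub>R x)"
      using ab by (simp add: z_def[symmetric] diff_divide_distrib)
  qed
  then show "F (b *\<^sub>R x) ((1 / (a * b)) *\<^sub>R \<phi>' x) \<le> 0" using ab by simp
qed

text \<open>The case \<open>a = b = 1\<close>. It is not immediate from the definition, which tests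
  \<open>u\<close> on \<open>D\<close> only with functions differentiable on all of
  \<open>D\<close>.\<close>

lemma viscosity_subsolution_subset:
  assumes "viscosity_subsolution F D u" "open D'" "D' \<subseteq> D"
  shows "viscosity_subsolution F D' u"
  using viscosity_subsolution_dilate[OF assms(1) zero_less_one zero_less_one assms(2)] assms(3) by auto

lemma viscosity_subsolution_mono:
  assumes "viscosity_subsolution F D u" "\<And>x p. x \<in> D \<Longrightarrow> F x p \<le> 0 \<Longrightarrow> F' x p \<le> 0"
  shows "viscosity_subsolution F' D u"
  using assms unfolding viscosity_subsolution_def by blast

lemma viscosity_subsolution_const:
  fixes D :: "'a::euclidean_space set"
  assumes "open D" "\<And>x. x \<in> D \<Longrightarrow> F x 0 \<le> 0"
  shows "viscosity_subsolution F D (\<lambda>x. k)"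
  unfolding viscosity_subsolution_def
proof (intro conjI allI impI)
  fix \<phi> \<phi>' x
  assume \<phi>: "\<forall>y\<in>D. GDERIV \<phi> y :> \<phi>' y" and x: "x \<in> D"
    and "\<exists>e>0. \<forall>y\<in>D \<inter> ball x e. k - \<phi> y \<le> k - \<phi> x"
  then obtain e where e: "e > 0" "\<forall>y\<in>D \<inter> ball x e. \<phi> x \<le> \<phi> y" by auto
  have "(\<lambda>h. h \<bullet> \<phi>' x) = (\<lambda>h. 0)"
  proof (rule differential_zero_maxmin)
    show "x \<in> D \<inter> ball x e" "open (D \<inter> ball x e)" using x e assms by auto
    show "(\<phi> has_derivative (\<lambda>h. h \<bullet> \<phi>' x)) (at x)" using \<phi> x by (simp add: gderiv_def)
  qed (use e in auto)
  then have "\<phi>' x = 0" by (metis inner_eq_zero_iff)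
  then show "F x (\<phi>' x) \<le> 0" using assms x by simp
qed simp

text \<open>The definition constrains \<open>u\<close> only where a test function touches it. A
  steep paraboloid touches any continuous function from above inside a small ball, so on a nonempty
  open set the condition is never vacuous.\<close>

lemma viscosity_subsolution_contact:
  fixes D :: "'a::euclidean_space set"
  assumes vs: "viscosity_subsolution F D u" and D: "open D" "z \<in> D"
  shows "\<exists>x\<in>D. \<exists>p. F x p \<le> 0"
proof -
  obtain \<rho> where \<rho>: "\<rho> > 0" "cball z \<rho> \<subseteq> D" using D open_contains_cball by blast
  have uc: "continuous_on (cball z \<rho>) u"
    using vs \<rho>(2) continuous_on_subset unfolding viscosity_subsolution_def by blast
  have "bounded (u ` cball z \<rho>)" by (rule compact_imp_bounded[OF compact_continuous_image[OF uc compact_cball]])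
  then obtain B where "\<forall>t\<in>u ` cball z \<rho>. norm t \<le> B" unfolding bounded_iff by blast
  then have B: "\<bar>u y\<bar> \<le> B" if "y \<in> cball z \<rho>" for y using that by auto
  \<comment> \<open>On the sphere of radius \<open>\<rho>\<close> the paraboloid equals
    \<open>2 * B + 1\<close>, more than the oscillation of \<open>u\<close>, so the maximum is
    interior.\<close>
  define m where "m = (2 * B + 1) / \<rho>\<^sup>2"
  have "continuous_on (cball z \<rho>) (\<lambda>y. u y - m * (norm (y - z))\<^sup>2)" by (intro continuous_intros uc)
  then obtain x where x: "x \<in> cball z \<rho>"
    "\<And>y. y \<in> cball z \<rho> \<Longrightarrow> u y - m * (norm (y - z))\<^sup>2 \<le> u x - m * (norm (x - z))\<^sup>2"
    using continuous_attains_sup[of "cball z \<rho>" "\<lambda>y. u y - m * (norm (y - z))\<^sup>2"] \<rho> by auto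
  have "x \<in> ball z \<rho>"
  proof (rule ccontr)
    assume "x \<notin> ball z \<rho>"
    then have "norm (x - z) = \<rho>" using x(1) by (auto simp: dist_norm norm_minus_commute)
    then have "m * (norm (x - z))\<^sup>2 = 2 * B + 1" using \<rho> by (simp add: m_def)
    then show False using x(2)[of z] B[of z] B[OF x(1)] \<rho> by auto
  qed
  then obtain e where e: "e > 0" "ball x e \<subseteq> ball z \<rho>" by (metis open_ball open_contains_ball)
  have "F x ((m * 2) *\<^sub>R (x - z)) \<le> 0"
  proof (rule viscosity_subsolution_local_test[OF vs _ e(1),
        where \<phi>' = "\<lambda>x. (m * 2) *\<^sub>R (x - z)" and \<phi> = "\<lambda>y. m * (norm (y - z))\<^sup>2"])
    show "x \<in> D" using x \<rho> by blast
    show "GDERIV (\<lambda>y. m * (norm (y - z))\<^sup>2) y :> (m * 2) *\<^sub>R (y - z)" for y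
      using GDERIV_mult[OF GDERIV_const[of m y] GDERIV_norm_diff_square[of z y]] by simp
    show "u y - m * (norm (y - z))\<^sup>2 \<le> u x - m * (norm (x - z))\<^sup>2" if "y \<in> D \<inter> ball x e" for y
    proof -
      have "y \<in> cball z \<rho>" using that e(2) ball_subset_cball[of z \<rho>] by blast
      then show ?thesis by (rule x(2))
    qed
  qed (intro continuous_intros)
  then show ?thesis using x \<rho> by blast
qed

lemma continuous_on_section_snd:
  assumes "continuous_on (A \<times> B) (\<lambda>(x, v). f x v)" "x \<in> A"
  shows "continuous_on B (f x)"
proof -
  have "continuous_on B (\<lambda>v. case (x, v) of (x, v) \<Rightarrow> f x v)"
    by (rule continuous_on_compose2[OF assms(1)])
      (use assms(2) in \<open>auto intro!: continuous_on_Pair continuous_on_const continuous_on_id\<close>)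
  then show ?thesis by simp
qed

lemma continuous_on_section_fst:
  assumes "continuous_on (A \<times> B) (\<lambda>(x, v). f x v)" "v \<in> B"
  shows "continuous_on A (\<lambda>x. f x v)"
proof -
  have "continuous_on A (\<lambda>x. case (x, v) of (x, v) \<Rightarrow> f x v)"
    by (rule continuous_on_compose2[OF assms(1)])
      (use assms(2) in \<open>auto intro!: continuous_on_Pair continuous_on_const continuous_on_id\<close>)
  then show ?thesis by simp
qed

text \<open>Continuity on the compact ball bounds the values, so that \<open>SUP\<close> is a
  genuine supremum.\<close>

lemma ham_le_iff:
  fixes f :: "'a::euclidean_space \<Rightarrow> 'a \<Rightarrow> real"
  assumes "0 \<le> h" "continuous_on (cball 0 h) (f x)"
  shows "ham h f x p \<le> c \<longleftrightarrow> (\<forall>v\<in>cball 0 h. p \<bullet> v - f x v \<le> c)"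
proof -
  have "continuous_on (cball 0 h) (\<lambda>v. p \<bullet> v - f x v)" by (intro continuous_intros assms)
  then have "bdd_above ((\<lambda>v. p \<bullet> v - f x v) ` cball 0 h)"
    using compact_continuous_image compact_imp_bounded bounded_imp_bdd_above compact_cball by metis
  moreover have "cball (0::'a) h \<noteq> {}" using assms by simp
  ultimately show ?thesis unfolding ham_def by (intro cSUP_le_iff)
qed

text \<open>Doubling of variables: the momenta of the two subsolutions at the contact points add up to the
  gradient of the test function.\<close>

lemma viscosity_subsolution_add:
  fixes D :: "'a::euclidean_space set"
  assumes D: "open D" and h: "0 \<le> h"
    and f1: "continuous_on (D \<times> cball 0 h) (\<lambda>(x, v). f1 x v)"
    and f2: "continuous_on (D \<times> cball 0 h) (\<lambda>(x, v). f2 x v)"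
    and vs1: "viscosity_subsolution (ham h f1) D u1" and vs2: "viscosity_subsolution (ham h f2) D u2"
  shows "viscosity_subsolution (ham h (\<lambda>x v. f1 x v + f2 x v)) D (\<lambda>x. u1 x + u2 x)"
  unfolding viscosity_subsolution_def
proof (intro conjI allI impI)
  have u1: "continuous_on D u1" and u2: "continuous_on D u2"
    using vs1 vs2 by (auto simp: viscosity_subsolution_def)
  then show "continuous_on D (\<lambda>x. u1 x + u2 x)" by (intro continuous_intros)
  fix \<phi> \<phi>' x0
  assume \<phi>: "\<forall>y\<in>D. GDERIV \<phi> y :> \<phi>' y" and \<phi>'c: "continuous_on D \<phi>'" and x0: "x0 \<in> D"
    and "\<exists>e>0. \<forall>y\<in>D \<inter> ball x0 e. u1 y + u2 y - \<phi> y \<le> u1 x0 + u2 x0 - \<phi> x0"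
  then obtain e where e: "e > 0" "\<And>y. y \<in> D \<Longrightarrow> y \<in> ball x0 e \<Longrightarrow> u1 y + u2 y - \<phi> y \<le> u1 x0 + u2 x0 - \<phi> x0" by auto
  obtain \<rho>0 where \<rho>0: "\<rho>0 > 0" "cball x0 \<rho>0 \<subseteq> D" using D x0 open_contains_cball by blast
  define \<rho> where "\<rho> = min \<rho>0 (e/2)"
  define B where "B = cball x0 \<rho>"
  have \<rho>: "\<rho> > 0" and BD: "B \<subseteq> D" and x0B: "x0 \<in> B"
    using \<rho>0 e(1) unfolding \<rho>_def B_def by auto
  have Be: "B \<subseteq> ball x0 e" using e(1) by (auto simp: B_def \<rho>_def)
  have \<phi>c: "continuous_on D \<phi>"
    using \<phi> unfolding gderiv_def
    by (intro continuous_at_imp_continuous_on ballI) (blast intro: has_derivative_continuous)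
  note cB = continuous_on_subset[OF u1 BD] continuous_on_subset[OF u2 BD] continuous_on_subset[OF \<phi>c BD]
  \<comment> \<open>The factor \<open>n\<close> drives the two points together; the other quadratic
    turns \<open>x0\<close> into a strict maximum, so that both converge to it.\<close>
  define \<Phi> where "\<Phi> n z = u1 (fst z) + u2 (snd z) - \<phi> (fst z) - (norm (fst z - x0))\<^sup>2
      - real n * (norm (fst z - snd z))\<^sup>2" for n :: nat and z
  have "\<exists>z\<in>B \<times> B. \<forall>w\<in>B \<times> B. \<Phi> n w \<le> \<Phi> n z" for n
  proof (rule continuous_attains_sup)
    show "compact (B \<times> B)" by (simp add: B_def compact_Times)
    show "B \<times> B \<noteq> {}" using x0B by auto
    show "continuous_on (B \<times> B) (\<Phi> n)" unfolding \<Phi>_def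
      by (intro continuous_intros continuous_on_compose2[OF cB(1), of _ fst]
          continuous_on_compose2[OF cB(2), of _ snd] continuous_on_compose2[OF cB(3), of _ fst]) auto
  qed
  then obtain z where z: "\<And>n. z n \<in> B \<times> B" and zmax: "\<And>n w. w \<in> B \<times> B \<Longrightarrow> \<Phi> n w \<le> \<Phi> n (z n)"
    by metis
  obtain l r where l: "l \<in> B \<times> B" and r: "strict_mono (r :: nat \<Rightarrow> nat)" and zr: "(z \<circ> r) \<longlonglongrightarrow> l"
    using compact_imp_seq_compact[of "B \<times> B"] z unfolding seq_compact_def
    by (metis B_def compact_Times compact_cball)
  define X where "X n = fst (z (r n))" for n
  define Y where "Y n = snd (z (r n))" for n
  have XY: "X n \<in> B" "Y n \<in> B" for n using z[of "r n"] by (auto simp: X_def Y_def mem_Times_iff)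
  have Xl: "X \<longlonglongrightarrow> fst l" and Yl: "Y \<longlonglongrightarrow> snd l"
    using tendsto_fst[OF zr] tendsto_snd[OF zr] by (simp_all add: X_def[abs_def] Y_def[abs_def] comp_def)
  \<comment> \<open>Comparison with the diagonal pair \<open>(x0, x0)\<close>, where both quadratic
    terms vanish. Both \<open>leq\<close> and \<open>lx0\<close> come from it.\<close>
  have low: "u1 x0 + u2 x0 - \<phi> x0 \<le> u1 (X n) + u2 (Y n) - \<phi> (X n) - (norm (X n - x0))\<^sup>2
      - real (r n) * (norm (X n - Y n))\<^sup>2" for n
    using zmax[of "(x0, x0)" "r n"] x0B by (simp add: \<Phi>_def X_def Y_def)
  have lB: "fst l \<in> B" "snd l \<in> B" using l by auto
  have lims: "(\<lambda>n. u1 (X n)) \<longlonglongrightarrow> u1 (fst l)" "(\<lambda>n. u2 (Y n)) \<longlonglongrightarrow> u2 (snd l)" "(\<lambda>n. \<phi> (X n)) \<longlonglongrightarrow> \<phi> (fst l)"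
    using continuous_on_tendsto_compose[OF cB(1) Xl lB(1)] continuous_on_tendsto_compose[OF cB(2) Yl lB(2)]
      continuous_on_tendsto_compose[OF cB(3) Xl lB(1)] XY by auto
  define b where "b n = u1 (X n) + u2 (Y n) - \<phi> (X n) - (u1 x0 + u2 x0 - \<phi> x0)" for n
  have bl: "b \<longlonglongrightarrow> u1 (fst l) + u2 (snd l) - \<phi> (fst l) - (u1 x0 + u2 x0 - \<phi> x0)"
    unfolding b_def by (intro tendsto_intros lims)
  have leq: "fst l = snd l"
  proof -
    have "(norm (X n - Y n))\<^sup>2 \<le> b n / real (r n)" if "n \<ge> 1" for n
    proof -
      have "r n \<ge> n" using r by (rule seq_suble)
      then have "real (r n) > 0" using that by simp
      moreover have "real (r n) * (norm (X n - Y n))\<^sup>2 \<le> b n"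
        using low[of n] zero_le_power2[of "norm (X n - x0)"] unfolding b_def by linarith
      ultimately show ?thesis by (simp add: field_simps)
    qed
    then have ev: "\<forall>\<^sub>F n in sequentially. (norm (X n - Y n))\<^sup>2 \<le> b n / real (r n)"
      by (auto simp: eventually_sequentially)
    have "filterlim (\<lambda>n. real (r n)) at_top sequentially"
      using filterlim_compose[OF filterlim_real_sequentially filterlim_subseq[OF r]] .
    then have "(\<lambda>n. b n / real (r n)) \<longlonglongrightarrow> 0"
      by (rule real_tendsto_divide_at_top[OF bl])
    moreover have "(\<lambda>n. (norm (X n - Y n))\<^sup>2) \<longlonglongrightarrow> (norm (fst l - snd l))\<^sup>2" by (intro tendsto_intros Xl Yl)
    ultimately have "(norm (fst l - snd l))\<^sup>2 \<le> 0" by (rule tendsto_le[OF trivial_limit_sequentially _ _ ev])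
    then show ?thesis by simp
  qed
  have lx0: "fst l = x0"
  proof -
    have ev: "(norm (X n - x0))\<^sup>2 \<le> b n" for n
      using low[of n] unfolding b_def
      by (smt (verit) mult_nonneg_nonneg of_nat_0_le_iff zero_le_power2)
    have "(\<lambda>n. (norm (X n - x0))\<^sup>2) \<longlonglongrightarrow> (norm (fst l - x0))\<^sup>2" by (intro tendsto_intros Xl)
    then have "(norm (fst l - x0))\<^sup>2 \<le> u1 (fst l) + u2 (snd l) - \<phi> (fst l) - (u1 x0 + u2 x0 - \<phi> x0)"
      by (rule LIMSEQ_le[OF _ bl]) (use ev in auto)
    also have "\<dots> \<le> 0" using e(2)[of "fst l"] leq subsetD[OF BD lB(1)] subsetD[OF Be lB(1)] by simp
    finally show ?thesis by simp
  qed
  have Xx: "X \<longlonglongrightarrow> x0" and Yx: "Y \<longlonglongrightarrow> x0" using Xl Yl lx0 leq by auto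
  have ball: "ball x0 \<rho> \<subseteq> B" by (auto simp: B_def)
  \<comment> \<open>For fixed \<open>v\<close> the constraints are affine in the momenta and can be
    added. The penalty gradients in \<open>p1\<close> and \<open>p2\<close> are opposite and cancel,
    so the growing factor \<open>m\<close> disappears.\<close>
  have key: "\<phi>' (X n) \<bullet> v + 2 * ((X n - x0) \<bullet> v) \<le> f1 (X n) v + f2 (Y n) v"
    if v: "v \<in> cball 0 h" and n: "X n \<in> ball x0 \<rho>" "Y n \<in> ball x0 \<rho>" for n v
  proof -
    define m where "m = real (r n)"
    have mx: "u1 x + u2 y - \<phi> x - (norm (x - x0))\<^sup>2 - m * (norm (x - y))\<^sup>2 \<le>
        u1 (X n) + u2 (Y n) - \<phi> (X n) - (norm (X n - x0))\<^sup>2 - m * (norm (X n - Y n))\<^sup>2"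
      if "x \<in> B" "y \<in> B" for x y
      using zmax[of "(x, y)" "r n"] that by (simp add: \<Phi>_def X_def Y_def m_def)
    obtain d1 where d1: "d1 > 0" "ball (X n) d1 \<subseteq> ball x0 \<rho>" using n by (metis open_ball open_contains_ball)
    obtain d2 where d2: "d2 > 0" "ball (Y n) d2 \<subseteq> ball x0 \<rho>" using n by (metis open_ball open_contains_ball)
    have D1: "ball (X n) d1 \<subseteq> D" using d1 ball BD by blast
    define p1 where "p1 x = \<phi>' x + 2 *\<^sub>R (x - x0) + (m * 2) *\<^sub>R (x - Y n)" for x
    have "ham h f1 (X n) (p1 (X n)) \<le> 0"
    proof (rule viscosity_subsolution_local_test[OF vs1 _ d1(1),
          where \<phi> = "\<lambda>x. \<phi> x + (norm (x - x0))\<^sup>2 + m * (norm (x - Y n))\<^sup>2"])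
      show "X n \<in> D" using XY BD by blast
      show "GDERIV (\<lambda>x. \<phi> x + (norm (x - x0))\<^sup>2 + m * (norm (x - Y n))\<^sup>2) y :> p1 y"
        if "y \<in> ball (X n) d1" for y
      proof -
        have "GDERIV (\<lambda>x. m * (norm (x - Y n))\<^sup>2) y :> (m * 2) *\<^sub>R (y - Y n)"
          using GDERIV_mult[OF GDERIV_const[of m y] GDERIV_norm_diff_square[of "Y n" y]] by simp
        then show ?thesis unfolding p1_def
          using \<phi> D1 that by (intro GDERIV_add GDERIV_norm_diff_square) auto
      qed
      show "continuous_on (ball (X n) d1) p1" unfolding p1_def
        by (intro continuous_intros continuous_on_subset[OF \<phi>'c D1])
      fix y assume "y \<in> D \<inter> ball (X n) d1"
      then have "y \<in> B" using d1(2) ball by blast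
      then show "u1 y - (\<phi> y + (norm (y - x0))\<^sup>2 + m * (norm (y - Y n))\<^sup>2)
        \<le> u1 (X n) - (\<phi> (X n) + (norm (X n - x0))\<^sup>2 + m * (norm (X n - Y n))\<^sup>2)"
        using mx[of y "Y n"] XY by simp
    qed
    then have 1: "p1 (X n) \<bullet> v - f1 (X n) v \<le> 0"
      using ham_le_iff[where f=f1, OF h continuous_on_section_snd[OF f1]] XY BD v by blast
    define p2 where "p2 y = (m * 2) *\<^sub>R (y - X n)" for y
    have "ham h f2 (Y n) (p2 (Y n)) \<le> 0"
    proof (rule viscosity_subsolution_local_test[OF vs2 _ d2(1), where \<phi> = "\<lambda>y. m * (norm (y - X n))\<^sup>2"])
      show "Y n \<in> D" using XY BD by blast
      show "GDERIV (\<lambda>x. m * (norm (x - X n))\<^sup>2) y :> p2 y" for y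
        unfolding p2_def using GDERIV_mult[OF GDERIV_const[of m y] GDERIV_norm_diff_square[of "X n" y]] by simp
      show "continuous_on (ball (Y n) d2) p2" unfolding p2_def by (intro continuous_intros)
      fix y assume "y \<in> D \<inter> ball (Y n) d2"
      then have "y \<in> B" using d2(2) ball by blast
      then show "u2 y - m * (norm (y - X n))\<^sup>2 \<le> u2 (Y n) - m * (norm (Y n - X n))\<^sup>2"
        using mx[of "X n" y] XY by (simp add: norm_minus_commute)
    qed
    then have 2: "p2 (Y n) \<bullet> v - f2 (Y n) v \<le> 0"
      using ham_le_iff[where f=f2, OF h continuous_on_section_snd[OF f2]] XY BD v by blast
    have "p1 (X n) + p2 (Y n) = \<phi>' (X n) + 2 *\<^sub>R (X n - x0)"
      unfolding p1_def p2_def by (simp add: algebra_simps)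
    then have "p1 (X n) \<bullet> v + p2 (Y n) \<bullet> v = \<phi>' (X n) \<bullet> v + 2 * ((X n - x0) \<bullet> v)"
      by (metis inner_add_left inner_scaleR_left)
    then show ?thesis using 1 2 by linarith
  qed
  have "\<phi>' x0 \<bullet> v - (f1 x0 v + f2 x0 v) \<le> 0" if v: "v \<in> cball 0 h" for v
  proof -
    have XD: "X n \<in> D" "Y n \<in> D" for n using XY BD by auto
    have "(\<lambda>n. \<phi>' (X n)) \<longlonglongrightarrow> \<phi>' x0"
      using continuous_on_tendsto_compose[OF \<phi>'c Xx x0] XD by auto
    then have l1: "(\<lambda>n. \<phi>' (X n) \<bullet> v + 2 * ((X n - x0) \<bullet> v)) \<longlonglongrightarrow> \<phi>' x0 \<bullet> v + 2 * ((x0 - x0) \<bullet> v)"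
      by (intro tendsto_intros Xx)
    have l2: "(\<lambda>n. f1 (X n) v + f2 (Y n) v) \<longlonglongrightarrow> f1 x0 v + f2 x0 v"
      using continuous_on_tendsto_compose[OF continuous_on_section_fst[OF f1 v] Xx x0] continuous_on_tendsto_compose[OF continuous_on_section_fst[OF f2 v] Yx x0] XD
      by (intro tendsto_intros) auto
    have ev: "\<forall>\<^sub>F n in sequentially. \<phi>' (X n) \<bullet> v + 2 * ((X n - x0) \<bullet> v) \<le> f1 (X n) v + f2 (Y n) v"
    proof -
      have "\<forall>\<^sub>F n in sequentially. X n \<in> ball x0 \<rho>" "\<forall>\<^sub>F n in sequentially. Y n \<in> ball x0 \<rho>"
        using topological_tendstoD[OF Xx, of "ball x0 \<rho>"] topological_tendstoD[OF Yx, of "ball x0 \<rho>"] \<rho> by auto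
      then show ?thesis by eventually_elim (use key v in auto)
    qed
    have "\<phi>' x0 \<bullet> v + 2 * ((x0 - x0) \<bullet> v) \<le> f1 x0 v + f2 x0 v"
      by (rule tendsto_le[OF trivial_limit_sequentially l2 l1 ev])
    then show ?thesis by simp
  qed
  then show "ham h (\<lambda>x v. f1 x v + f2 x v) x0 (\<phi>' x0) \<le> 0"
    using ham_le_iff[OF h, of "\<lambda>x v. f1 x v + f2 x v"] continuous_on_add
      continuous_on_section_snd[OF f1 x0] continuous_on_section_snd[OF f2 x0] by blast
qed

section \<open>The Lagrangian and the normalization\<close>

text \<open>A hyperplane separating the open vertical ray below the graph point at \<open>p\<close>
  from the epigraph has the subgradient as its slope.\<close>

lemma convex_on_subgradient:
  fixes f :: "'a::euclidean_space \<Rightarrow> real"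
  assumes "convex_on UNIV f"
  shows "\<exists>v. \<forall>q. f p + (q - p) \<bullet> v \<le> f q"
proof -
  define S where "S = {p} \<times> {..<f p}"
  define T where "T = epigraph UNIV f"
  have "convex S" unfolding S_def by (intro convex_Times convex_singleton convex_real_interval)
  moreover have "convex T" unfolding T_def using convex_epigraph[of UNIV f] assms by simp
  moreover have "S \<noteq> {}" by (auto simp: S_def)
  moreover have "T \<noteq> {}" by (auto simp: T_def epigraph_def)
  moreover have "S \<inter> T = {}" by (auto simp: S_def T_def epigraph_def)
  ultimately obtain a b where ab: "a \<noteq> 0" "\<forall>x\<in>S. a \<bullet> x \<le> b" "\<forall>x\<in>T. b \<le> a \<bullet> x"
    using separating_hyperplane_sets[of S T] by auto
  obtain \<alpha> \<beta> where a: "a = (\<alpha>, \<beta>)" by (cases a)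
  have sep: "\<alpha> \<bullet> p + \<beta> * s \<le> \<alpha> \<bullet> q + \<beta> * t" if "s < f p" "f q \<le> t" for s q t
  proof -
    have "a \<bullet> (p, s) \<le> b" "b \<le> a \<bullet> (q, t)"
      using ab(2,3) that by (auto simp: S_def T_def epigraph_def)
    then show ?thesis by (simp add: a)
  qed
  have "\<beta> \<ge> 0" using sep[of "f p - 1" p "f p"] by (simp add: algebra_simps)
  \<comment> \<open>The epigraph lies over the whole space, so the hyperplane cannot be vertical:
    the point over \<open>p - \<alpha>\<close> would be on the wrong side unless
    \<open>\<alpha> = 0\<close>.\<close>
  moreover have "\<beta> \<noteq> 0"
  proof
    assume z: "\<beta> = 0"
    have "\<alpha> \<bullet> \<alpha> \<le> 0" using sep[of "f p - 1" "p - \<alpha>" "f (p - \<alpha>)"] z by (simp add: inner_diff_right)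
    then have "\<alpha> = 0" using inner_ge_zero[of \<alpha>] inner_eq_zero_iff[of \<alpha>] by linarith
    then show False using ab(1) a z by (simp add: zero_prod_def)
  qed
  ultimately have \<beta>: "\<beta> > 0" by simp
  have "f p + (q - p) \<bullet> ((- 1 / \<beta>) *\<^sub>R \<alpha>) \<le> f q" for q
  proof -
    have "\<alpha> \<bullet> p + \<beta> * f p \<le> \<alpha> \<bullet> q + \<beta> * f q"
    proof (rule field_le_epsilon)
      fix e :: real assume "e > 0"
      then show "\<alpha> \<bullet> p + \<beta> * f p \<le> \<alpha> \<bullet> q + \<beta> * f q + e"
        using sep[of "f p - e / \<beta>" q "f q"] \<beta> by (simp add: right_diff_distrib)
    qed
    then have "(\<beta> * f p - (\<alpha> \<bullet> q - \<alpha> \<bullet> p)) / \<beta> \<le> (\<beta> * f q) / \<beta>" using \<beta> by (intro divide_right_mono) auto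
    then show ?thesis using \<beta> by (simp add: diff_divide_distrib inner_diff_right inner_commute[of _ \<alpha>])
  qed
  then show ?thesis by blast
qed

locale dilated_domains =
  fixes \<Omega> :: "'a::euclidean_space set" and R0 :: real and H :: "'a \<Rightarrow> 'a \<Rightarrow> real"
  assumes open_dom: "open \<Omega>" and zero_in: "0 \<in> \<Omega>" and dilate2: "dilate 2 \<Omega> \<subseteq> ball 0 R0"
    and H_cont: "continuous_on (cball 0 R0 \<times> UNIV) (\<lambda>(x, p). H x p)"
    and H1: "H1 R0 H" and H2: "H2 R0 H" and H3: "H3 R0 H" and H4: "H4 R0 H" and A1: "A1 \<Omega>"
begin

abbreviation "L \<equiv> lagrangian H"

section \<open>Geometry of the dilated domains\<close>

lemma R0_pos: "0 < R0"
proof -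
  have "0 \<in> dilate 2 \<Omega>" using zero_in by (auto simp: dilate_def intro!: image_eqI[of _ _ 0])
  then show ?thesis using dilate2 by auto
qed

lemma norm_closure_le:
  assumes "x \<in> closure \<Omega>" shows "norm x \<le> R0 / 2"
proof -
  have "norm x \<le> R0 / 2" if "x \<in> \<Omega>" for x
  proof -
    have "2 *\<^sub>R x \<in> dilate 2 \<Omega>" using that by (auto simp: dilate_def)
    then have "2 *\<^sub>R x \<in> ball 0 R0" using dilate2 by blast
    then show ?thesis by simp
  qed
  then have "closure \<Omega> \<subseteq> cball 0 (R0 / 2)" by (intro closure_minimal) auto
  then show ?thesis using assms by auto
qed

lemma scaled_closure_in:
  assumes "x \<in> closure \<Omega>" "0 \<le> b" "b \<le> 2" shows "b *\<^sub>R x \<in> cball 0 R0"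
proof -
  have "b * norm x \<le> 2 * (R0 / 2)" using norm_closure_le[OF assms(1)] assms(2,3) by (intro mult_mono) auto
  then show ?thesis using assms by simp
qed

lemma star_shaped: "x \<in> \<Omega> \<Longrightarrow> 0 \<le> t \<Longrightarrow> t \<le> 1 \<Longrightarrow> t *\<^sub>R x \<in> \<Omega>"
  using A1 unfolding A1_def closed_segment_def by auto

text \<open>Star-shapedness alone keeps \<open>t *\<^sub>R x\<close> in the closure. If it were a
  frontier point, its dilate \<open>x\<close> by the factor \<open>1 / t = 1 + s\<close> would have
  positive distance from the closure by (A1), although it belongs to it.\<close>

lemma shrink_closure:
  assumes x: "x \<in> closure \<Omega>" and t: "0 \<le> t" "t < 1"
  shows "t *\<^sub>R x \<in> \<Omega>"
proof (cases "t = 0")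
  case True then show ?thesis using zero_in by simp
next
  case False
  then have t0: "0 < t" using t by simp
  have "(\<lambda>x. t *\<^sub>R x) ` closure \<Omega> \<subseteq> closure \<Omega>"
    using star_shaped t closure_subset[of \<Omega>]
    by (intro image_closure_subset continuous_intros) auto
  then have cl: "t *\<^sub>R x \<in> closure \<Omega>" using x by blast
  show ?thesis
  proof (rule ccontr)
    assume "t *\<^sub>R x \<notin> \<Omega>"
    then have fr: "t *\<^sub>R x \<in> frontier \<Omega>" using cl open_dom by (simp add: frontier_def interior_open)
    define s where "s = 1 / t - 1"
    have s: "s > 0" "(1 + s) * t = 1" using t t0 by (auto simp: s_def field_simps)
    have "x \<in> dilate (1 + s) (frontier \<Omega>)"
      unfolding dilate_def using fr s(2) by (intro image_eqI[of _ _ "t *\<^sub>R x"]) auto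
    then obtain \<kappa> where "\<kappa> > 0" "\<kappa> * s \<le> infdist x (closure \<Omega>)"
      using A1 s(1) unfolding A1_def by blast
    moreover have "infdist x (closure \<Omega>) = 0" using x by simp
    ultimately show False using s(1) mult_pos_pos[of \<kappa> s] by linarith
  qed
qed

lemma open_dilate: "b > 0 \<Longrightarrow> open (dilate b \<Omega>)"
  unfolding dilate_def using open_scaling[OF _ open_dom] by auto

lemma dilate_in: "0 < b \<Longrightarrow> b \<le> 2 \<Longrightarrow> x \<in> dilate b \<Omega> \<Longrightarrow> x \<in> cball 0 R0"
  unfolding dilate_def using scaled_closure_in closure_subset[of \<Omega>] by auto

section \<open>Regularity of the Lagrangian\<close>

lemma lagrangian_ge: "x \<in> cball 0 R0 \<Longrightarrow> p \<bullet> v - H x p \<le> L x v"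
  unfolding lagrangian_def using H4 unfolding H4_def by (intro cSUP_upper) auto

lemma lagrangian_le: "(\<And>p. p \<bullet> v - H x p \<le> c) \<Longrightarrow> L x v \<le> c"
  unfolding lagrangian_def by (intro cSUP_least) auto

lemma convex_on_lagrangian:
  assumes "x \<in> cball 0 R0" shows "convex_on UNIV (L x)"
proof (rule convex_onI)
  fix t :: real and v w :: 'a assume t: "0 < t" "t < 1"
  show "L x ((1 - t) *\<^sub>R v + t *\<^sub>R w) \<le> (1 - t) * L x v + t * L x w"
  proof (rule lagrangian_le)
    fix p
    have "(1 - t) * (p \<bullet> v - H x p) \<le> (1 - t) * L x v" "t * (p \<bullet> w - H x p) \<le> t * L x w"
      using lagrangian_ge[OF assms] t by (auto intro!: mult_left_mono)
    then show "p \<bullet> ((1 - t) *\<^sub>R v + t *\<^sub>R w) - H x p \<le> (1 - t) * L x v + t * L x w"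
      by (simp add: inner_add_right algebra_simps)
  qed
qed simp

text \<open>A fixed witness from \<open>H4\<close>. It is continuous on the whole closed ball,
  whereas the two-sided derivative behind \<open>gradient\<close> is available at interior points
  only; on the closure of \<open>\<Omega>\<close> the two agree.\<close>

definition DL :: "'a \<Rightarrow> 'a \<Rightarrow> 'a" where
  "DL = (SOME G. (\<forall>v. \<forall>x\<in>cball 0 R0. ((\<lambda>y. L y v) has_derivative (\<lambda>w. w \<bullet> G x v)) (at x within cball 0 R0)) \<and>
          continuous_on (cball 0 R0 \<times> UNIV) (\<lambda>(x, v). G x v))"

lemma DL_props:
  "(\<forall>v. \<forall>x\<in>cball 0 R0. ((\<lambda>y. L y v) has_derivative (\<lambda>w. w \<bullet> DL x v)) (at x within cball 0 R0)) \<and>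
    continuous_on (cball 0 R0 \<times> UNIV) (\<lambda>(x, v). DL x v)"
proof -
  let ?P = "\<lambda>G. (\<forall>v. \<forall>x\<in>cball 0 R0. ((\<lambda>y. L y v) has_derivative (\<lambda>w. w \<bullet> G x v)) (at x within cball 0 R0)) \<and>
      continuous_on (cball 0 R0 \<times> UNIV) (\<lambda>(x, v). G x v)"
  have "\<exists>G. ?P G" using H4 unfolding H4_def by blast
  then have "?P (SOME G. ?P G)" by (rule someI_ex[of ?P])
  then show ?thesis unfolding DL_def .
qed

lemma DL_deriv:
  "x \<in> cball 0 R0 \<Longrightarrow> ((\<lambda>y. L y v) has_derivative (\<lambda>w. w \<bullet> DL x v)) (at x within cball 0 R0)"
  using DL_props by blast

lemma DL_cont: "continuous_on (cball 0 R0 \<times> cball 0 h) (\<lambda>(x, v). DL x v)"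
  using DL_props continuous_on_subset[of "cball 0 R0 \<times> UNIV" "\<lambda>(x, v). DL x v" "cball 0 R0 \<times> cball 0 h"] by auto

lemma gradient_lagrangian:
  assumes "x \<in> closure \<Omega>" shows "gradient (\<lambda>y. L y v) x = DL x v"
proof -
  have "norm x < R0" using norm_closure_le[OF assms] R0_pos by linarith
  then have i: "x \<in> interior (cball 0 R0)" and x: "x \<in> cball 0 R0" by (auto simp: interior_cball)
  have d: "((\<lambda>y. L y v) has_derivative (\<lambda>w. w \<bullet> DL x v)) (at x)"
    using DL_deriv[OF x, of v] unfolding at_within_interior[OF i] .
  show ?thesis unfolding gradient_def
  proof (rule the_equality)
    show "GDERIV (\<lambda>y. L y v) x :> DL x v" using d by (simp add: gderiv_def)
    fix g assume "GDERIV (\<lambda>y. L y v) x :> g"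
    then have "(\<lambda>w. w \<bullet> g) = (\<lambda>w. w \<bullet> DL x v)" using d has_derivative_unique unfolding gderiv_def by blast
    then have "(g - DL x v) \<bullet> g = (g - DL x v) \<bullet> DL x v" by (rule fun_cong)
    then have "(g - DL x v) \<bullet> (g - DL x v) = 0" unfolding inner_diff_right by simp
    then show "g = DL x v" by simp
  qed
qed

text \<open>Mean value inequality for \<open>L\<close> minus a linear function of slope
  \<open>c\<close>: slope 0 gives a Lipschitz bound, slope \<open>DL x v\<close> the first order
  expansion.\<close>

lemma lagrangian_mean_value:
  assumes S: "convex S" "S \<subseteq> cball 0 R0" and B: "\<And>z. z \<in> S \<Longrightarrow> norm (DL z v - c) \<le> B"
    and xy: "x \<in> S" "y \<in> S"
  shows "\<bar>L x v - L y v - (x - y) \<bullet> c\<bar> \<le> B * norm (x - y)"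
proof -
  have B0: "0 \<le> B" using B[OF xy(1)] norm_ge_zero order_trans by blast
  have "norm ((L x v - x \<bullet> c) - (L y v - y \<bullet> c)) \<le> B * norm (x - y)"
  proof (rule differentiable_bound[OF S(1), where f' = "\<lambda>z w. w \<bullet> DL z v - w \<bullet> c"])
    fix z assume z: "z \<in> S"
    have "((\<lambda>y. L y v) has_derivative (\<lambda>w. w \<bullet> DL z v)) (at z within S)"
      using DL_deriv[of z v] S(2) z has_derivative_subset by blast
    then show "((\<lambda>z. L z v - z \<bullet> c) has_derivative (\<lambda>w. w \<bullet> DL z v - w \<bullet> c)) (at z within S)"
      by (intro has_derivative_diff has_derivative_inner_left has_derivative_ident)
    show "onorm (\<lambda>w. w \<bullet> DL z v - w \<bullet> c) \<le> B"
    proof (rule onorm_bound[OF B0])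
      fix w
      have "norm (w \<bullet> (DL z v - c)) \<le> norm w * norm (DL z v - c)" by (rule Cauchy_Schwarz_ineq2[folded real_norm_def])
      also have "\<dots> \<le> norm w * B" using B[OF z] by (intro mult_left_mono) auto
      finally show "norm (w \<bullet> DL z v - w \<bullet> c) \<le> B * norm w" by (simp add: inner_diff_right mult.commute)
    qed
  qed (use xy in auto)
  then show ?thesis by (simp add: inner_diff_left algebra_simps)
qed

text \<open>A bounded \<open>DL\<close> makes \<open>L\<close> Lipschitz in \<open>x\<close>
  uniformly for \<open>v\<close> in the ball; in \<open>v\<close> it is continuous because it is
  finite and convex.\<close>

lemma lagrangian_cont: "continuous_on (cball 0 R0 \<times> cball 0 h) (\<lambda>(x, v). L x v)"
proof -
  have "bounded ((\<lambda>(x, v). DL x v) ` (cball 0 R0 \<times> cball 0 h))"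
    by (rule compact_imp_bounded[OF compact_continuous_image[OF DL_cont compact_Times[OF compact_cball compact_cball]]])
  then obtain B where B: "\<forall>y\<in>(\<lambda>(x, v). DL x v) ` (cball 0 R0 \<times> cball 0 h). norm y \<le> B"
    unfolding bounded_iff by blast
  have lip: "\<bar>L x v - L y v\<bar> \<le> \<bar>B\<bar> * norm (x - y)" if "x \<in> cball 0 R0" "y \<in> cball 0 R0" "v \<in> cball 0 h" for x y v
  proof -
    have "\<bar>L x v - L y v - (x - y) \<bullet> 0\<bar> \<le> \<bar>B\<bar> * norm (x - y)"
    proof (rule lagrangian_mean_value[OF convex_cball order_refl _ that(1,2)])
      fix z :: 'a assume "z \<in> cball 0 R0"
      then have "norm (DL z v) \<le> B" using B that(3) by auto
      then show "norm (DL z v - 0) \<le> \<bar>B\<bar>" by simp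
    qed
    then show ?thesis by simp
  qed
  show ?thesis unfolding continuous_on_iff
  proof (intro ballI allI impI)
    fix z :: "'a \<times> 'a" and e :: real assume z: "z \<in> cball 0 R0 \<times> cball 0 h" and e: "e > 0"
    obtain x v where zx: "z = (x, v)" by (cases z)
    have x: "x \<in> cball 0 R0" and v: "v \<in> cball 0 h" using z zx by auto
    have "isCont (L x) v"
      using convex_on_continuous[OF open_UNIV convex_on_lagrangian[OF x]]
      by (simp add: continuous_on_eq_continuous_at)
    then obtain d1 where d1: "d1 > 0" "\<And>w. dist w v < d1 \<Longrightarrow> dist (L x w) (L x v) < e / 2"
      using continuous_at_eps_delta[of v "L x"] e by (meson half_gt_zero)
    define k where "k = \<bar>B\<bar> + 1"
    have k: "k > 0" "\<bar>B\<bar> \<le> k" by (auto simp: k_def)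
    define d where "d = min d1 (e / (2 * k))"
    have d: "d > 0" "d \<le> d1" "d \<le> e / (2 * k)" using d1(1) e k by (auto simp: d_def)
    show "\<exists>d>0. \<forall>x'\<in>cball 0 R0 \<times> cball 0 h. dist x' z < d \<longrightarrow>
        dist (case x' of (x, v) \<Rightarrow> L x v) (case z of (x, v) \<Rightarrow> L x v) < e"
    proof (intro exI[of _ d] conjI ballI impI)
      fix z' :: "'a \<times> 'a" assume z': "z' \<in> cball 0 R0 \<times> cball 0 h" "dist z' z < d"
      obtain y w where zy: "z' = (y, w)" by (cases z')
      have y: "y \<in> cball 0 R0" and w: "w \<in> cball 0 h" using z' zy by auto
      have dy: "dist y x < d" and dw: "dist w v < d"
        using dist_fst_le[of z' z] dist_snd_le[of z' z] z'(2) zx zy by auto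
      have "\<bar>L y w - L x w\<bar> \<le> \<bar>B\<bar> * norm (y - x)" by (rule lip[OF y x w])
      also have "\<dots> \<le> k * (e / (2 * k))"
        using dy d(3) k by (intro mult_mono) (auto simp: dist_norm)
      also have "\<dots> = e / 2" using k by simp
      finally have "\<bar>L y w - L x w\<bar> \<le> e / 2" .
      moreover have "\<bar>L x w - L x v\<bar> < e / 2" using d1(2)[of w] dw d(2) by (simp add: dist_real_def)
      ultimately have "\<bar>L y w - L x v\<bar> < e" by linarith
      then show "dist (case z' of (x, v) \<Rightarrow> L x v) (case z of (x, v) \<Rightarrow> L x v) < e"
        by (simp add: zx zy dist_real_def)
    qed (rule d(1))
  qed
qed

lemma lagrangian_cont_scaled:
  assumes "0 \<le> b" "b \<le> 2"
  shows "continuous_on (closure \<Omega> \<times> cball 0 h) (\<lambda>(x, v). L (b *\<^sub>R x) v)"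
proof -
  have "continuous_on (closure \<Omega> \<times> cball 0 h) (\<lambda>z. case (b *\<^sub>R fst z, snd z) of (x, v) \<Rightarrow> L x v)"
    by (rule continuous_on_compose2[OF lagrangian_cont[of h]])
      (use scaled_closure_in assms in \<open>auto intro!: continuous_intros\<close>)
  then show ?thesis by (simp add: case_prod_unfold)
qed

text \<open>The error is controlled by the modulus of continuity of \<open>DL\<close> on a compact
  set. Uniformity in \<open>v\<close> rests on the joint continuity required in
  \<open>H4\<close>.\<close>

lemma lagrangian_dilation_derivative:
  assumes "\<epsilon> > 0"
  shows "\<exists>\<delta>>0. \<forall>s x v. \<bar>s\<bar> < \<delta> \<longrightarrow> x \<in> closure \<Omega> \<longrightarrow> v \<in> cball 0 h \<longrightarrow>
    \<bar>L ((1 + s) *\<^sub>R x) v - L x v - s * (x \<bullet> DL x v)\<bar> \<le> \<epsilon> * \<bar>s\<bar>"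
proof -
  have pos: "\<epsilon> / R0 > 0" using assms R0_pos by simp
  have uc: "uniformly_continuous_on (cball 0 R0 \<times> cball 0 h) (\<lambda>(x, v). DL x v)"
    by (rule compact_uniformly_continuous[OF DL_cont compact_Times[OF compact_cball compact_cball]])
  obtain d where d: "d > 0" "\<And>z z'. z \<in> cball 0 R0 \<times> cball 0 h \<Longrightarrow> z' \<in> cball 0 R0 \<times> cball 0 h \<Longrightarrow>
      dist z' z < d \<Longrightarrow> dist (case z' of (x, v) \<Rightarrow> DL x v) (case z of (x, v) \<Rightarrow> DL x v) < \<epsilon> / R0"
    using uc[unfolded uniformly_continuous_on_def, rule_format, OF pos] by blast
  define \<delta> where "\<delta> = min 1 (d / R0)"
  have \<delta>: "\<delta> > 0" "\<delta> \<le> 1" "\<delta> * R0 \<le> d" using d(1) R0_pos by (auto simp: \<delta>_def min_def field_simps)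
  show ?thesis
  proof (intro exI[of _ \<delta>] conjI allI impI \<delta>(1))
    fix s :: real and x v :: 'a assume s: "\<bar>s\<bar> < \<delta>" and x: "x \<in> closure \<Omega>" and v: "v \<in> cball 0 h"
    define y where "y = (1 + s) *\<^sub>R x"
    have yx: "y - x = s *\<^sub>R x" by (simp add: y_def algebra_simps)
    have nx: "norm x \<le> R0" using norm_closure_le[OF x] R0_pos by linarith
    have nyx: "norm (y - x) \<le> \<bar>s\<bar> * R0" using nx by (simp add: yx mult_left_mono)
    have xc: "x \<in> cball 0 R0" using nx by simp
    have yc: "y \<in> cball 0 R0" unfolding y_def using s \<delta>(2) x by (intro scaled_closure_in) auto
    have lt: "\<bar>s\<bar> * R0 < d"
    proof -
      have "\<bar>s\<bar> * R0 < \<delta> * R0" using s R0_pos by simp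
      then show ?thesis using \<delta>(3) by linarith
    qed
    \<comment> \<open>A convex set that contains \<open>x\<close> and \<open>y\<close> and on which
      \<open>DL\<close> stays within \<open>\<epsilon> / R0\<close> of its value at
      \<open>x\<close>.\<close>
    define S where "S = cball 0 R0 \<inter> cball x (\<bar>s\<bar> * R0)"
    have "\<bar>L y v - L x v - (y - x) \<bullet> DL x v\<bar> \<le> \<epsilon> / R0 * norm (y - x)"
    proof (rule lagrangian_mean_value)
      show "convex S" "S \<subseteq> cball 0 R0" by (auto simp: S_def convex_Int)
      show "y \<in> S" using yc nyx by (simp add: S_def dist_norm norm_minus_commute)
      show "x \<in> S" using xc R0_pos by (simp add: S_def)
      fix z assume z: "z \<in> S"
      have "dist (z, v) (x, v) < d" using z lt by (simp add: S_def dist_Pair_Pair dist_commute)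
      then have "dist (DL z v) (DL x v) < \<epsilon> / R0" using d(2)[of "(x, v)" "(z, v)"] z v xc by (simp add: S_def)
      then show "norm (DL z v - DL x v) \<le> \<epsilon> / R0" by (simp add: dist_norm)
    qed
    also have "\<dots> \<le> \<epsilon> / R0 * (\<bar>s\<bar> * R0)" using nyx assms R0_pos by (intro mult_left_mono) auto
    also have "\<dots> = \<epsilon> * \<bar>s\<bar>" using R0_pos by simp
    finally show "\<bar>L ((1 + s) *\<^sub>R x) v - L x v - s * (x \<bullet> DL x v)\<bar> \<le> \<epsilon> * \<bar>s\<bar>"
      by (simp add: yx y_def[symmetric])
  qed
qed

section \<open>Agreement of the Hamiltonian with its normalization\<close>

lemma H_cont_p: "x \<in> cball 0 R0 \<Longrightarrow> continuous_on UNIV (H x)"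
  using continuous_on_section_snd[OF H_cont] .

text \<open>The level at which constants are subsolutions, and up to which
  \<open>gradient_bound\<close> controls the momenta.\<close>

definition M :: real where "M = (SUP y\<in>cball 0 R0. H y 0)"

lemma H_zero_le: "y \<in> cball 0 R0 \<Longrightarrow> H y 0 \<le> M"
  unfolding M_def
  by (intro cSUP_upper bounded_imp_bdd_above compact_imp_bounded compact_continuous_image compact_cball
      continuous_on_section_fst[OF H_cont]) auto

lemma lagrangian_cont_v: "x \<in> cball 0 R0 \<Longrightarrow> continuous_on (cball 0 h) (L x)"
  using continuous_on_section_snd[OF lagrangian_cont] .

lemma ham_lagrangian_le:
  assumes "0 \<le> h" "x \<in> cball 0 R0" shows "ham h L x p \<le> H x p"
  using ham_le_iff[where f=L, OF assms(1) lagrangian_cont_v[OF assms(2)]] lagrangian_ge[OF assms(2)]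
  by (simp add: algebra_simps)

text \<open>Coercivity yields the gradient bound \<open>C\<close>. For \<open>p\<close> within it
  the Legendre supremum is attained at a subgradient of \<open>H x\<close> at \<open>p\<close>, and
  a Lipschitz constant of \<open>H x\<close> bounds that subgradient, which gives
  \<open>h\<close>.\<close>

lemma normalizing_radius_exists: "\<exists>h. normalizing_radius R0 H h"
proof -
  have "\<forall>\<^sub>F p in at_infinity. M < (INF x\<in>cball 0 R0. H x p)"
    using H2 unfolding H2_def filterlim_at_top_dense by blast
  then obtain b where b: "\<And>p. b \<le> norm p \<Longrightarrow> M < (INF x\<in>cball 0 R0. H x p)"
    unfolding eventually_at_infinity by blast
  define C where "C = max b 0"
  have gb: "gradient_bound R0 H C"
    unfolding gradient_bound_def M_def[symmetric]
  proof (intro ballI allI impI)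
    fix x p assume x: "x \<in> cball 0 R0" and le: "H x p \<le> M"
    have "(INF x\<in>cball 0 R0. H x p) \<le> H x p"
      by (intro cINF_lower bounded_imp_bdd_below compact_imp_bounded compact_continuous_image compact_cball
          continuous_on_section_fst[OF H_cont] x) auto
    then have "\<not> b \<le> norm p" using b[of p] le by linarith
    then show "norm p \<le> C" by (simp add: C_def)
  qed
  obtain C1 where C1: "\<And>x p q. x \<in> cball 0 R0 \<Longrightarrow> p \<in> cball 0 (C + 1) \<Longrightarrow> q \<in> cball 0 (C + 1) \<Longrightarrow>
      \<bar>H x p - H x q\<bar> \<le> C1 * norm (p - q)"
  proof -
    have "C + 1 > 0" by (simp add: C_def)
    then show thesis using H1 that unfolding H1_def by meson
  qed
  define h where "h = max C1 1"
  have h: "h > 0" by (simp add: h_def)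
  have "H x p = ham h L x p" if x: "x \<in> cball 0 R0" and p: "p \<in> cball 0 C" for x p
  proof (rule order_antisym)
    show "ham h L x p \<le> H x p" using ham_lagrangian_le h x by simp
    have "convex_on UNIV (H x)" using H3 x by (simp add: H3_def)
    then obtain v where v: "\<And>q. H x p + (q - p) \<bullet> v \<le> H x q" using convex_on_subgradient by blast
    have "norm v \<le> h"
    proof (cases "v = 0")
      case True then show ?thesis using h by simp
    next
      case False
      \<comment> \<open>A unit step in the direction of \<open>v\<close> raises \<open>H x\<close>
        by at least \<open>norm v\<close>. The step may leave the ball of radius \<open>C\<close>,
        hence the Lipschitz bound on radius \<open>C + 1\<close>.\<close>
      define q where "q = p + (1 / norm v) *\<^sub>R v"
      have nq: "norm (q - p) = 1" using False by (simp add: q_def)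
      then have "norm q \<le> C + 1" using p norm_triangle_ineq[of p "q - p"] by simp
      moreover have "(q - p) \<bullet> v = norm v" using False by (simp add: q_def dot_square_norm power2_eq_square)
      ultimately have "norm v \<le> \<bar>H x q - H x p\<bar>" using v[of q] by linarith
      also have "\<dots> \<le> C1" using C1[OF x, of q p] \<open>norm q \<le> C + 1\<close> p nq by simp
      finally show ?thesis by (simp add: h_def)
    qed
    moreover have "L x v \<le> p \<bullet> v - H x p"
    proof (rule lagrangian_le)
      fix q show "q \<bullet> v - H x q \<le> p \<bullet> v - H x p" using v[of q] by (simp add: inner_diff_left)
    qed
    moreover have "p \<bullet> v - L x v \<le> ham h L x p"
      using ham_le_iff[of h L x p "ham h L x p"] h lagrangian_cont_v[OF x, of h] \<open>norm v \<le> h\<close> by simp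
    ultimately show "H x p \<le> ham h L x p" by linarith
  qed
  then show ?thesis using gb h unfolding normalizing_radius_def by blast
qed

text \<open>The Hamiltonians agree for momenta of norm at most \<open>C\<close>, so \<open>p\<close>
  must be confined there. On the segment from some \<open>q\<close> with \<open>H x q < M\<close> to
  \<open>p\<close>, convexity keeps the normalized value below \<open>M\<close>. Where the norm is
  at most \<open>C\<close> this is the value of \<open>H\<close>, and \<open>H <= M\<close> in turn
  forces the norm bound. Hence the parameters with norm at most \<open>C\<close> are both open and
  closed in the unit interval.\<close>

lemma ham_le_imp_H_le:
  assumes nr: "normalizing_radius R0 H h" and x: "x \<in> cball 0 R0" and c: "c < M"
    and le: "ham h L x p \<le> c"
  shows "H x p \<le> c"
proof -
  obtain C where h: "0 < h" and gb: "\<And>p. H x p \<le> M \<Longrightarrow> norm p \<le> C"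
    and eq: "\<And>p. p \<in> cball 0 C \<Longrightarrow> H x p = ham h L x p"
    using nr x unfolding normalizing_radius_def gradient_bound_def M_def by blast
  have iff: "ham h L x p \<le> d \<longleftrightarrow> (\<forall>v\<in>cball 0 h. p \<bullet> v - L x v \<le> d)" for p d
    using ham_le_iff[of h L x p d] h lagrangian_cont_v[OF x] by simp
  have "norm p \<le> C"
  proof (rule ccontr)
    assume np: "\<not> norm p \<le> C"
    \<comment> \<open>If \<open>H x >= M\<close> everywhere, then \<open>L x 0 <= - M\<close>, and
      the velocity 0 alone makes \<open>ham h L x p\<close> at least \<open>M > c\<close>.\<close>
    obtain q where q: "H x q < M"
    proof (rule ccontr)
      assume "\<not> thesis"
      then have "M \<le> H x q" for q using that not_le by blast
      then have "L x 0 \<le> - M" by (intro lagrangian_le) simp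
      moreover have "p \<bullet> 0 - L x 0 \<le> c" using iff[of p c] le h by (metis centre_in_cball less_imp_le)
      ultimately show False using c by simp
    qed
    define g where "g t = q + t *\<^sub>R (p - q)" for t
    have gc: "continuous_on A g" for A unfolding g_def by (intro continuous_intros)
    define A where "A = {t \<in> {0..1}. norm (g t) \<le> C}"
    have below: "H x (g t) < M" if t: "t \<in> A" for t
    proof -
      have t01: "0 \<le> t" "t \<le> 1" using t by (auto simp: A_def)
      have "ham h L x (g t) \<le> (1 - t) * H x q + t * c"
        unfolding iff
      proof
        fix v :: 'a assume v: "v \<in> cball 0 h"
        have "(1 - t) * (q \<bullet> v - L x v) \<le> (1 - t) * H x q"
          using lagrangian_ge[OF x, of q v] t01 by (intro mult_left_mono) auto
        moreover have "t * (p \<bullet> v - L x v) \<le> t * c" using le v t01 unfolding iff by (intro mult_left_mono) auto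
        ultimately show "g t \<bullet> v - L x v \<le> (1 - t) * H x q + t * c"
          by (simp add: g_def inner_add_left inner_diff_left algebra_simps)
      qed
      also have "\<dots> < M"
      proof (cases "t = 0")
        case False
        then have "t * c < t * M" using c t01 by simp
        moreover have "(1 - t) * H x q \<le> (1 - t) * M" using q t01 by (intro mult_left_mono) auto
        ultimately show ?thesis by (simp add: algebra_simps)
      qed (use q in simp)
      finally show ?thesis using eq[of "g t"] t by (simp add: A_def)
    qed
    have "A = {t \<in> {0..1}. H x (g t) < M}"
      using below gb by (auto simp: A_def less_imp_le)
    also have "\<dots> = {0..1} \<inter> (\<lambda>t. H x (g t)) -` {..<M}" by auto
    finally have "openin (top_of_set {0..1}) A"
      using continuous_on_compose2[OF H_cont_p[OF x] gc, of "{0..1}"]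
        continuous_openin_preimage_gen[of "{0..1}" "\<lambda>t. H x (g t)" "{..<M}"] by simp
    moreover have "closedin (top_of_set {0..1}) A"
    proof -
      have "A = {0..1} \<inter> (\<lambda>t. norm (g t)) -` {..C}" by (auto simp: A_def)
      then show ?thesis
        using continuous_closedin_preimage[of "{0..1}" "\<lambda>t. norm (g t)" "{..C}"] gc[of "{0..1}"]
        by (simp add: continuous_on_norm)
    qed
    moreover have "connected {0..1::real}" by simp
    ultimately have "A = {} \<or> A = {0..1}" unfolding connected_clopen by blast
    moreover have "0 \<in> A" using gb[of q] q by (simp add: A_def g_def less_imp_le)
    moreover have "1 \<notin> A" using np by (simp add: A_def g_def)
    ultimately show False by auto
  qed
  then show ?thesis using eq[of p] le by simp
qed

section \<open>Duality for the eigenvalues of dilated domains\<close>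

abbreviation "eig b \<equiv> additive_eigenvalue H (dilate b \<Omega>)"

abbreviation "levels b \<equiv> {c. \<exists>u. viscosity_subsolution (\<lambda>x p. H x p - c) (dilate b \<Omega>) u}"

section \<open>Bounds and monotonicity of the eigenvalues\<close>

lemma M_level: "0 < b \<Longrightarrow> b \<le> 2 \<Longrightarrow> M \<in> levels b"
  using viscosity_subsolution_const[OF open_dilate, of b "\<lambda>x p. H x p - M"] H_zero_le dilate_in by fastforce

text \<open>At a contact point \<open>H x p <= c\<close>, while \<open>H x p >= - L x 0\<close> for
  every \<open>p\<close>. This makes the \<open>Inf\<close> in the eigenvalue a genuine
  infimum.\<close>

lemma levels_bdd_below:
  assumes b: "0 < b" "b \<le> 2" shows "bdd_below (levels b)"
proof -
  have "continuous_on (cball 0 R0) (\<lambda>x. L x 0)"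
    by (rule continuous_on_section_fst[OF lagrangian_cont[of 0]]) simp
  then have "bounded ((\<lambda>x. L x 0) ` cball 0 R0)"
    by (intro compact_imp_bounded compact_continuous_image compact_cball)
  then obtain B where B: "\<forall>y\<in>(\<lambda>x. L x 0) ` cball 0 R0. norm y \<le> B" unfolding bounded_iff by blast
  have "- B \<le> c" if c: "c \<in> levels b" for c
  proof -
    obtain u where u: "viscosity_subsolution (\<lambda>x p. H x p - c) (dilate b \<Omega>) u" using c by blast
    have "0 \<in> dilate b \<Omega>" using zero_in by (auto simp: dilate_def intro!: image_eqI[of _ _ 0])
    then obtain x p where x: "x \<in> dilate b \<Omega>" and le: "H x p - c \<le> 0"
      using viscosity_subsolution_contact[OF u open_dilate[OF b(1)]] by blast
    have xc: "x \<in> cball 0 R0" using dilate_in[OF b x] .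
    have "\<bar>L x 0\<bar> \<le> B" using B xc by auto
    then show ?thesis using lagrangian_ge[OF xc, of p 0] le by simp
  qed
  then show ?thesis by (intro bdd_belowI) blast
qed

lemma eig_le_M: "0 < b \<Longrightarrow> b \<le> 2 \<Longrightarrow> eig b \<le> M"
  unfolding additive_eigenvalue_def by (intro cInf_lower M_level levels_bdd_below)

text \<open>Star-shapedness nests the dilates, and subsolutions restrict to smaller domains.\<close>

lemma eig_mono:
  assumes "0 < a" "a \<le> b" "b \<le> 2" shows "eig a \<le> eig b"
  unfolding additive_eigenvalue_def
proof (rule cInf_superset_mono)
  show "levels b \<noteq> {}" using M_level[of b] assms by auto
  show "bdd_below (levels a)" using levels_bdd_below assms by simp
  have "dilate a \<Omega> \<subseteq> dilate b \<Omega>"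
  proof
    fix y assume "y \<in> dilate a \<Omega>"
    then obtain x where x: "x \<in> \<Omega>" "y = a *\<^sub>R x" by (auto simp: dilate_def)
    have "(a / b) *\<^sub>R x \<in> \<Omega>" using star_shaped[OF x(1)] assms by simp
    moreover have "y = b *\<^sub>R ((a / b) *\<^sub>R x)" using x assms by simp
    ultimately show "y \<in> dilate b \<Omega>" unfolding dilate_def by (rule image_eqI[rotated])
  qed
  then show "levels b \<subseteq> levels a" using viscosity_subsolution_subset[OF _ open_dilate[OF assms(1)]] by blast
qed

section \<open>Measures dual to the cone of subsolutions\<close>

lemma closure_dom_compact: "compact (closure \<Omega>)"
proof -
  have "bounded (closure \<Omega>)" using norm_closure_le unfolding bounded_iff by blast
  then show ?thesis by (simp add: compact_eq_bounded_closed)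
qed

abbreviation "phase h \<equiv> closure \<Omega> \<times> cball (0::'a) h"

lemma compact_phase: "compact (phase h)"
  by (intro compact_Times closure_dom_compact compact_cball)

abbreviation "dual_probs h \<equiv> {\<mu> \<in> G0_dual \<Omega> h. prob_space \<mu>}"

text \<open>A subsolution need not be continuous up to the boundary, but its restriction to a slightly
  smaller dilate of the domain is.\<close>

lemma dual_prob_lower_level:
  assumes h: "0 \<le> h" and b: "0 < b" "b \<le> 2" and \<mu>: "\<mu> \<in> dual_probs h" and c: "c \<in> levels b"
  shows "- c \<le> pairing \<mu> (\<lambda>x v. L (b *\<^sub>R x) v)"
proof (rule field_le_epsilon)
  fix e :: real assume e: "e > 0"
  obtain u where u: "viscosity_subsolution (\<lambda>x p. H x p - c) (dilate b \<Omega>) u" using c by blast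
  have P: "prob_on (phase h) \<mu>" using \<mu> by (auto simp: G0_dual_def)
  have uc: "uniformly_continuous_on (cball 0 R0 \<times> cball 0 h) (\<lambda>(x, v). L x v)"
    by (rule compact_uniformly_continuous[OF lagrangian_cont compact_Times[OF compact_cball compact_cball]])
  obtain d where d: "d > 0" "\<And>z z'. z \<in> cball 0 R0 \<times> cball 0 h \<Longrightarrow> z' \<in> cball 0 R0 \<times> cball 0 h \<Longrightarrow>
      dist z' z < d \<Longrightarrow> dist (case z' of (x, v) \<Rightarrow> L x v) (case z of (x, v) \<Rightarrow> L x v) < e"
    using uc[unfolded uniformly_continuous_on_def, rule_format, OF e] by blast
  \<comment> \<open>The factor \<open>\<tau>\<close> moves points of the dilated closure by at most
    \<open>(1 - \<tau>) * R0 < d\<close>, within the modulus of \<open>L\<close>; the minimum with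
    1/2 keeps \<open>\<tau>\<close> positive.\<close>
  define \<tau> where "\<tau> = 1 - min (1/2) (d / (2 * R0))"
  have \<tau>: "0 < \<tau>" "\<tau> < 1" "(1 - \<tau>) * R0 < d"
  proof -
    show "0 < \<tau>" "\<tau> < 1" using d(1) R0_pos by (auto simp: \<tau>_def min_def)
    have "(1 - \<tau>) * R0 \<le> d / (2 * R0) * R0" using R0_pos by (intro mult_right_mono) (auto simp: \<tau>_def)
    also have "\<dots> < d" using R0_pos d(1) by simp
    finally show "(1 - \<tau>) * R0 < d" .
  qed
  define k where "k = \<tau> * b"
  have k: "0 < k" "k \<le> 2" using \<tau> b mult_mono[of \<tau> 1 b 2] by (auto simp: k_def)
  have kin: "k *\<^sub>R x \<in> dilate b \<Omega>" if "x \<in> closure \<Omega>" for x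
  proof -
    have "\<tau> *\<^sub>R x \<in> \<Omega>" using shrink_closure[OF that] \<tau> by simp
    moreover have "k *\<^sub>R x = b *\<^sub>R (\<tau> *\<^sub>R x)" by (simp add: k_def mult.commute)
    ultimately show ?thesis unfolding dilate_def by (rule image_eqI[rotated])
  qed
  define f where "f x v = L (k *\<^sub>R x) v + c" for x v
  have fc: "continuous_on (phase h) (\<lambda>(x, v). f x v)"
    unfolding f_def using continuous_on_add[OF lagrangian_cont_scaled[of k h] continuous_on_const[of _ c]] k
    by (simp add: case_prod_unfold)
  have "f \<in> G0 \<Omega> h"
    unfolding G0_def mem_Collect_eq
  proof (intro conjI fc exI)
    have "continuous_on (dilate b \<Omega>) u" using u by (simp add: viscosity_subsolution_def)
    then show "continuous_on (closure \<Omega>) (\<lambda>x. (1 / k) * u (k *\<^sub>R x))"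
      using kin by (intro continuous_on_mult_left continuous_on_compose2[of "dilate b \<Omega>" u _ "\<lambda>x. k *\<^sub>R x"])
        (auto intro!: continuous_intros)
    \<comment> \<open>The factor \<open>1 / k\<close> in front of \<open>u\<close> offsets the
      dilation by \<open>k\<close>, so momenta are unchanged.\<close>
    have "viscosity_subsolution (\<lambda>x p. H (k *\<^sub>R x) ((1 / (1 / k * k)) *\<^sub>R p) - c) \<Omega> (\<lambda>x. (1 / k) * u (k *\<^sub>R x))"
      by (rule viscosity_subsolution_dilate[OF u]) (use k kin open_dom closure_subset[of \<Omega>] in auto)
    then show "viscosity_subsolution (ham h f) \<Omega> (\<lambda>x. (1 / k) * u (k *\<^sub>R x))"
    proof (rule viscosity_subsolution_mono)
      fix x p assume x: "x \<in> \<Omega>" and le: "H (k *\<^sub>R x) ((1 / (1 / k * k)) *\<^sub>R p) - c \<le> 0"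
      have xc: "x \<in> closure \<Omega>" using x closure_subset by blast
      have kx: "k *\<^sub>R x \<in> cball 0 R0" using scaled_closure_in[OF xc] k by simp
      have "p \<bullet> v - f x v \<le> 0" for v
        using lagrangian_ge[OF kx, of p v] le k by (simp add: f_def)
      then show "ham h f x p \<le> 0"
        using ham_le_iff[where f=f, OF h continuous_on_section_snd[OF fc xc]] by blast
    qed
  qed
  then have "0 \<le> pairing \<mu> f" using \<mu> by (auto simp: G0_dual_def)
  moreover have "\<bar>pairing \<mu> f - pairing \<mu> (\<lambda>x v. L (b *\<^sub>R x) v + c)\<bar> \<le> e"
    unfolding pairing_def
  proof (rule prob_on_integral_diff_le[OF compact_phase P fc])
    show "continuous_on (phase h) (\<lambda>(x, v). L (b *\<^sub>R x) v + c)"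
      using continuous_on_add[OF lagrangian_cont_scaled[of b h] continuous_on_const[of _ c]] b
      by (simp add: case_prod_unfold)
    fix z assume z: "z \<in> phase h"
    obtain x v where zx: "z = (x, v)" by (cases z)
    have x: "x \<in> closure \<Omega>" and v: "v \<in> cball 0 h" using z zx by auto
    have in1: "k *\<^sub>R x \<in> cball 0 R0" and in2: "b *\<^sub>R x \<in> cball 0 R0" using scaled_closure_in[OF x] k b by auto
    have "k *\<^sub>R x - b *\<^sub>R x = (- (1 - \<tau>)) *\<^sub>R (b *\<^sub>R x)" by (simp add: k_def algebra_simps)
    then have "dist (k *\<^sub>R x) (b *\<^sub>R x) = (1 - \<tau>) * norm (b *\<^sub>R x)"
      unfolding dist_norm using \<tau> by (simp only: norm_scaleR abs_minus_cancel abs_of_pos diff_gt_0_iff_gt)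
    also have "\<dots> \<le> (1 - \<tau>) * R0" using in2 \<tau> by (intro mult_left_mono) auto
    also have "\<dots> < d" by (rule \<tau>(3))
    finally have "dist (k *\<^sub>R x, v) (b *\<^sub>R x, v) < d" by (simp add: dist_Pair_Pair)
    then have "dist (L (k *\<^sub>R x) v) (L (b *\<^sub>R x) v) < e"
      using d(2)[of "(b *\<^sub>R x, v)" "(k *\<^sub>R x, v)"] in1 in2 v by simp
    then show "\<bar>(case z of (x, v) \<Rightarrow> f x v) - (case z of (x, v) \<Rightarrow> L (b *\<^sub>R x) v + c)\<bar> \<le> e"
      by (simp add: zx f_def dist_real_def)
  qed
  moreover have "pairing \<mu> (\<lambda>x v. L (b *\<^sub>R x) v + c) = pairing \<mu> (\<lambda>x v. L (b *\<^sub>R x) v) + c"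
  proof -
    interpret prob_space \<mu> using P by blast
    have "integrable \<mu> (\<lambda>(x, v). L (b *\<^sub>R x) v)"
      using prob_on_integrable[OF compact_phase _ finite_measure_axioms lagrangian_cont_scaled[of b h]] P b by simp
    then show ?thesis by (simp add: pairing_def case_prod_unfold prob_space)
  qed
  ultimately show "- c \<le> pairing \<mu> (\<lambda>x v. L (b *\<^sub>R x) v) + e" by linarith
qed

lemma dual_prob_lower:
  assumes "0 \<le> h" "0 < b" "b \<le> 2" "\<mu> \<in> dual_probs h"
  shows "- eig b \<le> pairing \<mu> (\<lambda>x v. L (b *\<^sub>R x) v)"
proof -
  have "- pairing \<mu> (\<lambda>x v. L (b *\<^sub>R x) v) \<le> eig b"
    unfolding additive_eigenvalue_def
  proof (rule cInf_greatest)
    show "levels b \<noteq> {}" using M_level assms by blast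
    fix c assume "c \<in> levels b"
    then show "- pairing \<mu> (\<lambda>x v. L (b *\<^sub>R x) v) \<le> c" using dual_prob_lower_level[OF assms, of c] by linarith
  qed
  then show ?thesis by linarith
qed

lemma G0_add:
  assumes h: "0 \<le> h" and f: "f \<in> G0 \<Omega> h" and g: "g \<in> G0 \<Omega> h"
  shows "(\<lambda>x v. f x v + g x v) \<in> G0 \<Omega> h"
proof -
  obtain u w where u: "continuous_on (closure \<Omega>) u" "viscosity_subsolution (ham h f) \<Omega> u"
    and w: "continuous_on (closure \<Omega>) w" "viscosity_subsolution (ham h g) \<Omega> w"
    and fc: "continuous_on (phase h) (\<lambda>(x, v). f x v)" and gc: "continuous_on (phase h) (\<lambda>(x, v). g x v)"
    using f g unfolding G0_def by auto
  have sub: "\<Omega> \<times> cball 0 h \<subseteq> phase h" using closure_subset by auto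
  have "viscosity_subsolution (ham h (\<lambda>x v. f x v + g x v)) \<Omega> (\<lambda>x. u x + w x)"
    by (rule viscosity_subsolution_add[OF open_dom h continuous_on_subset[OF fc sub] continuous_on_subset[OF gc sub] u(2) w(2)])
  moreover have "continuous_on (phase h) (\<lambda>(x, v). f x v + g x v)"
    using continuous_on_add[OF fc gc] by (simp add: case_prod_unfold)
  moreover have "continuous_on (closure \<Omega>) (\<lambda>x. u x + w x)" by (intro continuous_on_add u w)
  ultimately show ?thesis unfolding G0_def by blast
qed

lemma G0_scale:
  assumes h: "0 \<le> h" and f: "f \<in> G0 \<Omega> h" and k: "k > 0"
  shows "(\<lambda>x v. k * f x v) \<in> G0 \<Omega> h"
proof -
  obtain u where u: "continuous_on (closure \<Omega>) u" "viscosity_subsolution (ham h f) \<Omega> u"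
    and fc: "continuous_on (phase h) (\<lambda>(x, v). f x v)"
    using f unfolding G0_def by auto
  have kc: "continuous_on (phase h) (\<lambda>(x, v). k * f x v)"
    using continuous_on_mult_left[OF fc, of k] by (simp add: case_prod_unfold)
  have "viscosity_subsolution (\<lambda>x p. ham h f (1 *\<^sub>R x) ((1 / (k * 1)) *\<^sub>R p)) \<Omega> (\<lambda>x. k * u (1 *\<^sub>R x))"
    by (rule viscosity_subsolution_dilate[OF u(2) k zero_less_one open_dom]) simp
  then have "viscosity_subsolution (\<lambda>x p. ham h f x ((1 / k) *\<^sub>R p)) \<Omega> (\<lambda>x. k * u x)" by simp
  then have "viscosity_subsolution (ham h (\<lambda>x v. k * f x v)) \<Omega> (\<lambda>x. k * u x)"
  proof (rule viscosity_subsolution_mono)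
    fix x p assume x: "x \<in> \<Omega>" and le: "ham h f x ((1 / k) *\<^sub>R p) \<le> 0"
    have xc: "x \<in> closure \<Omega>" using x closure_subset by blast
    have "p \<bullet> v - k * f x v \<le> 0" if "v \<in> cball 0 h" for v
    proof -
      have "((1 / k) *\<^sub>R p) \<bullet> v - f x v \<le> 0"
        using ham_le_iff[where f=f, OF h continuous_on_section_snd[OF fc xc]] le that by blast
      then show ?thesis using k by (simp add: field_simps)
    qed
    then show "ham h (\<lambda>x v. k * f x v) x p \<le> 0"
      using ham_le_iff[where f="\<lambda>x v. k * f x v", OF h continuous_on_section_snd[OF kc xc]] by blast
  qed
  moreover have "continuous_on (closure \<Omega>) (\<lambda>x. k * u x)" by (intro continuous_on_mult_left u)
  ultimately show ?thesis using kc unfolding G0_def by blast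
qed

lemma G0_zero:
  assumes h: "0 \<le> h" shows "(\<lambda>x v. 0) \<in> G0 \<Omega> h"
proof -
  have "ham h (\<lambda>x v. 0) x 0 \<le> 0" for x :: 'a using ham_le_iff[OF h, of "\<lambda>x v. 0" x 0 0] by simp
  then have "viscosity_subsolution (ham h (\<lambda>x v. 0)) \<Omega> (\<lambda>x. 0)"
    by (intro viscosity_subsolution_const open_dom) auto
  then show ?thesis unfolding G0_def mem_Collect_eq
    by (intro conjI exI[of _ "\<lambda>x. 0"]) (auto simp: case_prod_unfold)
qed

text \<open>If an element of the cone were at most \<open>-e < 0\<close>, a multiple of its subsolution would be a
  subsolution at a level below the eigenvalue (or of an unsolvable problem, if \<open>a = 0\<close>).\<close>

lemma cone_not_negative:
  assumes nr: "normalizing_radius R0 H h" and b: "0 < b" "b \<le> 2" and g: "g \<in> G0 \<Omega> h"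
    and a: "0 \<le> a" and e: "e > 0"
  shows "\<exists>x\<in>closure \<Omega>. \<exists>v\<in>cball 0 h. - e < g x v - a * (L (b *\<^sub>R x) v + eig b)"
proof (rule ccontr)
  assume "\<not> ?thesis"
  then have neg: "g x v \<le> a * (L (b *\<^sub>R x) v + eig b) - e" if "x \<in> closure \<Omega>" "v \<in> cball 0 h" for x v
    using that by force
  have h: "0 \<le> h" using nr by (simp add: normalizing_radius_def)
  obtain u where u: "viscosity_subsolution (ham h g) \<Omega> u"
    and gc: "continuous_on (phase h) (\<lambda>(x, v). g x v)" using g unfolding G0_def by auto
  have iff: "ham h g x p \<le> 0 \<longleftrightarrow> (\<forall>v\<in>cball 0 h. p \<bullet> v - g x v \<le> 0)" if "x \<in> closure \<Omega>" for x p
    by (rule ham_le_iff[where f=g, OF h continuous_on_section_snd[OF gc that]])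
  show False
  proof (cases "a = 0")
    case True
    obtain x p where x: "x \<in> \<Omega>" and le: "ham h g x p \<le> 0"
      using viscosity_subsolution_contact[OF u open_dom zero_in] by blast
    have xc: "x \<in> closure \<Omega>" using x closure_subset by blast
    \<comment> \<open>The velocity 0 is admissible and removes the unknown momentum, so
      \<open>g x 0 >= 0\<close>.\<close>
    have "p \<bullet> 0 - g x 0 \<le> 0" using iff[OF xc] le h by (metis centre_in_cball)
    then show False using neg[OF xc, of 0] h True e by simp
  next
    case False
    then have a0: "a > 0" using a by simp
    define c where "c = eig b - e / a"
    have c: "c < eig b" using a0 e by (simp add: c_def)
    have pre: "(1 / b) *\<^sub>R y \<in> \<Omega>" if "y \<in> dilate b \<Omega>" for y using that b by (auto simp: dilate_def)
    \<comment> \<open>The factor \<open>b / a\<close> divides the gradient of \<open>u\<close> by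
      \<open>a\<close>. A momentum \<open>p\<close> of the new function is thus
      \<open>a *\<^sub>R p\<close> for \<open>u\<close>, and dividing the inequality by
      \<open>a\<close> leaves the level \<open>c\<close>.\<close>
    have "viscosity_subsolution (\<lambda>y p. ham h g ((1 / b) *\<^sub>R y) ((1 / (b / a * (1 / b))) *\<^sub>R p)) (dilate b \<Omega>)
        (\<lambda>y. b / a * u ((1 / b) *\<^sub>R y))"
      by (rule viscosity_subsolution_dilate[OF u]) (use a0 b pre open_dilate in auto)
    then have "viscosity_subsolution (\<lambda>y p. H y p - c) (dilate b \<Omega>) (\<lambda>y. b / a * u ((1 / b) *\<^sub>R y))"
    proof (rule viscosity_subsolution_mono)
      fix y p assume y: "y \<in> dilate b \<Omega>" and "ham h g ((1 / b) *\<^sub>R y) ((1 / (b / a * (1 / b))) *\<^sub>R p) \<le> 0"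
      then have le: "ham h g ((1 / b) *\<^sub>R y) (a *\<^sub>R p) \<le> 0" using b a0 by simp
      have yc: "y \<in> cball 0 R0" using dilate_in[OF b y] .
      have xc: "(1 / b) *\<^sub>R y \<in> closure \<Omega>" using pre[OF y] closure_subset by blast
      have "p \<bullet> v - L y v \<le> c" if v: "v \<in> cball 0 h" for v
      proof -
        have "(a *\<^sub>R p) \<bullet> v - g ((1 / b) *\<^sub>R y) v \<le> 0" using iff[OF xc] le v by blast
        then have "a * (p \<bullet> v) \<le> a * (L y v + eig b) - e" using neg[OF xc v] b by simp
        then have "a * (p \<bullet> v - L y v) \<le> a * c" using a0 by (simp add: c_def algebra_simps)
        then show ?thesis using a0 by simp
      qed
      then have "ham h L y p \<le> c" using ham_le_iff[where f=L, OF h lagrangian_cont_v[OF yc]] by blast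
      \<comment> \<open>The return from the normalized Hamiltonian to \<open>H\<close> is possible
        because \<open>c < eig b <= M\<close>.\<close>
      then have "H y p \<le> c" using ham_le_imp_H_le[OF nr yc] c eig_le_M[OF b] by simp
      then show "H y p - c \<le> 0" by simp
    qed
    then have "eig b \<le> c"
      unfolding additive_eigenvalue_def using levels_bdd_below[OF b] by (intro cInf_lower) blast+
    then show False using c by simp
  qed
qed

text \<open>Separation is applied to the cone of all \<open>g - a * (L + eig b)\<close>, with
  \<open>L\<close> taken at dilated points, \<open>g\<close> in \<open>G0\<close> and
  \<open>a >= 0\<close>. Positivity for \<open>a = 0\<close> places the measure in the dual cone;
  the element with \<open>g = 0\<close> and \<open>a = 1\<close> gives the inequality opposite to
  \<open>dual_prob_lower\<close>.\<close>

lemma dual_prob_attained: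
  assumes nr: "normalizing_radius R0 H h" and b: "0 < b" "b \<le> 2"
  shows "\<exists>\<mu>\<in>dual_probs h. pairing \<mu> (\<lambda>x v. L (b *\<^sub>R x) v) = - eig b"
proof -
  have h: "0 \<le> h" using nr by (simp add: normalizing_radius_def)
  define \<gamma> where "\<gamma> g a = (\<lambda>z. g (fst z) (snd z) - a * (L (b *\<^sub>R fst z) (snd z) + eig b))"
    for g :: "'a \<Rightarrow> 'a \<Rightarrow> real" and a :: real
  define \<Gamma> where "\<Gamma> = {\<gamma> g a |g a. g \<in> G0 \<Omega> h \<and> 0 \<le> a}"
  have Lc: "continuous_on (phase h) (\<lambda>z. L (b *\<^sub>R fst z) (snd z))"
    using lagrangian_cont_scaled[of b h] b by (simp add: case_prod_unfold)
  have \<gamma>c: "continuous_on (phase h) (\<gamma> g a)" if "g \<in> G0 \<Omega> h" for g a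
  proof -
    have "continuous_on (phase h) (\<lambda>z. g (fst z) (snd z))" using that by (simp add: G0_def case_prod_unfold)
    then show ?thesis unfolding \<gamma>_def by (intro continuous_intros Lc)
  qed
  obtain \<mu> where \<mu>: "prob_on (phase h) \<mu>" and
    pos: "\<And>\<gamma>. \<gamma> \<in> \<Gamma> \<Longrightarrow> continuous_on (phase h) \<gamma> \<Longrightarrow> 0 \<le> integral\<^sup>L \<mu> \<gamma>"
  proof (rule cone_dual_measure[OF compact_phase, of \<Gamma> h])
    show "bounded (f ` phase h)" if "f \<in> \<Gamma>" for f
      using that \<gamma>c compact_imp_bounded[OF compact_continuous_image[OF _ compact_phase]] unfolding \<Gamma>_def by blast
    have "\<gamma> (\<lambda>x v. 0) 0 = (\<lambda>z. 0)" by (simp add: \<gamma>_def)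
    then show "(\<lambda>z. 0) \<in> \<Gamma>" unfolding \<Gamma>_def using G0_zero[OF h] order_refl by (metis (mono_tags, lifting) mem_Collect_eq)
    fix f assume f: "f \<in> \<Gamma>"
    then obtain g a where ga: "f = \<gamma> g a" "g \<in> G0 \<Omega> h" "0 \<le> a" unfolding \<Gamma>_def by blast
    show "(\<lambda>x. f x + f' x) \<in> \<Gamma>" if f': "f' \<in> \<Gamma>" for f'
    proof -
      obtain g' a' where ga': "f' = \<gamma> g' a'" "g' \<in> G0 \<Omega> h" "0 \<le> a'" using f' unfolding \<Gamma>_def by blast
      have "(\<lambda>x. f x + f' x) = \<gamma> (\<lambda>x v. g x v + g' x v) (a + a')"
        unfolding ga ga' \<gamma>_def by (simp add: fun_eq_iff algebra_simps)
      then show ?thesis unfolding \<Gamma>_def using G0_add[OF h ga(2) ga'(2)] add_nonneg_nonneg[OF ga(3) ga'(3)] by blast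
    qed
    show "(\<lambda>x. k * f x) \<in> \<Gamma>" if k: "k > 0" for k
    proof -
      have "(\<lambda>x. k * f x) = \<gamma> (\<lambda>x v. k * g x v) (k * a)"
        unfolding ga \<gamma>_def by (simp add: fun_eq_iff algebra_simps)
      moreover have "0 \<le> k * a" using k ga(3) by simp
      ultimately show ?thesis unfolding \<Gamma>_def using G0_scale[OF h ga(2) k] by blast
    qed
    show "\<exists>z\<in>phase h. - e < f z" if e: "e > 0" for e
    proof -
      obtain x v where "x \<in> closure \<Omega>" "v \<in> cball 0 h" "- e < g x v - a * (L (b *\<^sub>R x) v + eig b)"
        using cone_not_negative[OF nr b ga(2,3) e] by blast
      then show ?thesis unfolding ga(1) \<gamma>_def by (intro bexI[of _ "(x, v)"]) auto
    qed
  qed blast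
  interpret prob_space \<mu> using \<mu> by blast
  have "0 \<le> pairing \<mu> g" if g: "g \<in> G0 \<Omega> h" for g
  proof -
    have "\<gamma> g 0 \<in> \<Gamma>" unfolding \<Gamma>_def using g by blast
    then have "0 \<le> integral\<^sup>L \<mu> (\<gamma> g 0)" using pos \<gamma>c[OF g] by blast
    then show ?thesis by (simp add: pairing_def \<gamma>_def case_prod_unfold)
  qed
  then have D: "\<mu> \<in> dual_probs h" using \<mu> finite_measure_axioms by (simp add: G0_dual_def)
  have "\<gamma> (\<lambda>x v. 0) 1 \<in> \<Gamma>" unfolding \<Gamma>_def using G0_zero[OF h] zero_le_one by blast
  then have "0 \<le> integral\<^sup>L \<mu> (\<gamma> (\<lambda>x v. 0) 1)" using pos \<gamma>c[OF G0_zero[OF h]] by blast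
  moreover have "integrable \<mu> (\<lambda>z. L (b *\<^sub>R fst z) (snd z))"
    using prob_on_integrable[OF compact_phase _ finite_measure_axioms Lc] \<mu> by blast
  ultimately have "pairing \<mu> (\<lambda>x v. L (b *\<^sub>R x) v) \<le> - eig b"
    by (simp add: pairing_def \<gamma>_def case_prod_unfold prob_space)
  then have "pairing \<mu> (\<lambda>x v. L (b *\<^sub>R x) v) = - eig b" using dual_prob_lower[OF h b D] by linarith
  then show ?thesis using D by blast
qed

section \<open>One-sided derivatives of the eigenvalue\<close>

lemma dilate_1: "dilate 1 \<Omega> = \<Omega>" by (simp add: dilate_def)

lemma DL_pairing_eq:
  assumes "sets \<mu> = sets (restrict_space borel (phase h))"
  shows "DL_pairing H \<mu> = (\<integral>z. (- fst z) \<bullet> DL (fst z) (snd z) \<partial>\<mu>)"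
  unfolding DL_pairing_def pairing_def
  by (rule Bochner_Integration.integral_cong)
    (auto simp: prob_on_space[OF assms] gradient_lagrangian)

text \<open>The sign \<open>\<sigma>\<close> treats expansion and contraction together. For
  \<open>\<sigma> = -1\<close> a maximum of \<open>- DL_pairing\<close> is attained, which becomes
  the minimum in the left limit.\<close>

lemma eigenvalue_one_sided_derivative:
  assumes nr: "normalizing_radius R0 H h" and \<sigma>: "\<sigma> = 1 \<or> \<sigma> = -1"
  shows "\<exists>\<mu>\<in>mather_measures H \<Omega> h.
    (\<forall>\<nu>\<in>mather_measures H \<Omega> h. \<sigma> * DL_pairing H \<nu> \<le> \<sigma> * DL_pairing H \<mu>) \<and>
    ((\<lambda>s. (eig (1 + \<sigma> * s) - eig 1) / s) \<longlongrightarrow> \<sigma> * DL_pairing H \<mu>) (at_right 0)"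
proof -
  have h: "0 \<le> h" using nr by (simp add: normalizing_radius_def)
  have range: "0 < 1 + \<sigma> * s" "1 + \<sigma> * s \<le> 2" if "0 \<le> s" "s < 1" for s using \<sigma> that by auto
  define ell where "ell s = (\<lambda>z. L ((1 + \<sigma> * s) *\<^sub>R fst z) (snd z))" for s
  define D where "D z = \<sigma> * ((- fst z) \<bullet> DL (fst z) (snd z))" for z
  have pr: "pairing \<mu> (\<lambda>x v. L ((1 + \<sigma> * s) *\<^sub>R x) v) = integral\<^sup>L \<mu> (ell s)" for \<mu> s
    by (simp add: pairing_def ell_def case_prod_unfold)
  have PD: "prob_on (phase h) \<mu>" if "\<mu> \<in> dual_probs h" for \<mu> using that by (auto simp: G0_dual_def)
  have "\<exists>\<mu>\<in>dual_probs h. integral\<^sup>L \<mu> (ell 0) = - eig (1 + \<sigma> * 0) \<and>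
    (\<forall>\<nu>\<in>dual_probs h. integral\<^sup>L \<nu> (ell 0) = - eig (1 + \<sigma> * 0) \<longrightarrow> integral\<^sup>L \<nu> D \<le> integral\<^sup>L \<mu> D) \<and>
    ((\<lambda>s. (eig (1 + \<sigma> * s) - eig (1 + \<sigma> * 0)) / s) \<longlongrightarrow> integral\<^sup>L \<mu> D) (at_right 0)"
  proof (rule envelope_right_derivative[OF compact_phase zero_less_one PD, where P = "dual_probs h"])
    \<comment> \<open>The dual set is weakly closed, since each constraint is the integral of a
      function continuous on the phase space.\<close>
    fix \<mu> \<nu> assume \<mu>: "\<And>n::nat. \<mu> n \<in> dual_probs h" and \<nu>: "prob_on (phase h) \<nu>"
      and lim: "\<And>f::'a \<times> 'a \<Rightarrow> real. continuous_on (phase h) f \<Longrightarrow> (\<lambda>n. integral\<^sup>L (\<mu> n) f) \<longlonglongrightarrow> integral\<^sup>L \<nu> f"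
    have "0 \<le> pairing \<nu> f" if f: "f \<in> G0 \<Omega> h" for f
      unfolding pairing_def
    proof (rule LIMSEQ_le_const[OF lim])
      show "continuous_on (phase h) (\<lambda>(x, v). f x v)" using f by (simp add: G0_def)
      show "\<exists>N. \<forall>n\<ge>N. 0 \<le> (\<integral>(x, v). f x v \<partial>\<mu> n)" using \<mu> f by (auto simp: G0_dual_def pairing_def)
    qed
    then show "\<nu> \<in> dual_probs h" using \<nu> by (simp add: G0_dual_def prob_space_def)
  next
    show "continuous_on (phase h) (ell s)" if "0 \<le> s" "s < 1" for s
      unfolding ell_def using lagrangian_cont_scaled[of "1 + \<sigma> * s" h] range[OF that] by (simp add: case_prod_unfold)
    have "phase h \<subseteq> cball 0 R0 \<times> cball 0 h"
    proof -
      have "closure \<Omega> \<subseteq> cball 0 R0" using scaled_closure_in[of _ 1] by auto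
      then show ?thesis by auto
    qed
    then have "continuous_on (phase h) (\<lambda>z. DL (fst z) (snd z))"
      using continuous_on_subset[OF DL_cont[of h]] by (simp add: case_prod_unfold)
    then show "continuous_on (phase h) D" unfolding D_def by (intro continuous_intros)
    show "- eig (1 + \<sigma> * s) \<le> integral\<^sup>L \<mu> (ell s)" if "0 \<le> s" "s < 1" "\<mu> \<in> dual_probs h" for s \<mu>
      using dual_prob_lower[OF h range[OF that(1,2)] that(3)] by (simp only: pr)
    show "\<exists>\<mu>\<in>dual_probs h. integral\<^sup>L \<mu> (ell s) = - eig (1 + \<sigma> * s)" if "0 \<le> s" "s < 1" for s
      using dual_prob_attained[OF nr range[OF that]] by (simp only: pr)
    fix \<epsilon> :: real assume "\<epsilon> > 0"
    then obtain \<delta> where \<delta>: "\<delta> > 0" "\<And>s x v. \<bar>s\<bar> < \<delta> \<Longrightarrow> x \<in> closure \<Omega> \<Longrightarrow> v \<in> cball 0 h \<Longrightarrow>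
        \<bar>L ((1 + s) *\<^sub>R x) v - L x v - s * (x \<bullet> DL x v)\<bar> \<le> \<epsilon> * \<bar>s\<bar>"
      using lagrangian_dilation_derivative[of \<epsilon> h] by blast
    have "\<bar>ell s z - ell 0 z + s * D z\<bar> \<le> \<epsilon> * s" if s: "0 < s" "s < \<delta>" and z: "z \<in> phase h" for s z
    proof -
      have as: "\<bar>\<sigma> * s\<bar> = s" using \<sigma> s by auto
      have "\<bar>L ((1 + \<sigma> * s) *\<^sub>R fst z) (snd z) - L (fst z) (snd z) - (\<sigma> * s) * (fst z \<bullet> DL (fst z) (snd z))\<bar> \<le> \<epsilon> * s"
        using \<delta>(2)[of "\<sigma> * s" "fst z" "snd z"] as s z by auto
      then show ?thesis by (simp add: ell_def D_def algebra_simps)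
    qed
    then show "\<exists>\<delta>>0. \<forall>s. 0 < s \<and> s < \<delta> \<longrightarrow> (\<forall>z\<in>phase h. \<bar>ell s z - ell 0 z + s * D z\<bar> \<le> \<epsilon> * s)"
      using \<delta>(1) by blast
  qed
  then obtain \<mu> where \<mu>: "\<mu> \<in> dual_probs h" "integral\<^sup>L \<mu> (ell 0) = - eig 1"
    and max: "\<And>\<nu>. \<nu> \<in> dual_probs h \<Longrightarrow> integral\<^sup>L \<nu> (ell 0) = - eig 1 \<Longrightarrow> integral\<^sup>L \<nu> D \<le> integral\<^sup>L \<mu> D"
    and lim: "((\<lambda>s. (eig (1 + \<sigma> * s) - eig 1) / s) \<longlongrightarrow> integral\<^sup>L \<mu> D) (at_right 0)"
    by auto
  have mather: "\<nu> \<in> mather_measures H \<Omega> h \<longleftrightarrow> \<nu> \<in> dual_probs h \<and> integral\<^sup>L \<nu> (ell 0) = - eig 1" for \<nu>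
    using pr[of \<nu> 0] by (auto simp: mather_measures_def dilate_1)
  have DLp: "integral\<^sup>L \<nu> D = \<sigma> * DL_pairing H \<nu>" if "\<nu> \<in> dual_probs h" for \<nu>
  proof -
    have "sets \<nu> = sets (restrict_space borel (phase h))" using PD[OF that] by blast
    then show ?thesis unfolding D_def by (simp add: DL_pairing_eq)
  qed
  show ?thesis
    using \<mu> max lim DLp mather by (intro bexI[of _ \<mu>]) auto
qed

lemma eigenvalue_quotient_eq: "eigenvalue_quotient H \<Omega> s = (eig (1 + s) - eig 1) / s"
  by (simp add: eigenvalue_quotient_def dilate_1)

text \<open>By monotonicity in the domain the numerator has the sign of \<open>s\<close>; this is
  the source of \<open>c1 >= 0\<close>.\<close>

lemma eigenvalue_quotient_nonneg:
  assumes "-1 < s" "s \<le> 1" shows "0 \<le> eigenvalue_quotient H \<Omega> s"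
  unfolding eigenvalue_quotient_eq
  using eig_mono[of 1 "1 + s"] eig_mono[of "1 + s" 1] assms
  by (cases "s \<ge> 0") (auto intro: divide_nonneg_nonneg divide_nonpos_nonpos)

lemma eigenvalue_quotient_right:
  assumes "normalizing_radius R0 H h"
  shows "\<exists>\<mu>\<in>mather_measures H \<Omega> h. (\<forall>\<nu>\<in>mather_measures H \<Omega> h. DL_pairing H \<nu> \<le> DL_pairing H \<mu>) \<and>
    (eigenvalue_quotient H \<Omega> \<longlongrightarrow> DL_pairing H \<mu>) (at_right 0)"
  using eigenvalue_one_sided_derivative[OF assms, of 1] by (simp add: eigenvalue_quotient_eq[abs_def])

lemma eigenvalue_quotient_left:
  assumes "normalizing_radius R0 H h"
  shows "\<exists>\<mu>\<in>mather_measures H \<Omega> h. (\<forall>\<nu>\<in>mather_measures H \<Omega> h. DL_pairing H \<mu> \<le> DL_pairing H \<nu>) \<and>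
    (eigenvalue_quotient H \<Omega> \<longlongrightarrow> DL_pairing H \<mu>) (at_left 0)"
proof -
  obtain \<mu> where \<mu>: "\<mu> \<in> mather_measures H \<Omega> h"
    and min: "\<And>\<nu>. \<nu> \<in> mather_measures H \<Omega> h \<Longrightarrow> DL_pairing H \<mu> \<le> DL_pairing H \<nu>"
    and lim: "((\<lambda>s. (eig (1 - s) - eig 1) / s) \<longlongrightarrow> - DL_pairing H \<mu>) (at_right 0)"
    using eigenvalue_one_sided_derivative[OF assms, of "-1"] by auto
  \<comment> \<open>The eigenvalue quotient at \<open>- s\<close> is minus this difference
    quotient.\<close>
  have "((\<lambda>s. - ((eig (1 - s) - eig 1) / s)) \<longlongrightarrow> - (- DL_pairing H \<mu>)) (at_right 0)"
    by (rule tendsto_minus[OF lim])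
  then have "((\<lambda>s. eigenvalue_quotient H \<Omega> (- s)) \<longlongrightarrow> DL_pairing H \<mu>) (at_right 0)"
    by (simp add: eigenvalue_quotient_eq)
  then have "(eigenvalue_quotient H \<Omega> \<longlongrightarrow> DL_pairing H \<mu>) (at_left 0)"
    by (simp add: filterlim_at_left_to_right)
  then show ?thesis using \<mu> min by blast
qed

end

text \<open>Necessity is stated for \<open>r\<close> taking both signs arbitrarily close to 0: if
  \<open>r\<close> is nonnegative or nonpositive near 0, one of the one-sided limits already gives
  convergence, whatever the Mather measures are. The constant is nonnegative rather than positive
  because a Hamiltonian independent of \<open>x\<close> has the same eigenvalue on all dilates. The
  formulas hold for every normalizing radius, and existence of one keeps this from being
  vacuous.\<close>

theorem theorem1p4:
  fixes \<Omega> :: "'a::euclidean_space set" and R0 :: real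
    and H :: "'a \<Rightarrow> 'a \<Rightarrow> real" and r :: "real \<Rightarrow> real"
  assumes "open \<Omega>" and "bounded \<Omega>" and "connected \<Omega>" and "0 \<in> \<Omega>"
    and "dilate 2 \<Omega> \<subseteq> ball 0 R0"
    and "continuous_on (cball 0 R0 \<times> UNIV) (\<lambda>(x, p). H x p)"
    and "H1 R0 H" and "H2 R0 H" and "H3 R0 H" and "H4 R0 H" and "A1 \<Omega>"
    and "continuous_on {0<..} r" and "(r \<longlongrightarrow> 0) (at_right 0)"
    and "\<exists>\<^sub>F t in at_right 0. r t \<noteq> 0"
  shows "(\<exists>h. normalizing_radius R0 H h) \<and>
    (\<forall>h. normalizing_radius R0 H h \<longrightarrow>
      (\<exists>\<mu>\<in>mather_measures H \<Omega> h.
         (\<forall>\<nu>\<in>mather_measures H \<Omega> h. DL_pairing H \<nu> \<le> DL_pairing H \<mu>) \<and>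
         ((\<lambda>t. eigenvalue_quotient H \<Omega> (r t)) \<longlongrightarrow> DL_pairing H \<mu>) (at 0 within {t. 0 < t \<and> 0 < r t})) \<and>
      (\<exists>\<mu>\<in>mather_measures H \<Omega> h.
         (\<forall>\<nu>\<in>mather_measures H \<Omega> h. DL_pairing H \<mu> \<le> DL_pairing H \<nu>) \<and>
         ((\<lambda>t. eigenvalue_quotient H \<Omega> (r t)) \<longlongrightarrow> DL_pairing H \<mu>) (at 0 within {t. 0 < t \<and> r t < 0})) \<and>
      ((\<exists>c1\<ge>0. \<forall>\<mu>\<in>mather_measures H \<Omega> h. DL_pairing H \<mu> = c1) \<longrightarrow>
         (\<exists>l. ((\<lambda>t. eigenvalue_quotient H \<Omega> (r t)) \<longlongrightarrow> l) (at 0 within {t. 0 < t \<and> r t \<noteq> 0}))) \<and>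
      ((\<exists>\<^sub>F t in at_right 0. 0 < r t) \<and> (\<exists>\<^sub>F t in at_right 0. r t < 0) \<longrightarrow>
         ((\<exists>l. ((\<lambda>t. eigenvalue_quotient H \<Omega> (r t)) \<longlongrightarrow> l) (at 0 within {t. 0 < t \<and> r t \<noteq> 0})) \<longleftrightarrow>
          (\<exists>c1\<ge>0. \<forall>\<mu>\<in>mather_measures H \<Omega> h. DL_pairing H \<mu> = c1))))"
proof -
  interpret dilated_domains \<Omega> R0 H using assms by unfold_locales
  let ?q = "\<lambda>t. eigenvalue_quotient H \<Omega> (r t)"
  let ?P = "{t. 0 < t \<and> 0 < r t}" and ?N = "{t. 0 < t \<and> r t < 0}" and ?Z = "{t. 0 < t \<and> r t \<noteq> 0}"
  have r0: "(r \<longlongrightarrow> 0) (at 0 within A)" if "A \<subseteq> {0<..}" for A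
    using assms(13) that by (rule tendsto_within_subset)
  have rP: "filterlim r (at_right 0) (at 0 within ?P)"
    unfolding filterlim_at using r0[of ?P] by (auto simp: eventually_at_filter)
  have rN: "filterlim r (at_left 0) (at 0 within ?N)"
    unfolding filterlim_at using r0[of ?N] by (auto simp: eventually_at_filter)
  have ZPN: "?Z = ?P \<union> ?N" by auto
  \<comment> \<open>Along a trivial filter every limit holds; uniqueness of limits needs parameters
    that accumulate at 0.\<close>
  have nontrivial: "at 0 within {t. 0 < t \<and> Q t} \<noteq> bot" if "\<exists>\<^sub>F t in at_right 0. Q t" for Q :: "real \<Rightarrow> bool"
  proof
    assume "at 0 within {t. 0 < t \<and> Q t} = bot"
    then have "\<forall>\<^sub>F t in at 0 within {t. 0 < t \<and> Q t}. False" by simp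
    then have "\<forall>\<^sub>F t in at_right 0. \<not> Q t" by (simp add: eventually_at_filter)
    then show False using that by (simp add: frequently_def)
  qed
  have nonneg: "0 \<le> l" if "(?q \<longlongrightarrow> l) (at 0 within ?Z)" "at 0 within ?Z \<noteq> bot" for l
  proof (rule tendsto_lowerbound[OF that(1) _ that(2)])
    have "\<forall>\<^sub>F t in at 0 within ?Z. -1 < r t" "\<forall>\<^sub>F t in at 0 within ?Z. r t < 1"
      by (rule order_tendstoD[OF r0], auto)+
    then show "\<forall>\<^sub>F t in at 0 within ?Z. 0 \<le> ?q t"
      by eventually_elim (auto intro: eigenvalue_quotient_nonneg)
  qed
  have main: "(\<exists>\<mu>\<in>mather_measures H \<Omega> h.
         (\<forall>\<nu>\<in>mather_measures H \<Omega> h. DL_pairing H \<nu> \<le> DL_pairing H \<mu>) \<and> (?q \<longlongrightarrow> DL_pairing H \<mu>) (at 0 within ?P)) \<and>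
      (\<exists>\<mu>\<in>mather_measures H \<Omega> h.
         (\<forall>\<nu>\<in>mather_measures H \<Omega> h. DL_pairing H \<mu> \<le> DL_pairing H \<nu>) \<and> (?q \<longlongrightarrow> DL_pairing H \<mu>) (at 0 within ?N)) \<and>
      ((\<exists>c1\<ge>0. \<forall>\<mu>\<in>mather_measures H \<Omega> h. DL_pairing H \<mu> = c1) \<longrightarrow> (\<exists>l. (?q \<longlongrightarrow> l) (at 0 within ?Z))) \<and>
      ((\<exists>\<^sub>F t in at_right 0. 0 < r t) \<and> (\<exists>\<^sub>F t in at_right 0. r t < 0) \<longrightarrow>
         ((\<exists>l. (?q \<longlongrightarrow> l) (at 0 within ?Z)) \<longleftrightarrow>
          (\<exists>c1\<ge>0. \<forall>\<mu>\<in>mather_measures H \<Omega> h. DL_pairing H \<mu> = c1)))"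
    if nr: "normalizing_radius R0 H h" for h
  proof -
    obtain \<mu> where \<mu>: "\<mu> \<in> mather_measures H \<Omega> h" "\<And>\<nu>. \<nu> \<in> mather_measures H \<Omega> h \<Longrightarrow> DL_pairing H \<nu> \<le> DL_pairing H \<mu>"
      "(eigenvalue_quotient H \<Omega> \<longlongrightarrow> DL_pairing H \<mu>) (at_right 0)"
      using eigenvalue_quotient_right[OF nr] by blast
    obtain \<nu> where \<nu>: "\<nu> \<in> mather_measures H \<Omega> h" "\<And>\<mu>. \<mu> \<in> mather_measures H \<Omega> h \<Longrightarrow> DL_pairing H \<nu> \<le> DL_pairing H \<mu>"
      "(eigenvalue_quotient H \<Omega> \<longlongrightarrow> DL_pairing H \<nu>) (at_left 0)"
      using eigenvalue_quotient_left[OF nr] by blast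
    have limP: "(?q \<longlongrightarrow> DL_pairing H \<mu>) (at 0 within ?P)" by (rule filterlim_compose[OF \<mu>(3) rP])
    have limN: "(?q \<longlongrightarrow> DL_pairing H \<nu>) (at 0 within ?N)" by (rule filterlim_compose[OF \<nu>(3) rN])
    have suff: "\<exists>l. (?q \<longlongrightarrow> l) (at 0 within ?Z)"
      if "\<exists>c1\<ge>0. \<forall>\<mu>\<in>mather_measures H \<Omega> h. DL_pairing H \<mu> = c1"
    proof -
      have "DL_pairing H \<nu> = DL_pairing H \<mu>" using that \<mu>(1) \<nu>(1) by force
      \<comment> \<open>A limit along a union amounts to the same limit along both parts, also when
        one of them has no points near 0.\<close>
      then have "(?q \<longlongrightarrow> DL_pairing H \<mu>) (at 0 within ?Z)"
        unfolding ZPN at_within_union using limP limN by (simp add: filterlim_sup)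
      then show ?thesis by blast
    qed
    have nec: "\<exists>c1\<ge>0. \<forall>\<mu>\<in>mather_measures H \<Omega> h. DL_pairing H \<mu> = c1"
      if fP: "\<exists>\<^sub>F t in at_right 0. 0 < r t" and fN: "\<exists>\<^sub>F t in at_right 0. r t < 0"
        and l: "(?q \<longlongrightarrow> l) (at 0 within ?Z)" for l
    proof (intro exI[of _ l] conjI ballI)
      have lP: "(?q \<longlongrightarrow> l) (at 0 within ?P)" by (rule tendsto_within_subset[OF l]) auto
      have lN: "(?q \<longlongrightarrow> l) (at 0 within ?N)" by (rule tendsto_within_subset[OF l]) auto
      have eq: "DL_pairing H \<mu> = l" "DL_pairing H \<nu> = l"
        by (rule tendsto_unique[OF nontrivial[OF fP] limP lP], rule tendsto_unique[OF nontrivial[OF fN] limN lN])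
      show "0 \<le> l" by (rule nonneg[OF l nontrivial[OF assms(14)]])
      \<comment> \<open>Every pairing lies between the minimum, attained at \<open>\<nu>\<close>,
        and the maximum, attained at \<open>\<mu>\<close>, and both equal \<open>l\<close>.\<close>
      show "DL_pairing H \<rho> = l" if "\<rho> \<in> mather_measures H \<Omega> h" for \<rho>
        using \<mu>(2)[OF that] \<nu>(2)[OF that] eq by simp
    qed
    show ?thesis
    proof (intro conjI impI)
      show "\<exists>\<mu>\<in>mather_measures H \<Omega> h. (\<forall>\<nu>\<in>mather_measures H \<Omega> h. DL_pairing H \<nu> \<le> DL_pairing H \<mu>) \<and>
          (?q \<longlongrightarrow> DL_pairing H \<mu>) (at 0 within ?P)"
        using \<mu>(1,2) limP by (intro bexI[of _ \<mu>] conjI ballI)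
      show "\<exists>\<mu>\<in>mather_measures H \<Omega> h. (\<forall>\<nu>\<in>mather_measures H \<Omega> h. DL_pairing H \<mu> \<le> DL_pairing H \<nu>) \<and>
          (?q \<longlongrightarrow> DL_pairing H \<mu>) (at 0 within ?N)"
        using \<nu>(1,2) limN by (intro bexI[of _ \<nu>] conjI ballI)
    qed (use suff nec in blast)+
  qed
  show ?thesis by (intro conjI[OF normalizing_radius_exists] allI impI) (rule main)
qed

end
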